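(* Let $n$ be even, $\frac12\le p\le 1$, and let $\lambda$ be a partition of $n$ with $\lambda_1'\le\lambda_1<\frac n2$. Then $\psi_\lambda\le\psi_{[n/2,n/2]}$.
   Context: For even $n$, $p\in[0,1]$ and a partition $\lambda$ of $n$, let $\chi_\lambda$ be the irreducible character of $S_n$ indexed by $\lambda$, $d_\lambda=\chi_\lambda(\mathrm{id})$, and $(1^{n-2s},2^s)$ the conjugacy class of involutions with exactly $s$ two-cycles. Define $$\psi_\lambda=\sum_{s=0}^{n/2}p^{n/2-s}(1-p)^s\binom{n/2}{s}\frac{\chi_\lambda(1^{n-2s},2^s)}{d_\lambda}.$$ $\lambda_1$ is the length of the first row of $\lambda$ and $\lambda_1'$ the length of its first column (number of parts). *)

theory Defs
  imports
    Complex_Main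
    "HOL-Library.FuncSet"
    "HOL-Library.Function_Algebras"
    "HOL-Library.Complex_Order"
    "HOL-Combinatorics.Permutations"
begin

section \<open>Trace of an operator on a finite-dimensional subspace\<close>

context vector_space
begin

definition trace_on :: "'b set \<Rightarrow> ('b \<Rightarrow> 'b) \<Rightarrow> 'a" where
  "trace_on V f =
     (let B = (SOME B. independent B \<and> span B = V)
      in \<Sum>b\<in>B. representation B (f b) b)"

text \<open>The choice of the basis does not matter.\<close>

lemma trace_basis_independent:
  assumes B: "independent B" "finite B" and C: "independent C" "finite C"
    and eq: "span B = span C"
    and f: "module_hom scale scale f" "f ` span B \<subseteq> span B"
  shows "(\<Sum>b\<in>B. representation B (f b) b) = (\<Sum>c\<in>C. representation C (f c) c)"
proof -
  interpret f: module_hom scale scale f by fact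
  have fB: "f x \<in> span B" if "x \<in> span B" for x
    using f(2) that by blast
  have BC: "b \<in> span C" if "b \<in> B" for b using eq span_base that by blast
  have CB: "c \<in> span B" if "c \<in> C" for c using eq span_base that by blast
  have 1: "representation B (f b) b = (\<Sum>c\<in>C. representation C b c * representation B (f c) b)"
    if "b \<in> B" for b
  proof -
    have "b = (\<Sum>c\<in>C. scale (representation C b c) c)"
      using sum_representation_eq[OF C(1) BC[OF that] C(2) order_refl] by simp
    then have "f b = (\<Sum>c\<in>C. scale (representation C b c) (f c))"
      by (metis (no_types, lifting) f.scale f.sum sum.cong)
    then have "representation B (f b) b
        = representation B (\<Sum>c\<in>C. scale (representation C b c) (f c)) b" by simp
    also have "\<dots> = (\<Sum>c\<in>C. representation B (scale (representation C b c) (f c)) b)"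
      by (subst representation_sum[OF B(1)]) (auto intro: span_scale fB CB)
    also have "\<dots> = (\<Sum>c\<in>C. representation C b c * representation B (f c) b)"
      by (intro sum.cong refl, subst representation_scale[OF B(1)]) (auto intro: fB CB)
    finally show ?thesis .
  qed
  have 2: "representation C (f c) c = (\<Sum>b\<in>B. representation B (f c) b * representation C b c)"
    if "c \<in> C" for c
  proof -
    have "f c = (\<Sum>b\<in>B. scale (representation B (f c) b) b)"
      using sum_representation_eq[OF B(1) fB[OF CB[OF that]] B(2) order_refl] by simp
    then have "representation C (f c) c
        = representation C (\<Sum>b\<in>B. scale (representation B (f c) b) b) c" by simp
    also have "\<dots> = (\<Sum>b\<in>B. representation C (scale (representation B (f c) b) b) c)"
      by (subst representation_sum[OF C(1)]) (auto intro: span_scale BC)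
    also have "\<dots> = (\<Sum>b\<in>B. representation B (f c) b * representation C b c)"
      by (intro sum.cong refl, subst representation_scale[OF C(1)]) (auto intro: BC)
    finally show ?thesis .
  qed
  have "(\<Sum>b\<in>B. representation B (f b) b)
      = (\<Sum>b\<in>B. \<Sum>c\<in>C. representation C b c * representation B (f c) b)"
    using 1 by simp
  also have "\<dots> = (\<Sum>c\<in>C. \<Sum>b\<in>B. representation B (f c) b * representation C b c)"
    by (subst sum.swap) (simp add: mult.commute)
  also have "\<dots> = (\<Sum>c\<in>C. representation C (f c) c)"
    using 2 by simp
  finally show ?thesis .
qed

end

text \<open>The complex vector space of all functions from a type to the complex numbers.\<close>

definition fscale :: "complex \<Rightarrow> ('a \<Rightarrow> complex) \<Rightarrow> 'a \<Rightarrow> complex" where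
  "fscale c f = (\<lambda>x. c * f x)"

global_interpretation cfun: vector_space "fscale :: complex \<Rightarrow> ('a \<Rightarrow> complex) \<Rightarrow> 'a \<Rightarrow> complex"
  by unfold_locales (auto simp: fscale_def fun_eq_iff algebra_simps)


section \<open>Partitions, tableaux and Specht modules\<close>

definition partition_of :: "nat \<Rightarrow> nat list \<Rightarrow> bool" where
  "partition_of n lam \<longleftrightarrow> sorted_wrt (\<ge>) lam \<and> 0 \<notin> set lam \<and> sum_list lam = n"

definition first_row :: "nat list \<Rightarrow> nat" where
  "first_row lam = (case lam of [] \<Rightarrow> 0 | a # _ \<Rightarrow> a)"

definition first_col :: "nat list \<Rightarrow> nat" where
  "first_col lam = length lam"

definition cells :: "nat list \<Rightarrow> (nat \<times> nat) set" where
  "cells lam = {(i, j). i < length lam \<and> j < lam ! i}"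

text \<open>
  The symmetric group \<open>S\<^sub>n\<close> consists of the permutations of \<open>{..<n}\<close>.  A tableau \<open>t\<close> sends each
  entry to the cell (row, column) that contains it.  A tabloid is represented by the function
  sending each entry to its row, and \<open>\<pi>\<close> acts on tabloids by \<open>r \<mapsto> r \<circ> inv \<pi>\<close>.
\<close>

definition tableaux :: "nat \<Rightarrow> nat list \<Rightarrow> (nat \<Rightarrow> nat \<times> nat) set" where
  "tableaux n lam = {t. bij_betw t {..<n} (cells lam)}"

definition tabloid :: "nat \<Rightarrow> (nat \<Rightarrow> nat \<times> nat) \<Rightarrow> nat \<Rightarrow> nat" where
  "tabloid n t = restrict (fst \<circ> t) {..<n}"

definition col_stabilizer :: "nat \<Rightarrow> (nat \<Rightarrow> nat \<times> nat) \<Rightarrow> (nat \<Rightarrow> nat) set" where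
  "col_stabilizer n t = {\<pi>. \<pi> permutes {..<n} \<and> (\<forall>x<n. snd (t (\<pi> x)) = snd (t x))}"

text \<open>
  Formal complex linear combinations of tabloids are functions on tabloids; a single tabloid \<open>r\<close>
  is the indicator function of \<open>{r}\<close>.
\<close>

definition polytabloid :: "nat \<Rightarrow> (nat \<Rightarrow> nat \<times> nat) \<Rightarrow> (nat \<Rightarrow> nat) \<Rightarrow> complex" where
  "polytabloid n t =
     (\<Sum>\<pi>\<in>col_stabilizer n t.
        fscale (of_int (sign \<pi>)) (\<lambda>r. if r = tabloid n t \<circ> inv \<pi> then 1 else 0))"

definition specht :: "nat \<Rightarrow> nat list \<Rightarrow> ((nat \<Rightarrow> nat) \<Rightarrow> complex) set" where
  "specht n lam = cfun.span (polytabloid n ` tableaux n lam)"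

text \<open>
  The linear extension of \<open>r \<mapsto> r \<circ> inv \<sigma>\<close>: the coefficient of \<open>r\<close> in \<open>\<sigma> v\<close> is the
  coefficient of \<open>r \<circ> \<sigma>\<close> in \<open>v\<close>.
\<close>

definition act :: "(nat \<Rightarrow> nat) \<Rightarrow> ((nat \<Rightarrow> nat) \<Rightarrow> complex) \<Rightarrow> (nat \<Rightarrow> nat) \<Rightarrow> complex" where
  "act \<sigma> v = (\<lambda>r. v (r \<circ> \<sigma>))"

text \<open>
  Over the complex numbers the Specht modules are the irreducible representations of \<open>S\<^sub>n\<close>,
  in the labelling for which \<open>[n]\<close> is the trivial and \<open>[1, \<dots>, 1]\<close> the sign representation.
\<close>

definition irr_char :: "nat \<Rightarrow> nat list \<Rightarrow> (nat \<Rightarrow> nat) \<Rightarrow> complex" where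
  "irr_char n lam \<sigma> = cfun.trace_on (specht n lam) (act \<sigma>)"

definition irr_dim :: "nat \<Rightarrow> nat list \<Rightarrow> complex" where
  "irr_dim n lam = irr_char n lam id"

lemma act_tabloid:
  assumes "bij \<sigma>"
  shows "act \<sigma> (\<lambda>r'. if r' = r then 1 else 0) = (\<lambda>r'. if r' = r \<circ> inv \<sigma> then 1 else 0)"
proof -
  have "r' \<circ> \<sigma> = r \<longleftrightarrow> r' = r \<circ> inv \<sigma>" for r'
    using assms by (metis bij_is_inj bij_is_surj comp_assoc comp_id inv_o_cancel surj_iff)
  then show ?thesis by (simp add: act_def)
qed

lemma act_hom: "module_hom fscale fscale (act \<sigma>)"
  by (rule module_hom.intro) (auto simp: act_def fscale_def module_hom_axioms_def cfun.module_axioms)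


section \<open>The eigenvalue\<close>

text \<open>A representative of the conjugacy class \<open>(1\<^bsup>n-2s\<^esup>, 2\<^bsup>s\<^esup>)\<close>: the product of the transpositions
  \<open>(0 1), (2 3), \<dots>, (2s-2 2s-1)\<close>.\<close>

definition involution :: "nat \<Rightarrow> nat \<Rightarrow> nat" where
  "involution s i = (if i < 2 * s then (if even i then i + 1 else i - 1) else i)"

lemma involution_involution: "involution s (involution s i) = i"
  by (auto simp: involution_def elim!: oddE evenE)

lemma involution_permutes:
  assumes "2 * s \<le> n"
  shows "involution s permutes {..<n}"
proof -
  have "bij (involution s)"
    by (rule o_bij[of "involution s"]) (auto simp: fun_eq_iff involution_involution)
  moreover have "involution s x = x" if "x \<notin> {..<n}" for x
    using that assms by (auto simp: involution_def)
  ultimately show ?thesis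
    by (auto simp: permutes_def bij_iff)
qed

lemma card_moved_involution: "card {i. involution s i \<noteq> i} = 2 * s"
proof -
  have "{i. involution s i \<noteq> i} = {..<2 * s}"
    by (auto simp: involution_def elim!: oddE)
  then show ?thesis by simp
qed

definition psi :: "nat \<Rightarrow> real \<Rightarrow> nat list \<Rightarrow> complex" where
  "psi n p lam =
     (\<Sum>s = 0..n div 2.
        of_real (p ^ (n div 2 - s) * (1 - p) ^ s * real ((n div 2) choose s))
          * (irr_char n lam (involution s) / irr_dim n lam))"

end

theory Submission
  imports Defs
begin

text \<open>
  Put \<open>q = 2p - 1\<close> and \<open>n = 2m\<close>.  The product of the commuting elements \<open>p + (1 - p) (2i 2i+1)\<close> of the
  group algebra has normalised trace \<open>\<psi>\<^sub>\<lambda>\<close> on the Specht module, and restricting step by step to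
  \<open>S\<^bsub>n-2\<^esub> \<times> S\<^sub>2\<close> shows that \<open>d\<^sub>\<lambda> \<psi>\<^sub>\<lambda>\<close> is the sum of \<open>q\<close> to the number of odd descents over all standard
  tableaux of shape \<open>\<lambda>\<close>.  The branching rule comes from identifying the Specht module with the
  vectors of weight \<open>\<lambda>\<close> in \<open>(\<complex>\<^sup>L)\<^bsup>\<otimes>n\<^esup>\<close> that are killed by all raising operators: stripping off tensor
  factors bounds the dimension of that space from above, James' argument with polytabloids bounds
  the dimension of the Specht module from below, and the two bounds agree.

  For \<open>m \<ge> 3\<close> induction on \<open>m\<close> shows the stronger statement that \<open>\<psi>\<^sub>\<lambda>\<close> is at most the value at the
  two-row shape with first row \<open>max \<lambda>\<^sub>1 m\<close>.  Among shapes with a given first row \<open>\<lambda>\<^sub>1 \<ge> m\<close> the two-row shape has the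
  smallest proportion of tableaux with last entry in the first row and the smallest proportion
  with a descent in the last step; both comparisons are inductions on the size.
  Since the two-row values increase with \<open>\<lambda>\<^sub>1\<close> once \<open>m \<ge> 3\<close> (this fails for \<open>m = 2\<close> and small \<open>q\<close>),
  the two comparisons combine to the induction step.
\<close>

section \<open>Traces along filtrations\<close>

text \<open>The claim for first rows shorter than half of the size is not inductive: removing two
  cells below the first row keeps that row but lowers half of the size by one, so the first row can
  reach half of the size and then exceed it. Shapes with long first rows are therefore part of the
  statement, and they force the two-row values to be monotone. The eigenvalues of p + (1 - p) (2i
  2i+1) are 1 and q, whence the weight q per descent. For two rows, removing two cells follows the
  recursion for the coefficients of (x + (1 + q) + 1/x)^m with a reflection at the boundary, and q =
  1 gives the dimensions. Monotonicity becomes a bound on ratios of neighbouring coefficients. In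
  the branching rule for a transposition the obstacle is a vertical pair of cells at the end of two
  equal rows. It can be removed in one order only, so the symmetric combination of the two
  strippings must vanish: it is a highest weight vector that is also raised from another vector,
  hence orthogonal to itself. Last-step descents have no evident recursion; since transpositions are
  conjugate, their number can also be read off at (0 1), which survives restriction.\<close>

locale vector_space_trace = vector_space
begin

text \<open>The ambient function spaces are infinite-dimensional, so finiteness is carried by the
  subspace. Asking only for containment in a finite span makes the property pass to subspaces at
  once.\<close>

definition fin_subspace :: "'b set \<Rightarrow> bool" where
  "fin_subspace V \<longleftrightarrow> subspace V \<and> (\<exists>S. finite S \<and> V \<subseteq> span S)"

lemma fin_subspaceD: "fin_subspace V \<Longrightarrow> subspace V"
  by (simp add: fin_subspace_def)

lemma fin_subspace_mono: "fin_subspace V \<Longrightarrow> subspace U \<Longrightarrow> U \<subseteq> V \<Longrightarrow> fin_subspace U"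
  unfolding fin_subspace_def by blast

lemma fin_subspace_finite:
  assumes "fin_subspace V" "B \<subseteq> V" "independent B"
  shows "finite B"
  using assms independent_span_bound unfolding fin_subspace_def by (meson order_trans)

lemma fin_subspace_extend:
  assumes "fin_subspace V" "S \<subseteq> V" "independent S"
  obtains B where "S \<subseteq> B" "finite B" "independent B" "span B = V"
proof -
  obtain B where B: "S \<subseteq> B" "B \<subseteq> V" "independent B" "V \<subseteq> span B"
    using maximal_independent_subset_extend[OF assms(2,3)] .
  have "finite B" using fin_subspace_finite assms(1) B by blast
  moreover have "span B = V"
    using B fin_subspaceD[OF assms(1)] by (simp add: span_minimal subset_antisym)
  ultimately show ?thesis using that B by blast
qed

lemma fin_subspace_basis:
  assumes "fin_subspace V"
  obtains B where "finite B" "independent B" "span B = V"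
  using fin_subspace_extend[OF assms, of "{}"] by (auto simp: independent_empty)

lemma fin_subspace_span: "finite B \<Longrightarrow> fin_subspace (span B)"
  unfolding fin_subspace_def by blast

lemma trace_on_basis:
  assumes "independent B" "finite B" "module_hom scale scale f" "f ` span B \<subseteq> span B"
  shows "trace_on (span B) f = (\<Sum>b\<in>B. representation B (f b) b)"
proof -
  define C where "C = (SOME C. independent C \<and> span C = span B)"
  have C: "independent C \<and> span C = span B"
    unfolding C_def by (rule someI[of _ B]) (use assms in simp)
  have "finite C"
    using fin_subspace_finite[OF fin_subspace_span[OF assms(2)], of C] C span_superset by blast
  then show ?thesis
    unfolding trace_on_def Let_def C_def[symmetric]
    using trace_basis_independent[of C B f] C assms by auto
qed

lemma trace_on_scale:
  assumes "fin_subspace V" "module_hom scale scale f" "f ` V \<subseteq> V"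
  shows "trace_on V (\<lambda>v. scale c (f v)) = c * trace_on V f"
proof -
  interpret f: module_hom scale scale f by fact
  obtain B where B: "finite B" "independent B" "span B = V" using fin_subspace_basis assms(1) .
  have hom: "module_hom scale scale (\<lambda>v. scale c (f v))"
    by unfold_locales (simp_all add: f.add f.scale scale_right_distrib scale_scale mult.commute)
  have inv: "(\<lambda>v. scale c (f v)) ` span B \<subseteq> span B"
    using assms(3) B(3) by (auto intro: span_scale)
  have "trace_on V (\<lambda>v. scale c (f v)) = (\<Sum>b\<in>B. representation B (scale c (f b)) b)"
    using trace_on_basis[OF B(2,1) hom inv] B(3) by simp
  also have "\<dots> = (\<Sum>b\<in>B. c * representation B (f b) b)"
    by (intro sum.cong refl, subst representation_scale[OF B(2)])
       (use assms(3) B(3) span_base in auto)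
  also have "\<dots> = c * trace_on V f"
    using trace_on_basis[OF B(2,1) assms(2)] assms(3) B(3) by (simp add: sum_distrib_left)
  finally show ?thesis .
qed

lemma trace_on_id:
  assumes "fin_subspace V"
  shows "trace_on V (\<lambda>v. v) = of_nat (dim V)"
proof -
  obtain B where B: "finite B" "independent B" "span B = V" using fin_subspace_basis assms .
  have "module_hom scale scale (\<lambda>v. v)" by unfold_locales auto
  then have "trace_on V (\<lambda>v. v) = (\<Sum>b\<in>B. representation B b b)"
    using trace_on_basis[OF B(2,1), of "\<lambda>v. v"] B(3) by simp
  also have "\<dots> = (\<Sum>b\<in>B. 1)"
    by (intro sum.cong refl) (simp add: representation_basis[OF B(2)])
  finally show ?thesis using dim_span_eq_card_independent[OF B(2)] B(3) by simp
qed

lemma trace_on_zero_space [simp]: "trace_on {0} f = 0"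
proof -
  have *: "B = {}" if "independent B" "span B = {0}" for B
  proof -
    have "B \<subseteq> {0}" using that(2) span_superset[of B] by simp
    moreover have "0 \<notin> B" using that(1) dependent_zero by metis
    ultimately show ?thesis by blast
  qed
  have "(SOME B. independent B \<and> span B = {0}) = {}"
    by (rule *) (use someI[of "\<lambda>B. independent B \<and> span B = {0}" "{}"] in
      \<open>simp_all add: independent_empty\<close>)
  then show ?thesis by (simp add: trace_on_def)
qed

lemma fin_subspace_zero: "fin_subspace {0}"
  unfolding fin_subspace_def by (auto simp: subspace_single_0 intro: exI[of _ "{}"])

lemma dim_zero_space: "dim {0} = 0"
  using dim_span_eq_card_independent[of "{}"] by (simp add: independent_empty)

text \<open>In a basis of the kernel extended to \<open>V\<close> the matrix of \<open>f\<close> is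
  block triangular; \<theta> carries the added vectors to a basis of the image, so the second
  diagonal block is the matrix of \<open>g\<close>.\<close>

lemma trace_exact:
  assumes V: "fin_subspace V"
    and f: "module_hom scale scale f" "f ` V \<subseteq> V"
    and th: "module_hom scale scale \<theta>"
    and g: "module_hom scale scale g"
    and comm: "\<And>v. v \<in> V \<Longrightarrow> \<theta> (f v) = g (\<theta> v)"
  shows "trace_on V f = trace_on {v \<in> V. \<theta> v = 0} f + trace_on (\<theta> ` V) g"
    and "dim V = dim {v \<in> V. \<theta> v = 0} + dim (\<theta> ` V)"
    and "fin_subspace {v \<in> V. \<theta> v = 0}" and "fin_subspace (\<theta> ` V)"
proof -
  interpret f: module_hom scale scale f by fact
  interpret th: module_hom scale scale \<theta> by fact
  interpret g: module_hom scale scale g by fact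
  let ?K = "{v \<in> V. \<theta> v = 0}"
  have sV: "subspace V" using V by (rule fin_subspaceD)
  have sK: "subspace ?K"
    using sV unfolding subspace_def by (auto simp: th.add th.scale)
  show K: "fin_subspace ?K" using fin_subspace_mono[OF V sK] by blast
  obtain B where B: "finite B" "independent B" "span B = ?K" using fin_subspace_basis[OF K] .
  have "B \<subseteq> V" using B(3) span_superset by blast
  then obtain D where D: "B \<subseteq> D" "finite D" "independent D" "span D = V"
    using fin_subspace_extend[OF V _ B(2)] by blast
  define C where "C = D - B"
  have fC: "finite C" and CD: "C \<subseteq> D" using D C_def by auto
  have DBC: "D = B \<union> C" "B \<inter> C = {}" using D C_def by auto
  have iC: "independent C" using independent_mono[OF D(3) CD] .
  have BK: "\<theta> b = 0" if "b \<in> B" for b using B(3) span_base that by blast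
  \<comment> \<open>A vector of \<open>span C\<close> in the kernel also lies in
    \<open>span B\<close>; in the common basis \<open>D\<close> its coordinates vanish both outside
    \<open>C\<close> and outside \<open>B\<close>.\<close>
  have inj: "x = 0" if "x \<in> span C" "\<theta> x = 0" for x
  proof -
    have "x \<in> V" using that(1) D(4) CD span_mono by blast
    then have "x \<in> span B" using B(3) that by simp
    have "representation D x b = 0" for b
    proof (cases "b \<in> C")
      case True
      then show ?thesis
        using representation_extend[OF D(3) \<open>x \<in> span B\<close> D(1)] DBC
        by (metis (full_types) disjoint_iff representation_ne_zero)
    next
      case False
      then show ?thesis
        using representation_extend[OF D(3) that(1) CD]
        by (metis (full_types) representation_ne_zero)
    qed
    moreover have "(\<Sum>b\<in>D. scale (representation D x b) b) = x"
      by (rule sum_representation_eq[OF D(3)]) (use \<open>x \<in> V\<close> D in auto)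
    ultimately show "x = 0" by simp
  qed
  have injon: "inj_on \<theta> (span C)"
  proof (rule inj_onI)
    fix x y assume "x \<in> span C" "y \<in> span C" "\<theta> x = \<theta> y"
    then have "x - y = 0" using inj[of "x - y"] by (simp add: span_diff th.diff)
    then show "x = y" by simp
  qed
  have injC: "inj_on \<theta> C" using injon inj_on_subset span_superset by blast
  have imV: "\<theta> ` V = span (\<theta> ` C)"
  proof -
    have "\<theta> ` V = span (\<theta> ` D)" using th.span_image[of D] D(4) by simp
    also have "\<theta> ` D - {0} = \<theta> ` C - {0}"
      using DBC BK by auto
    then have "span (\<theta> ` D) = span (\<theta> ` C)"
      by (metis span_delete_0)
    finally show ?thesis .
  qed
  have iTC: "independent (\<theta> ` C)"
    using th.dependent_inj_imageD iC injon by blast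
  show W: "fin_subspace (\<theta> ` V)" unfolding imV by (rule fin_subspace_span) (use fC in simp)
  have "dim V = card D" using dim_span_eq_card_independent[OF D(3)] D(4) by simp
  also have "\<dots> = card B + card C" using DBC B(1) fC by (simp add: card_Un_disjoint)
  also have "card B = dim ?K" using dim_span_eq_card_independent[OF B(2)] B(3) by simp
  also have "card C = dim (\<theta> ` V)"
    using dim_span_eq_card_independent[OF iTC] imV card_image[OF injC] by simp
  finally show "dim V = dim ?K + dim (\<theta> ` V)" .
  have fK: "f ` ?K \<subseteq> ?K" using f(2) comm by auto
  have gW: "g ` (\<theta> ` V) \<subseteq> \<theta> ` V"
    using f(2) comm[symmetric] by force
  have 1: "representation D (f b) b = representation B (f b) b" if "b \<in> B" for b
  proof -
    have "f b \<in> span B" using B(3) fK span_base that by blast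
    then show ?thesis using representation_extend[OF D(3) _ D(1)] by simp
  qed
  have 2: "representation D (f c) c = representation (\<theta> ` C) (g (\<theta> c)) (\<theta> c)" if c: "c \<in> C" for c
  proof -
    have cV: "c \<in> V" using c CD D(4) span_base by blast
    then have fcV: "f c \<in> span D" using f(2) D(4) by blast
    have e: "f c = (\<Sum>b\<in>D. scale (representation D (f c) b) b)"
      using sum_representation_eq[OF D(3) fcV D(2) order_refl] by simp
    have "g (\<theta> c) = \<theta> (f c)" using comm cV by simp
    also have "\<dots> = \<theta> (\<Sum>b\<in>D. scale (representation D (f c) b) b)" using e by simp
    also have "\<dots> = (\<Sum>b\<in>D. scale (representation D (f c) b) (\<theta> b))"
      by (simp add: th.sum th.scale)
    also have "\<dots> = (\<Sum>b\<in>C. scale (representation D (f c) b) (\<theta> b))"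
      by (rule sum.mono_neutral_right) (use D(2) CD BK DBC in auto)
    finally have "representation (\<theta> ` C) (g (\<theta> c)) (\<theta> c)
       = representation (\<theta> ` C) (\<Sum>b\<in>C. scale (representation D (f c) b) (\<theta> b)) (\<theta> c)" by simp
    also have "\<dots> = (\<Sum>b\<in>C. representation (\<theta> ` C) (scale (representation D (f c) b) (\<theta> b)) (\<theta> c))"
      by (subst representation_sum[OF iTC]) (auto intro: span_scale span_base)
    also have "\<dots> = (\<Sum>b\<in>C. representation D (f c) b * representation (\<theta> ` C) (\<theta> b) (\<theta> c))"
      by (intro sum.cong refl, subst representation_scale[OF iTC]) (auto intro: span_base)
    also have "\<dots> = (\<Sum>b\<in>C. representation D (f c) b * (if b = c then 1 else 0))"
      by (intro sum.cong refl)
         (use c inj_onD[OF injC] in \<open>auto simp: representation_basis[OF iTC]\<close>)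
    also have "\<dots> = representation D (f c) c" using c fC by (simp add: if_distrib cong: if_cong)
    finally show ?thesis by simp
  qed
  have "trace_on V f = (\<Sum>b\<in>D. representation D (f b) b)"
    using trace_on_basis[OF D(3,2) f(1)] f(2) D(4) by simp
  also have "\<dots> = (\<Sum>b\<in>B. representation D (f b) b) + (\<Sum>b\<in>C. representation D (f b) b)"
    unfolding DBC(1) by (rule sum.union_disjoint) (use B(1) fC DBC in auto)
  also have "(\<Sum>b\<in>B. representation D (f b) b) = trace_on ?K f"
    using 1 trace_on_basis[OF B(2,1) f(1)] fK B(3) by simp
  also have "(\<Sum>b\<in>C. representation D (f b) b)
      = (\<Sum>c\<in>C. representation (\<theta> ` C) (g (\<theta> c)) (\<theta> c))" using 2 by simp
  also have "\<dots> = (\<Sum>w\<in>\<theta> ` C. representation (\<theta> ` C) (g w) w)"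
    by (simp add: sum.reindex[OF injC])
  also have "\<dots> = trace_on (\<theta> ` V) g"
    using trace_on_basis[OF iTC _ g] fC gW imV by simp
  finally show "trace_on V f = trace_on ?K f + trace_on (\<theta> ` V) g" .
qed

section \<open>Dimension counts and filtrations by kernels\<close>

lemma dim_subspace_mono:
  assumes "fin_subspace V" "subspace U" "U \<subseteq> V"
  shows "dim U \<le> dim V"
    and "dim V \<le> dim U \<Longrightarrow> U = V"
proof -
  have "fin_subspace U" using fin_subspace_mono assms .
  then obtain B where B: "finite B" "independent B" "span B = U" using fin_subspace_basis by blast
  then have "B \<subseteq> V" using assms span_superset by blast
  then obtain D where D: "B \<subseteq> D" "finite D" "independent D" "span D = V"
    using fin_subspace_extend[OF assms(1) _ B(2)] by blast
  have U: "dim U = card B" using dim_span_eq_card_independent B by metis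
  have W: "dim V = card D" using dim_span_eq_card_independent D by metis
  show "dim U \<le> dim V" using U W D card_mono by metis
  show "U = V" if "dim V \<le> dim U"
    using U W D B that card_seteq by metis
qed

text \<open>The case of \<open>trace_exact\<close> with zero kernel, where the image is
  \<open>V\<close> again.\<close>

lemma trace_conj:
  assumes V: "fin_subspace V" and f: "module_hom scale scale f" "f ` V \<subseteq> V"
    and h: "module_hom scale scale h" "h ` V = V" "\<And>v. v \<in> V \<Longrightarrow> h v = 0 \<Longrightarrow> v = 0"
    and g: "module_hom scale scale g" "\<And>v. v \<in> V \<Longrightarrow> h (f v) = g (h v)"
  shows "trace_on V f = trace_on V g"
proof -
  have "h 0 = 0" using h(1) module_hom.zero by blast
  then have "{v \<in> V. h v = 0} = {0}" using h(3) fin_subspaceD[OF V] subspace_0 by auto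
  then show ?thesis using trace_exact(1)[OF V f h(1) g] h(2) by simp
qed

text \<open>
  Peeling off the maps \<open>\<theta> x\<close> in order of decreasing rank filters \<open>V\<close> by their kernels, with
  successive quotients embedded in the \<open>W x\<close>.  A dimension count then makes the embeddings onto.
\<close>

lemma finite_max_rank:
  assumes "finite I" "I \<noteq> {}"
  obtains x where "x \<in> I" "\<And>y. y \<in> I \<Longrightarrow> (rk y :: nat) \<le> rk x"
proof -
  have "Max (rk ` I) \<in> rk ` I" using assms by simp
  then obtain x where "x \<in> I" "rk x = Max (rk ` I)" by auto
  then show ?thesis using that[of x] assms(1) by simp
qed

lemma dim_filtration_le:
  assumes "finite I" "fin_subspace V"
    and "\<And>x. x \<in> I \<Longrightarrow> module_hom scale scale (\<theta> x)"
    and "\<And>x. x \<in> I \<Longrightarrow> fin_subspace (W x)"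
    and "\<And>x v. x \<in> I \<Longrightarrow> v \<in> V \<Longrightarrow> (\<And>y. y \<in> I \<Longrightarrow> rk x < (rk y :: nat) \<Longrightarrow> \<theta> y v = 0) \<Longrightarrow> \<theta> x v \<in> W x"
    and "\<And>v. v \<in> V \<Longrightarrow> (\<And>x. x \<in> I \<Longrightarrow> \<theta> x v = 0) \<Longrightarrow> v = 0"
  shows "dim V \<le> (\<Sum>x\<in>I. dim (W x))"
  using assms
proof (induction "card I" arbitrary: I V)
  case 0
  then have "V = {0}" using fin_subspaceD subspace_0 by fastforce
  then show ?case using dim_zero_space by simp
next
  case (Suc c)
  have ne: "I \<noteq> {}" using Suc.hyps by auto
  obtain x where x: "x \<in> I" "\<And>y. y \<in> I \<Longrightarrow> rk y \<le> rk x"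
    using finite_max_rank[OF Suc.prems(1) ne, of rk] by blast
  have id: "module_hom scale scale (\<lambda>v. v)" by unfold_locales auto
  let ?K = "{v \<in> V. \<theta> x v = 0}"
  note ex = trace_exact[OF Suc.prems(2) id _ Suc.prems(3)[OF x(1)] id, simplified]
  \<comment> \<open>No index has larger rank than \<open>x\<close>, so the condition on
    \<open>v\<close> in the hypothesis about \<open>W x\<close> is vacuous.\<close>
  have "\<theta> x ` V \<subseteq> W x"
    using Suc.prems(5)[OF x(1)] x(2) by (auto simp: leD)
  then have 1: "dim (\<theta> x ` V) \<le> dim (W x)"
    using dim_subspace_mono(1)[OF Suc.prems(4)[OF x(1)]] ex(4) fin_subspaceD by blast
  have 2: "dim ?K \<le> (\<Sum>y\<in>I - {x}. dim (W y))"
  proof (rule Suc.hyps(1))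
    show "c = card (I - {x})" using Suc.hyps(2) x Suc.prems(1) by simp
    show "\<theta> y v \<in> W y" if "y \<in> I - {x}" "v \<in> ?K"
      "\<And>z. z \<in> I - {x} \<Longrightarrow> rk y < rk z \<Longrightarrow> \<theta> z v = 0" for y v
      using Suc.prems(5)[of y v] that by blast
    show "v = 0" if "v \<in> ?K" "\<And>z. z \<in> I - {x} \<Longrightarrow> \<theta> z v = 0" for v
      using Suc.prems(6)[of v] that by blast
  qed (use Suc.prems(1,3,4) ex(3) in auto)
  show ?case using ex(2) 1 2 sum.remove[OF Suc.prems(1) x(1), of "\<lambda>x. dim (W x)"] by simp
qed

lemma trace_filtration:
  assumes "finite I" "fin_subspace V"
    and "\<And>x. x \<in> I \<Longrightarrow> module_hom scale scale (\<theta> x)"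
    and "\<And>x. x \<in> I \<Longrightarrow> fin_subspace (W x)"
    and "\<And>x v. x \<in> I \<Longrightarrow> v \<in> V \<Longrightarrow> (\<And>y. y \<in> I \<Longrightarrow> rk x < (rk y :: nat) \<Longrightarrow> \<theta> y v = 0) \<Longrightarrow> \<theta> x v \<in> W x"
    and "\<And>v. v \<in> V \<Longrightarrow> (\<And>x. x \<in> I \<Longrightarrow> \<theta> x v = 0) \<Longrightarrow> v = 0"
    and "module_hom scale scale f" "f ` V \<subseteq> V"
    and "\<And>x. x \<in> I \<Longrightarrow> module_hom scale scale (g x)"
    and "\<And>x v. x \<in> I \<Longrightarrow> v \<in> V \<Longrightarrow> \<theta> x (f v) = g x (\<theta> x v)"
    and "(\<Sum>x\<in>I. dim (W x)) \<le> dim V"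
  shows "trace_on V f = (\<Sum>x\<in>I. trace_on (W x) (g x))"
  using assms
proof (induction "card I" arbitrary: I V)
  case 0
  then have "V = {0}" using fin_subspaceD subspace_0 by fastforce
  then show ?case using 0 by simp
next
  case (Suc c)
  have ne: "I \<noteq> {}" using Suc.hyps by auto
  obtain x where x: "x \<in> I" "\<And>y. y \<in> I \<Longrightarrow> rk y \<le> rk x"
    using finite_max_rank[OF Suc.prems(1) ne, of rk] by blast
  let ?K = "{v \<in> V. \<theta> x v = 0}"
  note ex = trace_exact[OF Suc.prems(2,7,8) Suc.prems(3)[OF x(1)] Suc.prems(9)[OF x(1)] Suc.prems(10)[OF x(1)]]
  have sub: "\<theta> x ` V \<subseteq> W x"
    using Suc.prems(5)[OF x(1)] x(2) by (auto simp: leD)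
  have 1: "dim (\<theta> x ` V) \<le> dim (W x)"
    using dim_subspace_mono(1)[OF Suc.prems(4)[OF x(1)]] ex(4) fin_subspaceD sub by blast
  have c: "c = card (I - {x})" using Suc.hyps(2) x Suc.prems(1) by simp
  have W: "\<theta> y v \<in> W y" if "y \<in> I - {x}" "v \<in> ?K"
      "\<And>z. z \<in> I - {x} \<Longrightarrow> rk y < rk z \<Longrightarrow> \<theta> z v = 0" for y v
    using Suc.prems(5)[of y v] that by blast
  have Z: "v = 0" if "v \<in> ?K" "\<And>z. z \<in> I - {x} \<Longrightarrow> \<theta> z v = 0" for v
    using Suc.prems(6)[of v] that by blast
  have 2: "dim ?K \<le> (\<Sum>y\<in>I - {x}. dim (W y))"
  proof (rule dim_filtration_le[where rk = rk and \<theta> = \<theta>, OF _ ex(3)])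
    show "\<theta> y v \<in> W y" if "y \<in> I - {x}" "v \<in> ?K"
      "\<And>z. z \<in> I - {x} \<Longrightarrow> rk y < rk z \<Longrightarrow> \<theta> z v = 0" for y v
      using W that .
    show "v = 0" if "v \<in> ?K" "\<And>z. z \<in> I - {x} \<Longrightarrow> \<theta> z v = 0" for v
      using Z that .
  qed (use Suc.prems(1,3,4) in auto)
  have s: "(\<Sum>y\<in>I. dim (W y)) = dim (W x) + (\<Sum>y\<in>I - {x}. dim (W y))"
    using sum.remove[OF Suc.prems(1) x(1)] .
  \<comment> \<open>There is no slack: the dimension of the kernel is at most the sum over the other
    \<open>W y\<close>, so the image must fill \<open>W x\<close>.\<close>
  have "\<theta> x ` V = W x"
  proof (rule dim_subspace_mono(2)[OF Suc.prems(4)[OF x(1)] fin_subspaceD[OF ex(4)] sub])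
    have "dim V = dim ?K + dim (\<theta> x ` V)" by (rule ex(2))
    moreover have "(\<Sum>y\<in>I. dim (W y)) \<le> dim V" by (rule Suc.prems(11))
    ultimately show "dim (W x) \<le> dim (\<theta> x ` V)" using s 2 by linarith
  qed
  moreover have "trace_on ?K f = (\<Sum>y\<in>I - {x}. trace_on (W y) (g y))"
  proof (rule Suc.hyps(1)[OF c _ ex(3)])
    show "f ` ?K \<subseteq> ?K"
      using Suc.prems(8) Suc.prems(10)[OF x(1)] module_hom.zero[OF Suc.prems(9)[OF x(1)]] by auto
    show "(\<Sum>y\<in>I - {x}. dim (W y)) \<le> dim ?K"
      using s 1 ex(2) Suc.prems(11) by linarith
    show "\<theta> y v \<in> W y" if "y \<in> I - {x}" "v \<in> ?K"
      "\<And>z. z \<in> I - {x} \<Longrightarrow> rk y < rk z \<Longrightarrow> \<theta> z v = 0" for y v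
      using W that .
    show "v = 0" if "v \<in> ?K" "\<And>z. z \<in> I - {x} \<Longrightarrow> \<theta> z v = 0" for v
      using Z that .
  qed (use Suc.prems(1,3,4,7,9,10) in auto)
  ultimately show ?case
    using ex(1) sum.remove[OF Suc.prems(1) x(1), of "\<lambda>y. trace_on (W y) (g y)"] by simp
qed

text \<open>Preimages have to be killed by all maps of larger rank. The ranks are distinct so that,
  once \<open>x\<close> is peeled off, every remaining \<open>W y\<close> is reached from the kernel
  of \<open>\<theta> x\<close>.\<close>

lemma dim_filtration_ge:
  assumes "finite I" "fin_subspace V"
    and "\<And>x. x \<in> I \<Longrightarrow> module_hom scale scale (\<theta> x)"
    and "\<And>x. x \<in> I \<Longrightarrow> subspace (W x)"
    and "inj_on rk I"
    and "\<And>x. x \<in> I \<Longrightarrow> W x \<subseteq> \<theta> x ` {v \<in> V. \<forall>y\<in>I. rk x < (rk y :: nat) \<longrightarrow> \<theta> y v = 0}"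
  shows "(\<Sum>x\<in>I. dim (W x)) \<le> dim V"
  using assms
proof (induction "card I" arbitrary: I V)
  case 0
  then show ?case by simp
next
  case (Suc c)
  have ne: "I \<noteq> {}" using Suc.hyps by auto
  obtain x where x: "x \<in> I" "\<And>y. y \<in> I \<Longrightarrow> rk y \<le> rk x"
    using finite_max_rank[OF Suc.prems(1) ne, of rk] by blast
  have id: "module_hom scale scale (\<lambda>v. v)" by unfold_locales auto
  let ?K = "{v \<in> V. \<theta> x v = 0}"
  note ex = trace_exact[OF Suc.prems(2) id _ Suc.prems(3)[OF x(1)] id, simplified]
  have "W x \<subseteq> \<theta> x ` V" using Suc.prems(6)[OF x(1)] by blast
  then have 1: "dim (W x) \<le> dim (\<theta> x ` V)"
    using dim_subspace_mono(1)[OF ex(4)] Suc.prems(4)[OF x(1)] by blast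
  have 2: "(\<Sum>y\<in>I - {x}. dim (W y)) \<le> dim ?K"
  proof (rule Suc.hyps(1))
    show "c = card (I - {x})" using Suc.hyps(2) x Suc.prems(1) by simp
    show "W y \<subseteq> \<theta> y ` {v \<in> ?K. \<forall>z\<in>I - {x}. rk y < rk z \<longrightarrow> \<theta> z v = 0}" if "y \<in> I - {x}" for y
    proof -
      have "rk y < rk x" using x that Suc.prems(5) by (metis DiffE inj_onD le_neq_implies_less singletonI)
      then show ?thesis using Suc.prems(6)[of y] that x(1) by blast
    qed
    show "inj_on rk (I - {x})" using Suc.prems(5) inj_on_subset by blast
  qed (use Suc.prems(1,3,4) ex(3) in auto)
  show ?case using ex(2) 1 2 sum.remove[OF Suc.prems(1) x(1), of "\<lambda>x. dim (W x)"] by simp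
qed

end

interpretation cfun: vector_space_trace "fscale :: complex \<Rightarrow> ('a \<Rightarrow> complex) \<Rightarrow> 'a \<Rightarrow> complex" ..

section \<open>Highest weight vectors in the tabloid modules\<close>

text \<open>The content \<alpha> is any composition, since removing a cell need not leave a
  partition. Extensionality matches \<open>restrict\<close> in \<open>tabloid\<close>.\<close>

definition tabloids :: "nat \<Rightarrow> (nat \<Rightarrow> nat) \<Rightarrow> (nat \<Rightarrow> nat) set" where
  "tabloids n \<alpha> = {r \<in> extensional {..<n}. \<forall>i. card {x. x < n \<and> r x = i} = \<alpha> i}"

text \<open>Functions on words are read as tensors, a word being a product of basis vectors; this is
  the matrix unit E_{i,i+1} acting as a derivation. On coefficients the change of letters runs from
  \<open>i\<close> to \<open>Suc i\<close>, opposite to its effect on basis words.\<close>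

definition raise :: "nat \<Rightarrow> nat \<Rightarrow> ((nat \<Rightarrow> nat) \<Rightarrow> complex) \<Rightarrow> (nat \<Rightarrow> nat) \<Rightarrow> complex" where
  "raise n i v = (\<lambda>r. \<Sum>x | x < n \<and> r x = i. v (r(x := Suc i)))"

definition lower :: "nat \<Rightarrow> nat \<Rightarrow> ((nat \<Rightarrow> nat) \<Rightarrow> complex) \<Rightarrow> (nat \<Rightarrow> nat) \<Rightarrow> complex" where
  "lower n i v = (\<lambda>r. \<Sum>x | x < n \<and> r x = Suc i. v (r(x := i)))"

definition weight_space :: "nat \<Rightarrow> (nat \<Rightarrow> nat) \<Rightarrow> ((nat \<Rightarrow> nat) \<Rightarrow> complex) set" where
  "weight_space n \<alpha> = {v. \<forall>r. v r \<noteq> 0 \<longrightarrow> r \<in> tabloids n \<alpha>}"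

definition hw :: "nat \<Rightarrow> (nat \<Rightarrow> nat) \<Rightarrow> ((nat \<Rightarrow> nat) \<Rightarrow> complex) set" where
  "hw n \<alpha> = {v \<in> weight_space n \<alpha>. \<forall>i. raise n i v = 0}"

definition dec :: "(nat \<Rightarrow> nat) \<Rightarrow> nat \<Rightarrow> nat \<Rightarrow> nat" where
  "dec \<alpha> i = \<alpha>(i := \<alpha> i - 1)"

text \<open>The tensor component with letter \<open>k\<close> in position \<open>n\<close>. The
  value 0 off extensional words keeps the support inside words of length \<open>n\<close>.\<close>

definition strip :: "nat \<Rightarrow> nat \<Rightarrow> ((nat \<Rightarrow> nat) \<Rightarrow> complex) \<Rightarrow> (nat \<Rightarrow> nat) \<Rightarrow> complex" where
  "strip n k v = (\<lambda>r. if r \<in> extensional {..<n} then v (r(n := k)) else 0)"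

lemma module_hom_fscaleI:
  assumes "\<And>u v. f (u + v) = f u + f v" "\<And>c v. f (fscale c v) = fscale c (f v)"
  shows "module_hom fscale fscale f"
  by (rule module_hom.intro) (auto simp: module_hom_axioms_def cfun.module_axioms assms)

lemma raise_hom: "module_hom fscale fscale (raise n i)"
  by (rule module_hom_fscaleI)
     (auto simp: raise_def fscale_def fun_eq_iff sum.distrib sum_distrib_left)

lemma strip_hom: "module_hom fscale fscale (strip n k)"
  by (rule module_hom_fscaleI) (auto simp: strip_def fscale_def fun_eq_iff)

lemma weight_space_subspace: "cfun.subspace (weight_space n \<alpha>)"
  unfolding cfun.subspace_def weight_space_def by (auto simp: fscale_def) (metis add_0)

lemma hw_subspace: "cfun.subspace (hw n \<alpha>)"
  using weight_space_subspace[of n \<alpha>]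
  unfolding cfun.subspace_def hw_def
  by (auto simp: module_hom.add[OF raise_hom] module_hom.scale[OF raise_hom] module_hom.zero[OF raise_hom])

lemma tabloids_subset:
  assumes "\<And>i. i \<ge> L \<Longrightarrow> \<alpha> i = 0"
  shows "tabloids n \<alpha> \<subseteq> PiE {..<n} (\<lambda>_. {..<L})"
proof
  fix r assume r: "r \<in> tabloids n \<alpha>"
  have "r x < L" if "x < n" for x
  proof (rule ccontr)
    assume "\<not> r x < L"
    then have "card {y. y < n \<and> r y = r x} = 0" using assms r by (auto simp: tabloids_def)
    moreover have "finite {y. y < n \<and> r y = r x}" by simp
    ultimately show False using that by auto
  qed
  then show "r \<in> PiE {..<n} (\<lambda>_. {..<L})"
    using r by (auto simp: tabloids_def PiE_def)
qed

lemma finite_tabloids: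
  assumes "\<And>i. i \<ge> L \<Longrightarrow> \<alpha> i = 0"
  shows "finite (tabloids n \<alpha>)"
proof (rule finite_subset)
  show "tabloids n \<alpha> \<subseteq> PiE {..<n} (\<lambda>_. {..<L})" by (rule tabloids_subset) (rule assms)
qed (intro finite_PiE, auto)

lemma fin_subspace_weight_space:
  assumes "\<And>i. i \<ge> L \<Longrightarrow> \<alpha> i = 0"
  shows "cfun.fin_subspace (weight_space n \<alpha>)"
proof -
  define ind :: "(nat \<Rightarrow> nat) \<Rightarrow> (nat \<Rightarrow> nat) \<Rightarrow> complex" where "ind r = (\<lambda>r'. if r' = r then 1 else 0)" for r
  have fin: "finite (tabloids n \<alpha>)" by (rule finite_tabloids) (rule assms)
  have "v \<in> cfun.span (ind ` tabloids n \<alpha>)" if "v \<in> weight_space n \<alpha>" for v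
  proof -
    have "v = (\<Sum>r\<in>tabloids n \<alpha>. fscale (v r) (ind r))"
    proof
      fix r'
      have "(\<Sum>r\<in>tabloids n \<alpha>. fscale (v r) (ind r)) r' = (\<Sum>r\<in>tabloids n \<alpha>. fscale (v r) (ind r) r')"
        by (induction rule: infinite_finite_induct) auto
      also have "\<dots> = (\<Sum>r\<in>tabloids n \<alpha>. if r = r' then v r else 0)"
        by (intro sum.cong) (auto simp: fscale_def ind_def)
      also have "\<dots> = v r'" using that fin by (auto simp: weight_space_def)
      finally show "v r' = (\<Sum>r\<in>tabloids n \<alpha>. fscale (v r) (ind r)) r'" by simp
    qed
    moreover have "(\<Sum>r\<in>tabloids n \<alpha>. fscale (v r) (ind r)) \<in> cfun.span (ind ` tabloids n \<alpha>)"
      by (intro cfun.span_sum cfun.span_scale cfun.span_base) auto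
    ultimately show ?thesis by simp
  qed
  then show ?thesis
    unfolding cfun.fin_subspace_def using fin weight_space_subspace by blast
qed

lemma fin_subspace_hw:
  assumes "\<And>i. i \<ge> L \<Longrightarrow> \<alpha> i = 0"
  shows "cfun.fin_subspace (hw n \<alpha>)"
proof (rule cfun.fin_subspace_mono[OF _ hw_subspace])
  show "cfun.fin_subspace (weight_space n \<alpha>)" by (rule fin_subspace_weight_space) (rule assms)
qed (auto simp: hw_def)

section \<open>Raising and lowering as adjoint operators\<close>

text \<open>Both sides sum over pairs of words that differ in one position, with \<open>i\<close> in
  one and \<open>Suc i\<close> in the other; the bound on \<open>K\<close> keeps both words in
  \<open>R\<close>. The form is bilinear, and conjugates are inserted where norms are
  needed.\<close>

lemma raise_lower_adjoint:
  fixes v w :: "(nat \<Rightarrow> nat) \<Rightarrow> complex" and n i K :: nat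
  assumes "Suc i < K"
  defines "R \<equiv> PiE {..<n} (\<lambda>_. {..<K})"
  shows "(\<Sum>r\<in>R. raise n i v r * w r) = (\<Sum>r\<in>R. v r * lower n i w r)"
proof -
  have fin: "finite R" unfolding R_def by (intro finite_PiE) auto
  have "(\<Sum>r\<in>R. raise n i v r * w r)
      = (\<Sum>(r, x)\<in>(SIGMA r:R. {x. x < n \<and> r x = i}). v (r(x := Suc i)) * w r)"
    unfolding raise_def sum_distrib_right by (rule sum.Sigma) (use fin in auto)
  also have "\<dots> = (\<Sum>(r, x)\<in>(SIGMA r:R. {x. x < n \<and> r x = Suc i}). v r * w (r(x := i)))"
    by (rule sum.reindex_bij_witness[where i = "\<lambda>(r, x). (r(x := i), x)" and j = "\<lambda>(r, x). (r(x := Suc i), x)"])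
       (use assms in \<open>auto simp: R_def PiE_def extensional_def Pi_def\<close>)
  also have "\<dots> = (\<Sum>r\<in>R. v r * lower n i w r)"
    unfolding lower_def sum_distrib_left by (rule sum.Sigma[symmetric]) (use fin in auto)
  finally show ?thesis .
qed

text \<open>The sl_2 relation ef - fe = h. Changes at two different positions commute and cancel;
  what remains are changes undone at the same position, counted by the letters \<open>i\<close> and
  \<open>Suc i\<close>.\<close>

lemma raise_lower_commute:
  "raise n i (lower n i v) r = lower n i (raise n i v) r
    + (of_nat (card {x. x < n \<and> r x = i}) - of_nat (card {x. x < n \<and> r x = Suc i})) * v r"
proof -
  let ?A = "{x. x < n \<and> r x = i}" and ?B = "{x. x < n \<and> r x = Suc i}"
  have "raise n i (lower n i v) r = (\<Sum>x\<in>?A. v r + (\<Sum>y\<in>?B. v (r(x := Suc i, y := i))))"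
    unfolding raise_def lower_def
  proof (rule sum.cong)
    fix x assume x: "x \<in> ?A"
    \<comment> \<open>The position just changed to \<open>Suc i\<close> may be changed back, which
      returns \<open>v r\<close>.\<close>
    then have "{y. y < n \<and> (r(x := Suc i)) y = Suc i} = insert x ?B" by auto
    moreover have "r(x := Suc i, x := i) = r" using x by auto
    ultimately show "(\<Sum>y | y < n \<and> (r(x := Suc i)) y = Suc i. v (r(x := Suc i, y := i)))
        = v r + (\<Sum>y\<in>?B. v (r(x := Suc i, y := i)))" using x by simp
  qed simp
  moreover have "lower n i (raise n i v) r = (\<Sum>y\<in>?B. v r + (\<Sum>x\<in>?A. v (r(y := i, x := Suc i))))"
    unfolding raise_def lower_def
  proof (rule sum.cong)
    fix y assume y: "y \<in> ?B"
    then have "{x. x < n \<and> (r(y := i)) x = i} = insert y ?A" by auto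
    moreover have "r(y := i, y := Suc i) = r" using y by auto
    ultimately show "(\<Sum>x | x < n \<and> (r(y := i)) x = i. v (r(y := i, x := Suc i)))
        = v r + (\<Sum>x\<in>?A. v (r(y := i, x := Suc i)))" using y by simp
  qed simp
  moreover have "(\<Sum>x\<in>?A. \<Sum>y\<in>?B. v (r(x := Suc i, y := i))) = (\<Sum>y\<in>?B. \<Sum>x\<in>?A. v (r(y := i, x := Suc i)))"
  proof (subst sum.swap, intro sum.cong refl)
    fix x y assume "x \<in> ?A" "y \<in> ?B"
    then have "x \<noteq> y" by auto
    then show "v (r(x := Suc i, y := i)) = v (r(y := i, x := Suc i))" by (simp only: fun_upd_twist[OF \<open>x \<noteq> y\<close>])
  qed
  ultimately show ?thesis by (simp add: sum.distrib algebra_simps)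
qed

text \<open>The squared norm of fv is the pairing of efv with v, and ev = 0 reduces ef to the scalar
  h on a weight vector.\<close>

lemma lower_norm:
  assumes v: "v \<in> hw n \<beta>" and K: "Suc i < K"
  defines "R \<equiv> PiE {..<n} (\<lambda>_. {..<K})"
  shows "(\<Sum>r\<in>R. (cmod (lower n i v r))\<^sup>2) = (real (\<beta> i) - real (\<beta> (Suc i))) * (\<Sum>r\<in>R. (cmod (v r))\<^sup>2)"
proof -
  have cl: "lower n i (\<lambda>r. cnj (v r)) r = cnj (lower n i v r)" for r
    by (simp add: lower_def)
  have e: "raise n i (lower n i v) r = (of_nat (\<beta> i) - of_nat (\<beta> (Suc i))) * v r" for r
  proof (cases "v r = 0")
    case False
    then have "r \<in> tabloids n \<beta>" using v by (auto simp: hw_def weight_space_def)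
    then show ?thesis using v unfolding raise_lower_commute
      by (auto simp: tabloids_def hw_def lower_def)
  next
    case True
    then show ?thesis using v unfolding raise_lower_commute by (auto simp: hw_def lower_def)
  qed
  have "complex_of_real (\<Sum>r\<in>R. (cmod (lower n i v r))\<^sup>2) = (\<Sum>r\<in>R. lower n i v r * cnj (lower n i v r))"
    by (simp add: complex_norm_square[symmetric])
  also have "\<dots> = (\<Sum>r\<in>R. raise n i (lower n i v) r * cnj (v r))"
    unfolding R_def using raise_lower_adjoint[OF K, of n "lower n i v" "\<lambda>r. cnj (v r)"] cl by simp
  also have "\<dots> = (of_nat (\<beta> i) - of_nat (\<beta> (Suc i))) * (\<Sum>r\<in>R. v r * cnj (v r))"
    by (simp add: e sum_distrib_left mult.assoc)
  also have "\<dots> = complex_of_real ((real (\<beta> i) - real (\<beta> (Suc i))) * (\<Sum>r\<in>R. (cmod (v r))\<^sup>2))"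
    by (simp add: complex_norm_square[symmetric])
  finally show ?thesis using of_real_eq_iff by blast
qed

lemma weight_space_zeroI:
  assumes "v \<in> weight_space n \<beta>" "\<And>i. i \<ge> K \<Longrightarrow> \<beta> i = 0"
    and "(\<Sum>r\<in>PiE {..<n} (\<lambda>_. {..<K}). (cmod (v r))\<^sup>2) \<le> 0"
  shows "v = 0"
proof
  fix r
  have fin: "finite (PiE {..<n} (\<lambda>_. {..<K}))" by (intro finite_PiE) auto
  have "(\<Sum>r\<in>PiE {..<n} (\<lambda>_. {..<K}). (cmod (v r))\<^sup>2) = 0"
    using assms(3) by (intro antisym sum_nonneg) auto
  then have "v r = 0" if "r \<in> PiE {..<n} (\<lambda>_. {..<K})" for r
    using that fin by (auto simp: sum_nonneg_eq_0_iff)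
  moreover have "v r = 0" if "r \<notin> PiE {..<n} (\<lambda>_. {..<K})"
    using that assms(1) tabloids_subset[of K \<beta> n] assms(2) by (auto simp: weight_space_def)
  ultimately show "v r = 0 r" by auto
qed

text \<open>Highest weights are dominant: if \<beta> increases at \<open>i\<close>, then
  \<open>lower_norm\<close> equates a nonnegative number with a negative multiple of the squared
  norm of \<open>v\<close>.\<close>

lemma hw_not_partition:
  assumes "\<And>i. i \<ge> L \<Longrightarrow> \<beta> i = 0" "\<beta> i < \<beta> (Suc i)"
  shows "hw n \<beta> = {0}"
proof -
  have "v = 0" if v: "v \<in> hw n \<beta>" for v
  proof (rule weight_space_zeroI[where K = "L + i + 2"])
    let ?R = "PiE {..<n} (\<lambda>_. {..<L + i + 2})"
    have "0 \<le> (\<Sum>r\<in>?R. (cmod (lower n i v r))\<^sup>2)" by (simp add: sum_nonneg)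
    also have "\<dots> = (real (\<beta> i) - real (\<beta> (Suc i))) * (\<Sum>r\<in>?R. (cmod (v r))\<^sup>2)"
      by (rule lower_norm[OF v]) simp
    finally have "0 \<le> (real (\<beta> i) - real (\<beta> (Suc i))) * (\<Sum>r\<in>?R. (cmod (v r))\<^sup>2)" .
    moreover have "real (\<beta> i) - real (\<beta> (Suc i)) < 0" using assms(2) by simp
    ultimately show "(\<Sum>r\<in>?R. (cmod (v r))\<^sup>2) \<le> 0" by (meson mult_neg_pos not_le)
    show "v \<in> weight_space n \<beta>" using v by (simp add: hw_def)
    show "\<beta> j = 0" if "L + i + 2 \<le> j" for j using that by (intro assms(1)) linarith
  qed
  then show ?thesis using cfun.subspace_0[OF hw_subspace] by blast
qed

text \<open>If \<open>\<beta>\<^sub>i = \<beta>\<^bsub>i+1\<^esub>\<close> then lowering kills \<open>u\<close>, so \<open>u\<close> is orthogonal to everything raised.\<close>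

lemma hw_raise_zero:
  assumes "\<And>i. i \<ge> L \<Longrightarrow> \<beta> i = 0" "\<beta> i = \<beta> (Suc i)" and u: "u \<in> hw n \<beta>" and eq: "u = raise n i w"
  shows "u = 0"
proof (rule weight_space_zeroI[where K = "L + i + 2"])
  let ?R = "PiE {..<n} (\<lambda>_. {..<L + i + 2})"
  have fin: "finite ?R" by (intro finite_PiE) auto
  have "(\<Sum>r\<in>?R. (cmod (lower n i u r))\<^sup>2) = 0"
    using lower_norm[OF u, of i "L + i + 2"] assms(2) by simp
  then have lo: "lower n i u r = 0" if "r \<in> ?R" for r
    using that fin by (auto simp: sum_nonneg_eq_0_iff)
  have cl: "lower n i (\<lambda>r. cnj (u r)) r = cnj (lower n i u r)" for r
    by (simp add: lower_def)
  have ur: "u r = raise n i w r" for r using eq by (rule fun_cong)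
  have "complex_of_real (\<Sum>r\<in>?R. (cmod (u r))\<^sup>2) = (\<Sum>r\<in>?R. u r * cnj (u r))"
    by (simp add: complex_norm_square[symmetric])
  also have "\<dots> = (\<Sum>r\<in>?R. raise n i w r * cnj (u r))"
    by (simp only: ur)
  also have "\<dots> = 0" by (subst raise_lower_adjoint) (auto simp: cl lo)
  finally show "(\<Sum>r\<in>?R. (cmod (u r))\<^sup>2) \<le> 0" by (simp only: of_real_eq_0_iff order_refl)
  show "u \<in> weight_space n \<beta>" using u by (simp add: hw_def)
  show "\<beta> j = 0" if "L + i + 2 \<le> j" for j using that by (intro assms(1)) linarith
qed

section \<open>Removing the last tensor factor\<close>

text \<open>Raising is a derivation; the extra term is its action on the removed factor.\<close>

lemma strip_raise:
  "strip n i (raise (Suc n) k v) = raise n k (strip n i v) + (if i = k then strip n (Suc k) v else 0)"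
proof
  fix r
  show "strip n i (raise (Suc n) k v) r
      = (raise n k (strip n i v) + (if i = k then strip n (Suc k) v else 0)) r"
  proof (cases "r \<in> extensional {..<n}")
    case True
    have ext: "r(x := y) \<in> extensional {..<n}" if "x < n" for x y
      using True that by (auto simp: extensional_def)
    have set: "{x. x < Suc n \<and> (r(n := i)) x = k}
        = {x. x < n \<and> r x = k} \<union> (if i = k then {n} else {})"
      by (auto simp: less_Suc_eq)
    have "strip n i (raise (Suc n) k v) r
       = (\<Sum>x | x < n \<and> r x = k. v (r(n := i, x := Suc k))) + (if i = k then v (r(n := Suc k)) else 0)"
      unfolding strip_def raise_def set using True by (subst sum.union_disjoint) auto
    also have "(\<Sum>x | x < n \<and> r x = k. v (r(n := i, x := Suc k))) = raise n k (strip n i v) r"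
      unfolding raise_def strip_def using ext by (intro sum.cong) (auto simp: fun_upd_twist[of n])
    finally show ?thesis using True by (simp add: strip_def)
  next
    case False
    then have "r(x := y) \<notin> extensional {..<n}" if "x < n" for x y
      using that by (auto simp: extensional_def split: if_splits)
    then show ?thesis using False by (simp add: strip_def raise_def)
  qed
qed

text \<open>Since \<open>dec\<close> truncates at zero, the weight in the first conclusion is
  meaningful only for nonzero \<open>\<alpha> k\<close>; otherwise no word in the support has the
  letter \<open>k\<close>.\<close>

lemma strip_weight_space:
  assumes "v \<in> weight_space (Suc n) \<alpha>"
  shows "strip n k v \<in> weight_space n (dec \<alpha> k)" and "\<alpha> k = 0 \<Longrightarrow> strip n k v = 0"
proof -
  have *: "\<alpha> k > 0 \<and> r \<in> tabloids n (dec \<alpha> k)" if "strip n k v r \<noteq> 0" for r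
  proof -
    have r: "r \<in> extensional {..<n}" and t: "r(n := k) \<in> tabloids (Suc n) \<alpha>"
      using that assms by (auto simp: strip_def weight_space_def split: if_splits)
    have set: "{x. x < Suc n \<and> (r(n := k)) x = i}
        = {x. x < n \<and> r x = i} \<union> (if i = k then {n} else {})" for i
      by (auto simp: less_Suc_eq)
    have "card {x. x < Suc n \<and> (r(n := k)) x = i} = card {x. x < n \<and> r x = i} + (if i = k then 1 else 0)" for i
      unfolding set by (subst card_Un_disjoint) auto
    then have "\<alpha> i = card {x. x < n \<and> r x = i} + (if i = k then 1 else 0)" for i
      using t unfolding tabloids_def by auto
    then show ?thesis using r by (auto simp: tabloids_def dec_def)
  qed
  show "strip n k v \<in> weight_space n (dec \<alpha> k)" using * by (auto simp: weight_space_def)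
  show "strip n k v = 0" if "\<alpha> k = 0" using * that by fastforce
qed

lemma strip_all_zero:
  assumes v: "v \<in> weight_space (Suc n) \<alpha>" and L: "\<And>i. i \<ge> L \<Longrightarrow> \<alpha> i = 0"
    and z: "\<And>k. k < L \<Longrightarrow> strip n k v = 0"
  shows "v = 0"
proof
  fix r
  show "v r = 0 r"
  proof (cases "r \<in> tabloids (Suc n) \<alpha>")
    case True
    then have r: "r \<in> PiE {..<Suc n} (\<lambda>_. {..<L})" using tabloids_subset[of L \<alpha> "Suc n"] L by blast
    have "(restrict r {..<n})(n := r n) = r"
      using r by (auto simp: fun_eq_iff PiE_def extensional_def less_Suc_eq)
    moreover have "strip n (r n) v (restrict r {..<n}) = 0"
      using z[of "r n"] r by (auto simp: PiE_def Pi_def)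
    ultimately show ?thesis by (simp add: strip_def)
  qed (use v in \<open>auto simp: weight_space_def\<close>)
qed

section \<open>Shapes, corners and diagrams\<close>

definition is_part :: "(nat \<Rightarrow> nat) \<Rightarrow> bool" where
  "is_part \<alpha> \<longleftrightarrow> (\<forall>i. \<alpha> (Suc i) \<le> \<alpha> i)"

text \<open>Partitions are padded by zeros to functions, so that removing a cell never changes a
  length; \<open>L\<close> only bounds the number of rows.\<close>

definition shape :: "nat \<Rightarrow> nat \<Rightarrow> (nat \<Rightarrow> nat) \<Rightarrow> bool" where
  "shape L n \<alpha> \<longleftrightarrow> (\<forall>i\<ge>L. \<alpha> i = 0) \<and> (\<Sum>i<L. \<alpha> i) = n"

definition corner :: "(nat \<Rightarrow> nat) \<Rightarrow> nat \<Rightarrow> bool" where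
  "corner \<alpha> i \<longleftrightarrow> \<alpha> (Suc i) < \<alpha> i"

definition diagram :: "(nat \<Rightarrow> nat) \<Rightarrow> (nat \<times> nat) set" where
  "diagram \<alpha> = {(i, j). j < \<alpha> i}"

definition specht_fun :: "nat \<Rightarrow> (nat \<Rightarrow> nat) \<Rightarrow> ((nat \<Rightarrow> nat) \<Rightarrow> complex) set" where
  "specht_fun n \<alpha> = cfun.span (polytabloid n ` {t. bij_betw t {..<n} (diagram \<alpha>)})"

lemma is_part_mono: "is_part \<alpha> \<Longrightarrow> i \<le> j \<Longrightarrow> \<alpha> j \<le> \<alpha> i"
  unfolding is_part_def using lift_Suc_antimono_le by blast

lemma is_part_dec: "is_part \<alpha> \<Longrightarrow> corner \<alpha> i \<Longrightarrow> is_part (dec \<alpha> i)"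
  unfolding is_part_def corner_def dec_def
  by (auto simp: Suc_le_eq le_diff_conv) (metis le_SucI less_eq_Suc_le)

lemma corner_less: "shape L n \<alpha> \<Longrightarrow> corner \<alpha> i \<Longrightarrow> i < L"
  unfolding shape_def corner_def by (metis leI not_less_zero)

lemma shape_dec:
  assumes "shape L (Suc n) \<alpha>" "corner \<alpha> i"
  shows "shape L n (dec \<alpha> i)"
proof -
  have i: "i < L" using corner_less assms .
  have "(\<Sum>j<L. \<alpha> j) = \<alpha> i + (\<Sum>j\<in>{..<L} - {i}. \<alpha> j)" by (rule sum.remove) (use i in auto)
  moreover have "(\<Sum>j<L. dec \<alpha> i j) = dec \<alpha> i i + (\<Sum>j\<in>{..<L} - {i}. dec \<alpha> i j)"
    by (rule sum.remove) (use i in auto)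
  moreover have "(\<Sum>j\<in>{..<L} - {i}. dec \<alpha> i j) = (\<Sum>j\<in>{..<L} - {i}. \<alpha> j)"
    by (rule sum.cong) (auto simp: dec_def)
  ultimately show ?thesis using assms unfolding shape_def corner_def by (auto simp: dec_def)
qed

lemma dec_support: "(\<And>i. L \<le> i \<Longrightarrow> \<alpha> i = 0) \<Longrightarrow> L \<le> i \<Longrightarrow> dec \<alpha> k i = 0"
  by (simp add: dec_def)

text \<open>Removing a cell from a row of the same length as the next one leaves an increase, which
  \<open>hw_not_partition\<close> excludes.\<close>

lemma hw_dec_not_corner:
  assumes "\<And>i. L \<le> i \<Longrightarrow> \<alpha> i = 0" "is_part \<alpha>" "\<alpha> k > 0" "\<not> corner \<alpha> k"
  shows "hw n (dec \<alpha> k) = {0}"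
proof (rule hw_not_partition)
  show "dec \<alpha> k i = 0" if "L \<le> i" for i using dec_support assms(1) that by blast
  have "\<alpha> (Suc k) = \<alpha> k" using assms(2,4) by (auto simp: is_part_def corner_def not_less le_antisym)
  then show "dec \<alpha> k k < dec \<alpha> k (Suc k)" using assms(3) by (simp add: dec_def)
qed

section \<open>The symmetric group action, which commutes with raising and stripping\<close>

lemma comp_tabloids:
  assumes \<sigma>: "\<sigma> permutes {..<n}"
  shows "r \<circ> \<sigma> \<in> tabloids n \<alpha> \<longleftrightarrow> r \<in> tabloids n \<alpha>"
proof -
  have "card {x. x < n \<and> (r \<circ> \<sigma>) x = i} = card {x. x < n \<and> r x = i}" for i
  proof (rule bij_betw_same_card[where f = \<sigma>])
    have "\<sigma> ` {x. x < n \<and> (r \<circ> \<sigma>) x = i} = {x. x < n \<and> r x = i}"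
    proof (intro set_eqI iffI)
      fix y assume "y \<in> {x. x < n \<and> r x = i}"
      then have "inv \<sigma> y \<in> {x. x < n \<and> (r \<circ> \<sigma>) x = i}" "\<sigma> (inv \<sigma> y) = y"
        using permutes_in_image[OF permutes_inv[OF \<sigma>], of y] permutes_inverses[OF \<sigma>] by auto
      then show "y \<in> \<sigma> ` {x. x < n \<and> (r \<circ> \<sigma>) x = i}" by force
    qed (use permutes_in_image[OF \<sigma>] in auto)
    then show "bij_betw \<sigma> {x. x < n \<and> (r \<circ> \<sigma>) x = i} {x. x < n \<and> r x = i}"
      using permutes_inj[OF \<sigma>] by (auto simp: bij_betw_def inj_on_def)
  qed
  moreover have "r \<circ> \<sigma> \<in> extensional {..<n} \<longleftrightarrow> r \<in> extensional {..<n}"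
    using permutes_not_in[OF \<sigma>] by (auto simp: extensional_def)
  ultimately show ?thesis by (auto simp: tabloids_def)
qed

lemma act_weight_space:
  assumes "\<sigma> permutes {..<n}" "v \<in> weight_space n \<alpha>"
  shows "act \<sigma> v \<in> weight_space n \<alpha>"
  using assms comp_tabloids by (auto simp: weight_space_def act_def)

lemma fun_upd_comp_permutes:
  assumes "\<sigma> permutes S"
  shows "r(\<sigma> y := c) \<circ> \<sigma> = (r \<circ> \<sigma>)(y := c)"
  using injD[OF permutes_inj[OF assms]] by (auto simp: fun_eq_iff)

lemma raise_act:
  assumes \<sigma>: "\<sigma> permutes {..<n}"
  shows "raise n i (act \<sigma> v) = act \<sigma> (raise n i v)"
proof
  fix r
  have "(\<Sum>x | x < n \<and> r x = i. v (r(x := Suc i) \<circ> \<sigma>)) = (\<Sum>x | x < n \<and> (r \<circ> \<sigma>) x = i. v ((r \<circ> \<sigma>)(x := Suc i)))"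
  proof (rule sum.reindex_bij_witness[where i = \<sigma> and j = "inv \<sigma>"])
    fix a assume "a \<in> {x. x < n \<and> r x = i}"
    then show "inv \<sigma> a \<in> {x. x < n \<and> (r \<circ> \<sigma>) x = i}"
      using permutes_in_image[OF permutes_inv[OF \<sigma>], of a] permutes_inverses[OF \<sigma>] by auto
    show "v ((r \<circ> \<sigma>)(inv \<sigma> a := Suc i)) = v (r(a := Suc i) \<circ> \<sigma>)"
      using fun_upd_comp_permutes[OF \<sigma>, of r "inv \<sigma> a" "Suc i"] permutes_inverses(1)[OF \<sigma>] by simp
  qed (use permutes_in_image[OF \<sigma>] permutes_inverses[OF \<sigma>] in auto)
  then show "raise n i (act \<sigma> v) r = act \<sigma> (raise n i v) r"
    by (simp add: raise_def act_def)
qed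

lemma act_hw:
  assumes "\<sigma> permutes {..<n}" "v \<in> hw n \<alpha>"
  shows "act \<sigma> v \<in> hw n \<alpha>"
  using assms act_weight_space raise_act unfolding hw_def
  by (auto simp: module_hom.zero[OF act_hom])

lemma strip_act:
  assumes \<sigma>: "\<sigma> permutes {..<n}"
  shows "strip n k (act \<sigma> v) = act \<sigma> (strip n k v)"
proof
  fix r :: "nat \<Rightarrow> nat"
  have "r \<circ> \<sigma> \<in> extensional {..<n} \<longleftrightarrow> r \<in> extensional {..<n}"
    using permutes_not_in[OF \<sigma>] by (auto simp: extensional_def)
  moreover have "r(n := k) \<circ> \<sigma> = (r \<circ> \<sigma>)(n := k)"
    using fun_upd_comp_permutes[OF \<sigma>, of r n k] permutes_not_in[OF \<sigma>, of n] by simp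
  ultimately show "strip n k (act \<sigma> v) r = act \<sigma> (strip n k v) r"
    by (simp add: strip_def act_def)
qed

text \<open>By \<open>strip_raise\<close> the only obstruction is the stripping at
  \<open>Suc k\<close>; this is why larger letters are peeled off first.\<close>

lemma strip_hw:
  assumes v: "v \<in> hw (Suc n) \<alpha>" and z: "strip n (Suc k) v = 0"
  shows "strip n k v \<in> hw n (dec \<alpha> k)"
proof -
  have "raise n i (strip n k v) = 0" for i
  proof -
    have "strip n k (raise (Suc n) i v) = 0"
      using v module_hom.zero[OF strip_hom, of n k] by (simp add: hw_def)
    then show ?thesis using strip_raise[of n k i v] z by (cases "k = i") auto
  qed
  then show ?thesis using v strip_weight_space(1)[of v n \<alpha> k] by (simp add: hw_def)
qed

text \<open>Zero spaces at non-corners let sums and filtrations run over all rows below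
  \<open>L\<close>.\<close>

definition dec_hw :: "nat \<Rightarrow> (nat \<Rightarrow> nat) \<Rightarrow> nat \<Rightarrow> ((nat \<Rightarrow> nat) \<Rightarrow> complex) set" where
  "dec_hw n \<alpha> k = (if corner \<alpha> k then hw n (dec \<alpha> k) else {0})"

lemma fin_subspace_dec_hw:
  assumes "shape L m \<alpha>"
  shows "cfun.fin_subspace (dec_hw n \<alpha> k)"
proof -
  have "cfun.fin_subspace (hw n (dec \<alpha> k))"
    by (rule fin_subspace_hw[where L = L]) (use assms in \<open>simp add: shape_def dec_def\<close>)
  then show ?thesis by (simp add: dec_hw_def cfun.fin_subspace_zero)
qed

lemma strip_dec_hw:
  assumes "shape L m \<alpha>" "is_part \<alpha>" "v \<in> hw (Suc n) \<alpha>"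
    and z: "\<And>j. j < L \<Longrightarrow> k < j \<Longrightarrow> strip n j v = 0"
  shows "strip n k v \<in> dec_hw n \<alpha> k"
proof -
  have ws: "v \<in> weight_space (Suc n) \<alpha>" using assms(3) by (simp add: hw_def)
  have "strip n (Suc k) v = 0"
  proof (cases "Suc k < L")
    case False
    then show ?thesis using strip_weight_space(2)[OF ws] assms(1) by (simp add: shape_def)
  qed (use z in simp)
  then have *: "strip n k v \<in> hw n (dec \<alpha> k)" using strip_hw assms(3) by blast
  \<comment> \<open>An empty row leaves nothing to strip; a nonempty row that is not a corner leads
    to a weight that is not dominant.\<close>
  show ?thesis
  proof (cases "corner \<alpha> k \<or> \<alpha> k = 0")
    case True
    then show ?thesis using * strip_weight_space(2)[OF ws, of k] by (auto simp: dec_hw_def)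
  next
    case False
    then have "hw n (dec \<alpha> k) = {0}"
      using hw_dec_not_corner[of L \<alpha> k n] assms(1,2) by (simp add: shape_def)
    then show ?thesis using * False by (simp add: dec_hw_def)
  qed
qed

lemma dim_hw_le:
  assumes "shape L m \<alpha>" "is_part \<alpha>"
  shows "cfun.dim (hw (Suc n) \<alpha>) \<le> (\<Sum>k<L. cfun.dim (dec_hw n \<alpha> k))"
proof (rule cfun.dim_filtration_le[where rk = "\<lambda>k. k" and \<theta> = "strip n"])
  show "cfun.fin_subspace (hw (Suc n) \<alpha>)"
    by (rule fin_subspace_hw[where L = L]) (use assms in \<open>simp add: shape_def\<close>)
  show "strip n k v \<in> dec_hw n \<alpha> k"
    if "v \<in> hw (Suc n) \<alpha>" "\<And>j. j \<in> {..<L} \<Longrightarrow> k < j \<Longrightarrow> strip n j v = 0" for k v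
    by (rule strip_dec_hw[OF assms that(1)]) (use that(2) in simp)
  show "v = 0" if "v \<in> hw (Suc n) \<alpha>" "\<And>k. k \<in> {..<L} \<Longrightarrow> strip n k v = 0" for v
    by (rule strip_all_zero[where L = L and n = n and \<alpha> = \<alpha>])
       (use that assms in \<open>simp_all add: hw_def shape_def\<close>)
qed (use fin_subspace_dec_hw[OF assms(1)] strip_hom in auto)

section \<open>Polytabloids as weight vectors\<close>

lemma finite_col_stabilizer: "finite (col_stabilizer n t)"
proof (rule finite_subset)
  show "col_stabilizer n t \<subseteq> {\<pi>. \<pi> permutes {..<n}}" by (auto simp: col_stabilizer_def)
qed (simp add: finite_permutations)

lemma polytabloid_eval:
  "polytabloid n t r = (\<Sum>\<pi> | \<pi> \<in> col_stabilizer n t \<and> r \<circ> \<pi> = tabloid n t. of_int (sign \<pi>))"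
proof -
  have sum_apply: "(\<Sum>\<pi>\<in>A. F \<pi>) r = (\<Sum>\<pi>\<in>A. F \<pi> r)" for A and F :: "(nat \<Rightarrow> nat) \<Rightarrow> (nat \<Rightarrow> nat) \<Rightarrow> complex"
    by (induction A rule: infinite_finite_induct) auto
  have "polytabloid n t r = (\<Sum>\<pi>\<in>col_stabilizer n t. if r \<circ> \<pi> = tabloid n t then of_int (sign \<pi>) else 0)"
    unfolding polytabloid_def sum_apply
  proof (rule sum.cong)
    fix \<pi> assume "\<pi> \<in> col_stabilizer n t"
    then have "bij \<pi>" using permutes_bij by (auto simp: col_stabilizer_def)
    then have "r = tabloid n t \<circ> inv \<pi> \<longleftrightarrow> r \<circ> \<pi> = tabloid n t"
      by (metis bij_is_inj bij_is_surj comp_assoc comp_id inv_o_cancel surj_iff)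
    then show "fscale (of_int (sign \<pi>)) (\<lambda>r. if r = tabloid n t \<circ> inv \<pi> then 1 else 0) r
        = (if r \<circ> \<pi> = tabloid n t then of_int (sign \<pi>) else 0)"
      by (simp add: fscale_def)
  qed simp
  also have "\<dots> = (\<Sum>\<pi> | \<pi> \<in> col_stabilizer n t \<and> r \<circ> \<pi> = tabloid n t. of_int (sign \<pi>))"
    by (simp add: sum.inter_filter[OF finite_col_stabilizer])
  finally show ?thesis .
qed

lemma tabloid_in_tabloids:
  assumes t: "bij_betw t {..<n} (diagram \<alpha>)"
  shows "tabloid n t \<in> tabloids n \<alpha>"
proof -
  have "card {x. x < n \<and> tabloid n t x = i} = \<alpha> i" for i
  proof -
    have "bij_betw t {x. x < n \<and> tabloid n t x = i} ((\<lambda>j. (i, j)) ` {..<\<alpha> i})"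
    proof (rule bij_betw_subset[OF t])
      show "t ` {x. x < n \<and> tabloid n t x = i} = (\<lambda>j. (i, j)) ` {..<\<alpha> i}"
      proof (intro set_eqI iffI)
        fix c assume "c \<in> t ` {x. x < n \<and> tabloid n t x = i}"
        then obtain x where "x < n" "tabloid n t x = i" "c = t x" by auto
        moreover from this have "t x \<in> diagram \<alpha>" using t by (auto simp: bij_betw_def)
        ultimately show "c \<in> (\<lambda>j. (i, j)) ` {..<\<alpha> i}"
          by (cases "t x") (auto simp: tabloid_def diagram_def)
      next
        fix c assume "c \<in> (\<lambda>j. (i, j)) ` {..<\<alpha> i}"
        then obtain j where c: "c = (i, j)" "j < \<alpha> i" by auto
        then have "c \<in> t ` {..<n}" using t by (auto simp: bij_betw_def diagram_def)
        then obtain x where "x < n" "t x = c" by auto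
        moreover from this c have "tabloid n t x = i" by (simp add: tabloid_def)
        ultimately show "c \<in> t ` {x. x < n \<and> tabloid n t x = i}" by blast
      qed
    qed auto
    then have "card {x. x < n \<and> tabloid n t x = i} = card ((\<lambda>j. (i, j)) ` {..<\<alpha> i})"
      by (rule bij_betw_same_card)
    also have "\<dots> = \<alpha> i" by (subst card_image) (auto simp: inj_on_def)
    finally show ?thesis .
  qed
  then show ?thesis by (auto simp: tabloids_def tabloid_def)
qed

lemma polytabloid_weight_space:
  assumes "bij_betw t {..<n} (diagram \<alpha>)"
  shows "polytabloid n t \<in> weight_space n \<alpha>"
  unfolding weight_space_def
proof (intro CollectI allI impI)
  fix r assume "polytabloid n t r \<noteq> 0"
  then obtain \<pi> where \<pi>: "\<pi> \<in> col_stabilizer n t" "r \<circ> \<pi> = tabloid n t"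
    unfolding polytabloid_eval by (metis (mono_tags, lifting) mem_Collect_eq sum.not_neutral_contains_not_neutral)
  then have "\<pi> permutes {..<n}" by (simp add: col_stabilizer_def)
  then show "r \<in> tabloids n \<alpha>" using comp_tabloids[of \<pi> n r \<alpha>] tabloid_in_tabloids[OF assms] \<pi>(2) by simp
qed

section \<open>Specht modules are the highest weight spaces\<close>

text \<open>
  Swapping the two entries of a column of \<open>t\<close> that \<open>\<pi>\<close> sends to rows \<open>i\<close> and \<open>i + 1\<close> cancels the
  terms of the raised polytabloid in pairs.
\<close>

lemma raise_polytabloid:
  assumes t: "bij_betw t {..<n} (diagram \<alpha>)" and \<alpha>: "is_part \<alpha>"
  shows "raise n i (polytabloid n t) = 0"
proof
  fix r :: "nat \<Rightarrow> nat"
  let ?T = "tabloid n t"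
  define P where "P = (SIGMA x:{x. x < n \<and> r x = i}. {\<pi>. \<pi> \<in> col_stabilizer n t \<and> r(x := Suc i) \<circ> \<pi> = ?T})"
  define zz where "zz y = inv_into {..<n} t (i, snd (t y))" for y
  define \<phi> :: "nat \<times> (nat \<Rightarrow> nat) \<Rightarrow> nat \<times> (nat \<Rightarrow> nat)" where "\<phi> = (\<lambda>(x, \<pi>). (\<pi> (zz (inv \<pi> x)), \<pi> \<circ> transpose (inv \<pi> x) (zz (inv \<pi> x))))"
  have main: "\<phi> (x, \<pi>) \<in> P \<and> \<phi> (\<phi> (x, \<pi>)) = (x, \<pi>) \<and> sign (snd (\<phi> (x, \<pi>))) = - sign \<pi>"
    if "(x, \<pi>) \<in> P" for x \<pi>
  proof -
    have xn: "x < n" and rx: "r x = i" and C: "\<pi> \<in> col_stabilizer n t" and eq: "r(x := Suc i) \<circ> \<pi> = ?T"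
      using that by (auto simp: P_def)
    have per: "\<pi> permutes {..<n}" and col: "\<And>w. w < n \<Longrightarrow> snd (t (\<pi> w)) = snd (t w)"
      using C by (auto simp: col_stabilizer_def)
    have inj: "\<pi> a = \<pi> b \<longleftrightarrow> a = b" for a b using permutes_inj[OF per] by (auto dest: injD)
    define y where "y = inv \<pi> x"
    have \<pi>y: "\<pi> y = x" unfolding y_def using permutes_inverses(1)[OF per] .
    have yn: "y < n" using permutes_in_image[OF per, of y] \<pi>y xn by simp
    have at: "(if \<pi> w = x then Suc i else r (\<pi> w)) = ?T w" for w
      using fun_cong[OF eq, of w] by simp
    have Ty: "?T y = Suc i" using at[of y] \<pi>y by simp
    then have fy: "fst (t y) = Suc i" using yn by (simp add: tabloid_def)
    define z where "z = zz y"
    \<comment> \<open>The column of \<open>y\<close> reaches row \<open>i + 1\<close>, so it also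
      has a cell in row \<open>i\<close>, and \<open>z\<close> is the entry there.\<close>
    have "t y \<in> diagram \<alpha>" using t yn by (auto simp: bij_betw_def)
    then have "snd (t y) < \<alpha> (Suc i)" using fy by (cases "t y") (auto simp: diagram_def)
    also have "\<alpha> (Suc i) \<le> \<alpha> i" using \<alpha> by (simp add: is_part_def)
    finally have "(i, snd (t y)) \<in> t ` {..<n}" using t by (simp add: bij_betw_def diagram_def)
    then have zn: "z < n" and tz: "t z = (i, snd (t y))"
      unfolding z_def zz_def using inv_into_into[of "(i, snd (t y))" t "{..<n}"] f_inv_into_f[of "(i, snd (t y))" t "{..<n}"]
      by auto
    have zy: "z \<noteq> y" using tz fy by (metis fst_conv n_not_Suc_n)
    have Tz: "?T z = i" using zn tz by (simp add: tabloid_def)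
    have \<pi>z: "\<pi> z \<noteq> x" using zy \<pi>y inj by metis
    have r\<pi>z: "r (\<pi> z) = i" using at[of z] \<pi>z Tz by simp
    have \<pi>zn: "\<pi> z < n" using permutes_in_image[OF per, of z] zn by simp
    define \<pi>' where "\<pi>' = \<pi> \<circ> transpose y z"
    have \<phi>x: "\<phi> (x, \<pi>) = (\<pi> z, \<pi>')" by (simp add: \<phi>_def y_def z_def \<pi>'_def)
    have per': "\<pi>' permutes {..<n}"
      unfolding \<pi>'_def using yn zn per by (intro permutes_compose permutes_swap_id) auto
    have "snd (t (\<pi>' w)) = snd (t w)" if "w < n" for w
      using col[OF that] col[OF yn] col[OF zn] tz by (auto simp: \<pi>'_def transpose_def)
    then have C': "\<pi>' \<in> col_stabilizer n t" using per' by (simp add: col_stabilizer_def)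
    have "r(\<pi> z := Suc i) \<circ> \<pi>' = ?T"
    proof
      fix w
      consider "w = y" | "w = z" | "w \<noteq> y" "w \<noteq> z" by blast
      then show "(r(\<pi> z := Suc i) \<circ> \<pi>') w = ?T w"
      proof cases
        case 1
        then show ?thesis using Ty by (simp add: \<pi>'_def)
      next
        case 2
        then show ?thesis using Tz \<pi>y rx \<pi>z by (auto simp: \<pi>'_def)
      next
        case 3
        then show ?thesis using at[of w] inj \<pi>y by (auto simp: \<pi>'_def)
      qed
    qed
    then have "(\<pi> z, \<pi>') \<in> P" using \<pi>zn r\<pi>z C' by (simp add: P_def)
    moreover have "inv \<pi>' (\<pi> z) = y"
    proof -
      have "\<pi>' y = \<pi> z" by (simp add: \<pi>'_def)
      then show ?thesis using permutes_inverses(2)[OF per', of y] by simp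
    qed
    then have "\<phi> (\<pi> z, \<pi>') = (\<pi>' z, \<pi>' \<circ> transpose y z)" by (simp add: \<phi>_def z_def)
    then have "\<phi> (\<pi> z, \<pi>') = (x, \<pi>)" using \<pi>y by (simp add: \<pi>'_def comp_assoc)
    moreover have "sign \<pi>' = - sign \<pi>"
    proof -
      have "permutation \<pi>" using permutation_permutes per by blast
      then show ?thesis unfolding \<pi>'_def using zy
        by (subst sign_compose) (auto simp: permutation_swap_id sign_swap_id)
    qed
    ultimately show ?thesis by (simp add: \<phi>x)
  qed
  \<comment> \<open>The pairing gives S = - S for the sum of signs.\<close>
  have neg: "a = - a \<Longrightarrow> a = 0" for a :: complex by (simp add: complex_eq_iff)
  have r: "raise n i (polytabloid n t) r = (\<Sum>(x, \<pi>)\<in>P. of_int (sign \<pi>))"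
    unfolding raise_def polytabloid_eval P_def
    by (rule sum.Sigma) (auto simp: finite_col_stabilizer)
  have "(\<Sum>(x, \<pi>)\<in>P. of_int (sign \<pi>)) = (\<Sum>(x, \<pi>)\<in>P. - complex_of_int (sign \<pi>))"
  proof (rule sum.reindex_bij_witness[where i = \<phi> and j = \<phi>])
    fix a assume a: "a \<in> P"
    obtain x \<pi> where a': "a = (x, \<pi>)" by (cases a)
    show "\<phi> (\<phi> a) = a" "\<phi> a \<in> P" using main a a' by blast+
    show "(case \<phi> a of (x, \<pi>) \<Rightarrow> - complex_of_int (sign \<pi>)) = (case a of (x, \<pi>) \<Rightarrow> of_int (sign \<pi>))"
      using main a a' by (simp add: case_prod_beta)
  next
    fix a assume a: "a \<in> P"
    obtain x \<pi> where a': "a = (x, \<pi>)" by (cases a)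
    show "\<phi> (\<phi> a) = a" "\<phi> a \<in> P" using main a a' by blast+
  qed
  also have "\<dots> = - (\<Sum>(x, \<pi>)\<in>P. of_int (sign \<pi>))"
    by (simp add: sum_negf case_prod_beta)
  finally have "(\<Sum>(x, \<pi>)\<in>P. complex_of_int (sign \<pi>)) = 0"
    by (rule neg)
  then show "raise n i (polytabloid n t) r = 0 r" using r by simp
qed

lemma specht_fun_subset_hw:
  assumes "is_part \<alpha>"
  shows "specht_fun n \<alpha> \<subseteq> hw n \<alpha>"
  unfolding specht_fun_def
proof (rule cfun.span_minimal[OF _ hw_subspace])
  show "polytabloid n ` {t. bij_betw t {..<n} (diagram \<alpha>)} \<subseteq> hw n \<alpha>"
    using polytabloid_weight_space raise_polytabloid[OF _ assms] unfolding hw_def by blast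
qed

text \<open>The new entry \<open>n\<close> sits at the end of row \<open>k\<close>, which is the
  bottom of its column because \<open>k\<close> is a corner. Column permutations can only move it
  up, so no term has \<open>n\<close> in a lower row, and the terms with \<open>n\<close> in row
  \<open>k\<close> come from permutations fixing \<open>n\<close>.\<close>

lemma strip_polytabloid:
  assumes t: "bij_betw t {..<n} (diagram (dec \<alpha> k))" and \<alpha>: "is_part \<alpha>" and k: "corner \<alpha> k"
  defines "s \<equiv> t(n := (k, \<alpha> k - 1))"
  shows "bij_betw s {..<Suc n} (diagram \<alpha>)"
    and "k < j \<Longrightarrow> strip n j (polytabloid (Suc n) s) = 0"
    and "strip n k (polytabloid (Suc n) s) = polytabloid n t"
proof -
  have \<alpha>k: "\<alpha> k > 0" using k by (simp add: corner_def)
  have ins: "diagram \<alpha> = diagram (dec \<alpha> k) \<union> {(k, \<alpha> k - 1)}"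
    using \<alpha>k by (auto simp: diagram_def dec_def split: if_splits)
  have "bij_betw s {..<n} (diagram (dec \<alpha> k))"
    using t bij_betw_cong[of "{..<n}" s t "diagram (dec \<alpha> k)"] by (simp add: s_def)
  then have "bij_betw s ({..<n} \<union> {n}) (diagram (dec \<alpha> k) \<union> {s n})"
    by (rule notIn_Un_bij_betw[rotated 2]) (auto simp: s_def diagram_def dec_def)
  then show bij: "bij_betw s {..<Suc n} (diagram \<alpha>)"
    using ins by (simp add: s_def lessThan_Suc)
  \<comment> \<open>The entry that \<pi> sends to \<open>n\<close> lies in row \<open>j\<close> and
    in the column of \<open>n\<close>, so this column reaches row \<open>j\<close>.\<close>
  have key: "fst (s (inv \<pi> n)) = j \<and> snd (s (inv \<pi> n)) = \<alpha> k - 1 \<and> \<alpha> k - 1 < \<alpha> j \<and> inv \<pi> n < Suc n"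
    if \<pi>: "\<pi> \<in> col_stabilizer (Suc n) s" "r(n := j) \<circ> \<pi> = tabloid (Suc n) s" for \<pi> j r
  proof -
    have per: "\<pi> permutes {..<Suc n}" and col: "\<And>w. w < Suc n \<Longrightarrow> snd (s (\<pi> w)) = snd (s w)"
      using \<pi> by (auto simp: col_stabilizer_def)
    have y: "\<pi> (inv \<pi> n) = n" using permutes_inverses(1)[OF per] .
    have yn: "inv \<pi> n < Suc n" using permutes_in_image[OF per, of "inv \<pi> n"] y by simp
    have "tabloid (Suc n) s (inv \<pi> n) = j" using fun_cong[OF \<pi>(2), of "inv \<pi> n"] y by simp
    then have f: "fst (s (inv \<pi> n)) = j" using yn by (simp add: tabloid_def)
    have sn: "snd (s (inv \<pi> n)) = \<alpha> k - 1" using col[OF yn] y by (simp add: s_def)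
    have "s (inv \<pi> n) \<in> diagram \<alpha>" using bij yn by (auto simp: bij_betw_def)
    then have "\<alpha> k - 1 < \<alpha> j" using f sn by (cases "s (inv \<pi> n)") (auto simp: diagram_def)
    then show ?thesis using f sn yn by simp
  qed
  show "strip n j (polytabloid (Suc n) s) = 0" if "k < j"
  proof
    fix r
    have "\<alpha> j \<le> \<alpha> k - 1"
      using is_part_mono[OF \<alpha>, of "Suc k" j] that k by (simp add: corner_def)
    then have "\<not> (\<pi> \<in> col_stabilizer (Suc n) s \<and> r(n := j) \<circ> \<pi> = tabloid (Suc n) s)" for \<pi>
      using key[of \<pi> r j] by linarith
    then have "{\<pi>. \<pi> \<in> col_stabilizer (Suc n) s \<and> r(n := j) \<circ> \<pi> = tabloid (Suc n) s} = {}"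
      by blast
    then show "strip n j (polytabloid (Suc n) s) r = 0 r"
      unfolding strip_def polytabloid_eval by (simp only: sum.empty zero_fun_apply if_cancel)
  qed
  show "strip n k (polytabloid (Suc n) s) = polytabloid n t"
  proof
    fix r :: "nat \<Rightarrow> nat"
    show "strip n k (polytabloid (Suc n) s) r = polytabloid n t r"
    proof (cases "r \<in> extensional {..<n}")
      case False
      then have "polytabloid n t r = 0"
        using polytabloid_weight_space[OF t] by (auto simp: weight_space_def tabloids_def)
      then show ?thesis using False by (simp add: strip_def)
    next
      case True
      have "{\<pi>. \<pi> \<in> col_stabilizer (Suc n) s \<and> r(n := k) \<circ> \<pi> = tabloid (Suc n) s}
          = {\<pi>. \<pi> \<in> col_stabilizer n t \<and> r \<circ> \<pi> = tabloid n t}" (is "?A = ?B")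
      proof (intro set_eqI iffI)
        fix \<pi> assume "\<pi> \<in> ?A"
        then have \<pi>: "\<pi> \<in> col_stabilizer (Suc n) s" "r(n := k) \<circ> \<pi> = tabloid (Suc n) s" by auto
        have per: "\<pi> permutes {..<Suc n}" and col: "\<And>w. w < Suc n \<Longrightarrow> snd (s (\<pi> w)) = snd (s w)"
          using \<pi> by (auto simp: col_stabilizer_def)
        have "s (inv \<pi> n) = s n" using key[OF \<pi>] by (simp add: s_def prod_eq_iff)
        then have "inv \<pi> n = n"
          using key[OF \<pi>] bij unfolding bij_betw_def by (meson inj_onD lessI lessThan_iff)
        then have fix_n: "\<pi> n = n" using permutes_inverses(1)[OF per, of n] by simp
        have per': "\<pi> permutes {..<n}"
          by (rule permutes_superset[OF per]) (use fix_n in \<open>simp add: less_Suc_eq\<close>)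
        have ne: "w < n \<Longrightarrow> \<pi> w < n" for w using permutes_in_image[OF per', of w] by simp
        have "snd (t (\<pi> w)) = snd (t w)" if "w < n" for w
          using col[of w] that ne[OF that] by (simp add: s_def)
        then have "\<pi> \<in> col_stabilizer n t" using per' by (simp add: col_stabilizer_def)
        moreover have "r \<circ> \<pi> = tabloid n t"
        proof
          fix w
          show "(r \<circ> \<pi>) w = tabloid n t w"
          proof (cases "w < n")
            case True
            then show ?thesis using fun_cong[OF \<pi>(2), of w] ne[OF True] by (simp add: tabloid_def s_def)
          next
            case False
            then show ?thesis using permutes_not_in[OF per', of w] \<open>r \<in> extensional {..<n}\<close>
              by (simp add: tabloid_def extensional_def)
          qed
        qed
        ultimately show "\<pi> \<in> ?B" by simp
      next
        fix \<pi> assume "\<pi> \<in> ?B"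
        then have \<pi>: "\<pi> \<in> col_stabilizer n t" "r \<circ> \<pi> = tabloid n t" by auto
        have per: "\<pi> permutes {..<n}" and col: "\<And>w. w < n \<Longrightarrow> snd (t (\<pi> w)) = snd (t w)"
          using \<pi> by (auto simp: col_stabilizer_def)
        have fix_n: "\<pi> n = n" using permutes_not_in[OF per, of n] by simp
        have ne: "w < n \<Longrightarrow> \<pi> w < n" for w using permutes_in_image[OF per, of w] by simp
        have per': "\<pi> permutes {..<Suc n}" using permutes_subset[OF per, of "{..<Suc n}"] by auto
        have "snd (s (\<pi> w)) = snd (s w)" if "w < Suc n" for w
          using col[of w] that ne[of w] fix_n by (cases "w = n") (auto simp: s_def)
        then have "\<pi> \<in> col_stabilizer (Suc n) s" using per' by (simp add: col_stabilizer_def)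
        moreover have "r(n := k) \<circ> \<pi> = tabloid (Suc n) s"
        proof
          fix w
          consider "w < n" | "w = n" | "w > n" by linarith
          then show "(r(n := k) \<circ> \<pi>) w = tabloid (Suc n) s w"
          proof cases
            case 1
            then show ?thesis using fun_cong[OF \<pi>(2), of w] ne[OF 1] by (simp add: tabloid_def s_def)
          next
            case 2
            then show ?thesis using fix_n by (simp add: tabloid_def s_def)
          next
            case 3
            then show ?thesis using permutes_not_in[OF per, of w] \<open>r \<in> extensional {..<n}\<close>
              by (simp add: tabloid_def extensional_def)
          qed
        qed
        ultimately show "\<pi> \<in> ?A" by simp
      qed
      then show ?thesis using True by (simp add: strip_def polytabloid_eval)
    qed
  qed
qed

lemma fin_subspace_specht_fun:
  assumes "shape L m \<alpha>" "is_part \<alpha>"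
  shows "cfun.fin_subspace (specht_fun n \<alpha>)"
proof (rule cfun.fin_subspace_mono)
  show "cfun.fin_subspace (hw n \<alpha>)"
    by (rule fin_subspace_hw[where L = L]) (use assms in \<open>simp add: shape_def\<close>)
  show "specht_fun n \<alpha> \<subseteq> hw n \<alpha>" using specht_fun_subset_hw assms(2) .
qed (simp add: specht_fun_def)

text \<open>\<open>strip_polytabloid\<close> lifts each generator of shape
  \<open>dec \<alpha> k\<close> to a polytabloid of shape \<alpha> killed by all strippings of
  larger index, as \<open>dim_filtration_ge\<close> demands.\<close>

lemma dim_specht_fun_ge:
  assumes "shape L m \<alpha>" "is_part \<alpha>"
  shows "(\<Sum>k<L. cfun.dim (if corner \<alpha> k then specht_fun n (dec \<alpha> k) else {0}))
     \<le> cfun.dim (specht_fun (Suc n) \<alpha>)"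
proof (rule cfun.dim_filtration_ge[where rk = "\<lambda>k. k" and \<theta> = "strip n"])
  fix k assume "k \<in> {..<L}"
  let ?V = "{v \<in> specht_fun (Suc n) \<alpha>. \<forall>j\<in>{..<L}. k < j \<longrightarrow> strip n j v = 0}"
  have sS: "cfun.subspace (specht_fun (Suc n) \<alpha>)" by (simp add: specht_fun_def)
  have sV: "cfun.subspace ?V"
    unfolding cfun.subspace_def
    using cfun.subspace_0[OF sS] cfun.subspace_add[OF sS] cfun.subspace_scale[OF sS]
    by (auto simp: module_hom.add[OF strip_hom] module_hom.scale[OF strip_hom] module_hom.zero[OF strip_hom])
  have im: "cfun.subspace (strip n k ` ?V)"
    using module_hom.subspace_image[OF strip_hom sV] .
  show "(if corner \<alpha> k then specht_fun n (dec \<alpha> k) else {0}) \<subseteq> strip n k ` ?V"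
  proof (cases "corner \<alpha> k")
    case True
    have "polytabloid n t \<in> strip n k ` ?V" if t: "bij_betw t {..<n} (diagram (dec \<alpha> k))" for t
    proof -
      note sp = strip_polytabloid[OF t assms(2) True]
      have "polytabloid (Suc n) (t(n := (k, \<alpha> k - 1))) \<in> ?V"
        using sp(1,2) unfolding specht_fun_def by (auto intro: cfun.span_base)
      then show ?thesis using sp(3) by (metis (no_types, lifting) image_eqI)
    qed
    then have "specht_fun n (dec \<alpha> k) \<subseteq> strip n k ` ?V"
      unfolding specht_fun_def[of n "dec \<alpha> k"] by (intro cfun.span_minimal im) auto
    then show ?thesis using True by simp
  next
    case False
    then show ?thesis using cfun.subspace_0[OF im] by simp
  qed
qed (use fin_subspace_specht_fun[OF assms] strip_hom in \<open>auto simp: specht_fun_def cfun.subspace_single_0\<close>)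

text \<open>By induction the pieces in both branching inequalities coincide, so the included space
  has at least the dimension of the including one.\<close>

theorem specht_fun_eq_hw:
  assumes "shape L n \<alpha>" "is_part \<alpha>"
  shows "specht_fun n \<alpha> = hw n \<alpha>"
  using assms
proof (induction n arbitrary: \<alpha>)
  case 0
  then have \<alpha>: "\<alpha> = (\<lambda>_. 0)" by (auto simp: shape_def fun_eq_iff) (metis lessThan_iff linorder_not_le)
  have "diagram \<alpha> = {}" by (auto simp: diagram_def \<alpha>)
  then have bij: "bij_betw (\<lambda>_. (0, 0)) {..<0::nat} (diagram \<alpha>)" by (simp add: bij_betw_def)
  define e where "e = polytabloid 0 (\<lambda>_. (0, 0))"
  have e: "e \<in> specht_fun 0 \<alpha>" unfolding specht_fun_def e_def using bij by (intro cfun.span_base) auto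
  \<comment> \<open>In size 0 the only extensional word is \<open>undefined\<close> everywhere; the
    polytabloid has coefficient 1 there, so both spaces are the same line.\<close>
  define u :: "nat \<Rightarrow> nat" where "u = (\<lambda>_. undefined)"
  have eu: "e u = 1"
  proof -
    have "{\<pi>. \<pi> \<in> col_stabilizer 0 (\<lambda>_. (0, 0)) \<and> u \<circ> \<pi> = tabloid 0 (\<lambda>_. (0, 0))} = {id}"
      by (auto simp: col_stabilizer_def u_def tabloid_def fun_eq_iff permutes_def)
    then show ?thesis by (simp add: e_def polytabloid_eval sign_id)
  qed
  have tab: "tabloids 0 \<alpha> \<subseteq> {u}" by (auto simp: tabloids_def u_def extensional_def fun_eq_iff)
  have "v \<in> specht_fun 0 \<alpha>" if v: "v \<in> hw 0 \<alpha>" for v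
  proof -
    have "v = fscale (v u) e"
    proof
      fix r
      have "v r = 0" "e r = 0" if "r \<noteq> u"
        using that tab v polytabloid_weight_space[OF bij]
        by (auto simp: hw_def weight_space_def e_def)
      then show "v r = fscale (v u) e r" using eu by (cases "r = u") (auto simp: fscale_def)
    qed
    then show ?thesis using e cfun.span_scale unfolding specht_fun_def by metis
  qed
  then show ?case using specht_fun_subset_hw[OF \<open>is_part \<alpha>\<close>, of 0] by blast
next
  case (Suc n)
  have fin: "cfun.fin_subspace (hw (Suc n) \<alpha>)"
    by (rule fin_subspace_hw[where L = L]) (use Suc.prems in \<open>simp add: shape_def\<close>)
  have "(if corner \<alpha> k then specht_fun n (dec \<alpha> k) else {0}) = dec_hw n \<alpha> k" for k
    using Suc.IH[of "dec \<alpha> k"] shape_dec[OF Suc.prems(1)] is_part_dec[OF Suc.prems(2)]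
    by (simp add: dec_hw_def)
  then have "(\<Sum>k<L. cfun.dim (dec_hw n \<alpha> k)) \<le> cfun.dim (specht_fun (Suc n) \<alpha>)"
    using dim_specht_fun_ge[OF Suc.prems, of n] by simp
  then have "cfun.dim (hw (Suc n) \<alpha>) \<le> cfun.dim (specht_fun (Suc n) \<alpha>)"
    using dim_hw_le[OF Suc.prems, of n] by linarith
  then show ?case
    by (rule cfun.dim_subspace_mono(2)[OF fin _ specht_fun_subset_hw[OF Suc.prems(2)], rotated])
       (simp add: specht_fun_def)
qed

lemma dim_hw_eq:
  assumes "shape L (Suc n) \<alpha>" "is_part \<alpha>"
  shows "cfun.dim (hw (Suc n) \<alpha>) = (\<Sum>k<L. cfun.dim (dec_hw n \<alpha> k))"
proof -
  have "(if corner \<alpha> k then specht_fun n (dec \<alpha> k) else {0}) = dec_hw n \<alpha> k" for k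
    using specht_fun_eq_hw[of L n "dec \<alpha> k"] shape_dec[OF assms(1)] is_part_dec[OF assms(2)]
    by (simp add: dec_hw_def)
  then have "(\<Sum>k<L. cfun.dim (dec_hw n \<alpha> k)) \<le> cfun.dim (hw (Suc n) \<alpha>)"
    using dim_specht_fun_ge[OF assms, of n] specht_fun_eq_hw[OF assms] by simp
  then show ?thesis using dim_hw_le[OF assms, of n] by linarith
qed

section \<open>Branching of characters\<close>

definition chi :: "nat \<Rightarrow> (nat \<Rightarrow> nat) \<Rightarrow> (nat \<Rightarrow> nat) \<Rightarrow> complex" where
  "chi n \<alpha> \<sigma> = cfun.trace_on (hw n \<alpha>) (act \<sigma>)"

lemma fin_subspace_hw_shape: "shape L m \<alpha> \<Longrightarrow> cfun.fin_subspace (hw n \<alpha>)"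
  by (rule fin_subspace_hw[where L = L]) (simp add: shape_def)

lemma act_hw_image: "\<sigma> permutes {..<n} \<Longrightarrow> act \<sigma> ` hw n \<alpha> \<subseteq> hw n \<alpha>"
  using act_hw by blast

lemma act_comp: "act (\<sigma> \<circ> \<tau>) v = act \<sigma> (act \<tau> v)"
  by (simp add: act_def comp_assoc)

lemma permutes_lessThan_Suc: "\<sigma> permutes {..<n} \<Longrightarrow> \<sigma> permutes {..<Suc n}"
  by (rule permutes_subset) auto

lemma chi_conj:
  assumes "shape L m \<alpha>" and \<sigma>: "\<sigma> permutes {..<n}" and \<pi>: "\<pi> permutes {..<n}"
    and eq: "\<pi> \<circ> \<sigma> = \<rho> \<circ> \<pi>"
  shows "chi n \<alpha> \<sigma> = chi n \<alpha> \<rho>"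
  unfolding chi_def
proof (rule cfun.trace_conj[where h = "act \<pi>"])
  have inv: "act \<pi> (act (inv \<pi>) v) = v" "act (inv \<pi>) (act \<pi> v) = v" for v
    using permutes_inv_o[OF \<pi>] by (simp_all add: act_comp[symmetric]) (simp_all add: act_def)
  show "act \<pi> ` hw n \<alpha> = hw n \<alpha>"
    using act_hw[OF \<pi>] act_hw[OF permutes_inv[OF \<pi>]] inv(1) by (metis (no_types, lifting) image_eqI image_subsetI subsetI subset_antisym)
  show "v = 0" if "act \<pi> v = 0" for v
    using inv(2)[of v] that module_hom.zero[OF act_hom] by metis
  show "act \<pi> (act \<sigma> v) = act \<rho> (act \<pi> v)" for v
    using eq by (metis act_comp)
qed (use fin_subspace_hw_shape[OF assms(1)] act_hom act_hw_image[OF \<sigma>] in auto)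

text \<open>A permutation of the first \<open>n\<close> entries commutes with stripping, so its
  trace adds up along the filtration; \<open>dim_hw_eq\<close> makes the embeddings onto.\<close>

lemma chi_branch:
  assumes \<sigma>: "\<sigma> permutes {..<n}" and sh: "shape L (Suc n) \<alpha>" and pt: "is_part \<alpha>"
  shows "chi (Suc n) \<alpha> \<sigma> = (\<Sum>k<L. if corner \<alpha> k then chi n (dec \<alpha> k) \<sigma> else 0)"
proof -
  have "cfun.trace_on (hw (Suc n) \<alpha>) (act \<sigma>) = (\<Sum>k<L. cfun.trace_on (dec_hw n \<alpha> k) (act \<sigma>))"
  proof (rule cfun.trace_filtration[where rk = "\<lambda>k. k" and \<theta> = "strip n"])
    show "strip n k v \<in> dec_hw n \<alpha> k"
      if "v \<in> hw (Suc n) \<alpha>" "\<And>j. j \<in> {..<L} \<Longrightarrow> k < j \<Longrightarrow> strip n j v = 0" for k v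
      by (rule strip_dec_hw[OF sh pt that(1)]) (use that(2) in simp)
    show "v = 0" if "v \<in> hw (Suc n) \<alpha>" "\<And>k. k \<in> {..<L} \<Longrightarrow> strip n k v = 0" for v
      by (rule strip_all_zero[where L = L and n = n and \<alpha> = \<alpha>])
         (use that sh in \<open>simp_all add: hw_def shape_def\<close>)
    show "(\<Sum>k<L. cfun.dim (dec_hw n \<alpha> k)) \<le> cfun.dim (hw (Suc n) \<alpha>)"
      using dim_hw_eq[OF sh pt] by simp
  qed (use fin_subspace_hw_shape[OF sh] fin_subspace_dec_hw[OF sh] strip_hom act_hom
        act_hw_image[OF permutes_lessThan_Suc[OF \<sigma>]] strip_act[OF \<sigma>] in auto)
  also have "\<dots> = (\<Sum>k<L. if corner \<alpha> k then chi n (dec \<alpha> k) \<sigma> else 0)"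
    by (rule sum.cong) (auto simp: dec_hw_def chi_def)
  finally show ?thesis by (simp add: chi_def)
qed

section \<open>Removing two entries: the branching rule for a transposition\<close>

text \<open>Position \<open>Suc n\<close> carries the letter \<open>i\<close> and position
  \<open>n\<close> the letter \<open>j\<close>, so row \<open>i\<close> loses its cell
  first.\<close>

definition strip2 :: "nat \<Rightarrow> nat \<Rightarrow> nat \<Rightarrow> ((nat \<Rightarrow> nat) \<Rightarrow> complex) \<Rightarrow> (nat \<Rightarrow> nat) \<Rightarrow> complex" where
  "strip2 n i j v = strip n j (strip (Suc n) i v)"

text \<open>The transposition of the two stripped entries acts on these combinations by a sign.\<close>

definition strip_pm :: "nat \<Rightarrow> nat \<times> nat \<Rightarrow> ((nat \<Rightarrow> nat) \<Rightarrow> complex) \<Rightarrow> (nat \<Rightarrow> nat) \<Rightarrow> complex" where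
  "strip_pm n = (\<lambda>(i, j) v. if i = j then strip2 n i j v
     else if i < j then strip2 n i j v + strip2 n j i v else strip2 n i j v - strip2 n j i v)"

definition dec2_hw :: "nat \<Rightarrow> (nat \<Rightarrow> nat) \<Rightarrow> nat \<times> nat \<Rightarrow> ((nat \<Rightarrow> nat) \<Rightarrow> complex) set" where
  "dec2_hw n \<alpha> = (\<lambda>(i, j). if corner \<alpha> i \<and> corner (dec \<alpha> i) j then hw n (dec (dec \<alpha> i) j) else {0})"

lemma strip2_hom: "module_hom fscale fscale (strip2 n i j)"
  by (rule module_hom_fscaleI)
     (simp_all add: strip2_def module_hom.add[OF strip_hom] module_hom.scale[OF strip_hom])

lemma strip_pm_hom: "module_hom fscale fscale (strip_pm n x)"
  by (rule module_hom_fscaleI; cases x)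
     (auto simp: strip_pm_def module_hom.add[OF strip2_hom] module_hom.scale[OF strip2_hom]
       cfun.scale_right_distrib cfun.scale_right_diff_distrib)

lemma dec_commute: "dec (dec \<alpha> i) j = dec (dec \<alpha> j) i"
  by (auto simp: dec_def fun_eq_iff)

lemma strip2_weight_space:
  assumes v: "v \<in> weight_space (Suc (Suc n)) \<alpha>"
  shows "strip2 n i j v \<in> weight_space n (dec (dec \<alpha> i) j)"
    and "\<alpha> i = 0 \<or> dec \<alpha> i j = 0 \<Longrightarrow> strip2 n i j v = 0"
proof -
  note s = strip_weight_space[OF v, of i]
  show "strip2 n i j v \<in> weight_space n (dec (dec \<alpha> i) j)"
    unfolding strip2_def by (rule strip_weight_space(1)[OF s(1)])
  show "strip2 n i j v = 0" if "\<alpha> i = 0 \<or> dec \<alpha> i j = 0"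
    using that s(2) strip_weight_space(2)[OF s(1), of j] module_hom.zero[OF strip_hom]
    unfolding strip2_def by auto
qed

lemma strip2_raise:
  assumes "raise (Suc (Suc n)) k v = 0"
  shows "raise n k (strip2 n i j v) + (if j = k then strip2 n i (Suc k) v else 0)
    + (if i = k then strip2 n (Suc k) j v else 0) = 0"
proof -
  have "0 = strip n j (strip (Suc n) i (raise (Suc (Suc n)) k v))"
    using assms module_hom.zero[OF strip_hom] by simp
  also have "\<dots> = strip n j (raise (Suc n) k (strip (Suc n) i v)) + (if i = k then strip2 n (Suc k) j v else 0)"
    unfolding strip_raise[of "Suc n"]
    by (simp add: module_hom.add[OF strip_hom] module_hom.zero[OF strip_hom] strip2_def)
  finally show ?thesis
    unfolding strip_raise[of n] strip2_def by (rule sym)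
qed

lemma strip2_hw:
  assumes v: "v \<in> hw (Suc (Suc n)) \<alpha>" and "strip2 n i (Suc j) v = 0" "strip2 n (Suc i) j v = 0"
  shows "strip2 n i j v \<in> hw n (dec (dec \<alpha> i) j)"
proof -
  have "raise n k (strip2 n i j v) = 0" for k
    using strip2_raise[of n k v i j] assms by (auto simp: hw_def split: if_splits)
  then show ?thesis using strip2_weight_space(1)[of v n \<alpha>] v by (simp add: hw_def)
qed

text \<open>Pairs are peeled off by decreasing maximum, then decreasing minimum, so all strippings
  that could spoil the highest weight condition already vanish. What needs an argument is the
  vanishing for orders of removal that are not allowed.\<close>

lemma strip_pm_dec2_hw:
  assumes sh: "shape L m \<alpha>" and pt: "is_part \<alpha>" and v: "v \<in> hw (Suc (Suc n)) \<alpha>"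
    and z: "\<And>a b. max i j < max a b \<or> max i j = max a b \<and> min i j < min a b \<Longrightarrow> strip2 n a b v = 0"
  shows "strip_pm n (i, j) v \<in> dec2_hw n \<alpha> (i, j)"
proof -
  have ws: "v \<in> weight_space (Suc (Suc n)) \<alpha>" using v by (simp add: hw_def)
  define \<beta> where "\<beta> = dec (dec \<alpha> i) j"
  have sup: "\<beta> k = 0" if "L \<le> k" for k using sh that by (simp add: \<beta>_def dec_def shape_def)
  have "strip2 n i j v \<in> hw n \<beta>"
    unfolding \<beta>_def by (rule strip2_hw[OF v]; rule z) (auto simp: max_def min_def)
  moreover have "strip2 n j i v \<in> hw n \<beta>"
    unfolding \<beta>_def dec_commute[of _ i j] by (rule strip2_hw[OF v]; rule z) (auto simp: max_def min_def)
  ultimately have in_hw: "strip_pm n (i, j) v \<in> hw n \<beta>"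
    using cfun.subspace_add[OF hw_subspace] cfun.subspace_diff[OF hw_subspace]
    by (auto simp: strip_pm_def)
  show ?thesis
  proof (cases "corner \<alpha> i \<and> corner (dec \<alpha> i) j")
    case True
    then show ?thesis using in_hw by (simp add: dec2_hw_def \<beta>_def)
  next
    case False
    have "strip_pm n (i, j) v = 0"
    proof (cases "\<alpha> i = 0 \<or> dec \<alpha> i j = 0")
      case True
      then have "\<alpha> j = 0 \<or> dec \<alpha> j i = 0" by (auto simp: dec_def split: if_splits)
      then have "strip2 n j i v = 0" by (rule strip2_weight_space(2)[OF ws])
      moreover have "strip2 n i j v = 0" using True by (rule strip2_weight_space(2)[OF ws])
      ultimately show ?thesis by (cases "i = j") (simp_all add: strip_pm_def)
    next
      case pos: False
      show ?thesis
      proof (cases "is_part \<beta>")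
        case False
        then obtain k where "\<beta> k < \<beta> (Suc k)" by (auto simp: is_part_def not_le)
        then have "hw n \<beta> = {0}" using hw_not_partition[of L \<beta> k n] sup by blast
        then show ?thesis using in_hw by simp
      next
        case \<beta>: True
        \<comment> \<open>Both cells are present and their joint removal leaves a partition, so only
          the order is wrong: row \<open>i\<close> would lose its cell before row
          \<open>i + 1\<close> of equal length.\<close>
        have nc: "\<not> corner \<alpha> i"
        proof
          assume c: "corner \<alpha> i"
          then have "is_part (dec \<alpha> i)" "\<not> corner (dec \<alpha> i) j"
            using is_part_dec[OF pt] False by auto
          then have "dec \<alpha> i (Suc j) = dec \<alpha> i j"
            by (auto simp: is_part_def corner_def not_less le_antisym)
          then have "\<beta> j < \<beta> (Suc j)" using pos by (simp add: \<beta>_def dec_def[of _ j])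
          then show False using \<beta> by (auto simp: is_part_def not_le[symmetric])
        qed
        then have ai: "\<alpha> (Suc i) = \<alpha> i" using pt by (auto simp: is_part_def corner_def not_less le_antisym)
        have j: "j = Suc i"
        proof (rule ccontr)
          assume "j \<noteq> Suc i"
          then have "\<beta> (Suc i) = \<alpha> i" "\<beta> i < \<alpha> i" using ai pos by (auto simp: \<beta>_def dec_def)
          then show False using \<beta> unfolding is_part_def by (metis not_le)
        qed
        have eq: "\<beta> i = \<beta> (Suc i)" using ai j by (simp add: \<beta>_def dec_def)
        \<comment> \<open>Here i < j, so \<open>strip_pm\<close> is the symmetric combination. Up to
          sign it is raised from the stripping at \<open>(i, i)\<close>, and
          \<open>hw_raise_zero\<close> applies because \<beta> agrees on the two rows.\<close>
        have "raise n i (strip2 n i i v) + strip2 n i (Suc i) v + strip2 n (Suc i) i v = 0"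
          using strip2_raise[of n i v i i] v by (simp add: hw_def)
        then have "strip2 n i (Suc i) v + strip2 n (Suc i) i v = - raise n i (strip2 n i i v)"
          unfolding add.assoc add_eq_0_iff .
        then have "strip_pm n (i, j) v = raise n i (- strip2 n i i v)"
          using j by (simp add: strip_pm_def module_hom.neg[OF raise_hom])
        then show ?thesis using hw_raise_zero[of L \<beta> i _ n] sup eq in_hw by blast
      qed
    qed
    then show ?thesis using cfun.subspace_0[OF hw_subspace] by (simp add: dec2_hw_def)
  qed
qed

lemma strip2_act:
  assumes \<sigma>: "\<sigma> permutes {..<n}"
  shows "strip2 n i j (act (\<sigma> \<circ> transpose n (Suc n)) v) = act \<sigma> (strip2 n j i v)"
proof
  fix r :: "nat \<Rightarrow> nat"
  have ext: "r \<circ> \<sigma> \<in> extensional {..<n} \<longleftrightarrow> r \<in> extensional {..<n}"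
    using permutes_not_in[OF \<sigma>] by (auto simp: extensional_def)
  have ext2: "r(n := a) \<in> extensional {..<Suc n}" if "r \<in> extensional {..<n}" for r :: "nat \<Rightarrow> nat" and a
    using that by (auto simp: extensional_def)
  have fx: "\<sigma> n = n" "\<sigma> (Suc n) = Suc n" using permutes_not_in[OF \<sigma>] by auto
  have inj: "\<sigma> x = \<sigma> y \<longleftrightarrow> x = y" for x y using permutes_inj[OF \<sigma>] by (auto dest: injD)
  have "r(n := j, Suc n := i) \<circ> (\<sigma> \<circ> transpose n (Suc n)) = (r \<circ> \<sigma>)(n := i, Suc n := j)"
  proof
    fix x
    show "(r(n := j, Suc n := i) \<circ> (\<sigma> \<circ> transpose n (Suc n))) x = ((r \<circ> \<sigma>)(n := i, Suc n := j)) x"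
      using fx inj[of x n] inj[of x "Suc n"] by (cases "x = n"; cases "x = Suc n") auto
  qed
  then show "strip2 n i j (act (\<sigma> \<circ> transpose n (Suc n)) v) r = act \<sigma> (strip2 n j i v) r"
    using ext ext2 by (simp add: strip2_def strip_def act_def)
qed

lemma strip_pm_act:
  assumes \<sigma>: "\<sigma> permutes {..<n}"
  shows "strip_pm n (i, j) (act (\<sigma> \<circ> transpose n (Suc n)) v)
    = fscale (if i \<le> j then 1 else - 1) (act \<sigma> (strip_pm n (i, j) v))"
proof -
  have m1: "fscale (- 1) u = - u" for u :: "(nat \<Rightarrow> nat) \<Rightarrow> complex" by (auto simp: fscale_def)
  show ?thesis
    using strip2_act[OF \<sigma>]
    by (auto simp: strip_pm_def m1 module_hom.add[OF act_hom] module_hom.diff[OF act_hom] add.commute)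
qed

text \<open>Off the diagonal the two combinations are sum and difference, up to sign, of the same
  two strippings, and 2 is invertible.\<close>

lemma strip_pm_zero:
  assumes "strip_pm n (i, j) v = 0" "strip_pm n (j, i) v = 0"
  shows "strip2 n i j v = 0"
proof
  fix r
  have e: "strip_pm n (i, j) v r = 0" "strip_pm n (j, i) v r = 0" using assms by simp_all
  consider "i = j" | "i < j" | "j < i" by linarith
  then show "strip2 n i j v r = 0 r"
  proof cases
    case 2
    then have "strip2 n i j v r + strip2 n j i v r = 0" "strip2 n j i v r - strip2 n i j v r = 0"
      using e by (auto simp: strip_pm_def)
    then show ?thesis by (simp add: complex_eq_iff)
  next
    case 3
    then have "strip2 n i j v r - strip2 n j i v r = 0" "strip2 n j i v r + strip2 n i j v r = 0"
      using e by (auto simp: strip_pm_def)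
    then show ?thesis by (simp add: complex_eq_iff)
  qed (use e in \<open>simp add: strip_pm_def\<close>)
qed

text \<open>Encodes a lexicographic order as a single number, since the filtration lemmas take ranks
  in the natural numbers.\<close>

lemma pair_rank_less:
  fixes a b c d L :: nat
  assumes "b < L" "a < c \<or> a = c \<and> b < d"
  shows "a * L + b < c * L + d"
proof (cases "a < c")
  case True
  then have "Suc a * L \<le> c * L" by (intro mult_right_mono) auto
  then show ?thesis using assms(1) by simp
qed (use assms in auto)

text \<open>The swap exchanges the two orders of removal; \<open>(i, j)\<close> with i < j takes the
  symmetric part and \<open>(j, i)\<close> the antisymmetric part. Two cells of one row give only
  the sign 1, a vertical pair only the sign -1.\<close>

lemma chi_branch_transpose:
  assumes \<sigma>: "\<sigma> permutes {..<n}" and sh: "shape L (Suc (Suc n)) \<alpha>" and pt: "is_part \<alpha>"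
  shows "chi (Suc (Suc n)) \<alpha> (\<sigma> \<circ> transpose n (Suc n))
    = (\<Sum>i<L. \<Sum>j<L. if corner \<alpha> i \<and> corner (dec \<alpha> i) j
        then (if i \<le> j then 1 else - 1) * chi n (dec (dec \<alpha> i) j) \<sigma> else 0)"
proof -
  let ?I = "{..<L} \<times> {..<L}" and ?V = "hw (Suc (Suc n)) \<alpha>" and ?f = "act (\<sigma> \<circ> transpose n (Suc n))"
  define sg :: "nat \<times> nat \<Rightarrow> complex" where "sg = (\<lambda>(i, j). if i \<le> j then 1 else - 1)"
  have fin2: "cfun.fin_subspace (hw n (dec (dec \<alpha> i) j))" for i j
    by (rule fin_subspace_hw[where L = L]) (use sh in \<open>simp add: shape_def dec_def\<close>)
  have ws: "v \<in> weight_space (Suc (Suc n)) \<alpha>" if "v \<in> ?V" for v using that by (simp add: hw_def)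
  have out: "strip2 n a b v = 0" if "v \<in> ?V" "\<not> (a < L \<and> b < L)" for a b v
    by (rule strip2_weight_space(2)[OF ws[OF that(1)]])
       (use sh that(2) in \<open>auto simp: shape_def dec_def not_less\<close>)
  have per: "\<sigma> \<circ> transpose n (Suc n) permutes {..<Suc (Suc n)}"
    by (intro permutes_compose permutes_swap_id permutes_lessThan_Suc \<sigma>) auto
  have hom: "module_hom fscale fscale (\<lambda>v. fscale c (act \<sigma> v))" for c
    by (rule module_hom_fscaleI)
       (simp_all add: module_hom.add[OF act_hom] module_hom.scale[OF act_hom] cfun.scale_right_distrib mult.commute)
  have "cfun.trace_on ?V ?f = (\<Sum>x\<in>?I. cfun.trace_on (dec2_hw n \<alpha> x) (\<lambda>v. fscale (sg x) (act \<sigma> v)))"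
  proof (rule cfun.trace_filtration[where rk = "\<lambda>(i, j). max i j * L + min i j" and \<theta> = "strip_pm n"])
    show "strip_pm n x v \<in> dec2_hw n \<alpha> x"
      if x: "x \<in> ?I" and v: "v \<in> ?V" and z: "\<And>y. y \<in> ?I \<Longrightarrow>
        (case x of (i, j) \<Rightarrow> max i j * L + min i j) < (case y of (i, j) \<Rightarrow> max i j * L + min i j) \<Longrightarrow> strip_pm n y v = 0" for x v
    proof -
      obtain i j where ij: "x = (i, j)" "i < L" "j < L" using x by auto
      have "strip2 n a b v = 0" if ab: "max i j < max a b \<or> max i j = max a b \<and> min i j < min a b" for a b
      proof (cases "a < L \<and> b < L")
        case True
        have lt: "max i j * L + min i j < max a b * L + min a b"
          by (rule pair_rank_less[OF _ ab]) (use ij in auto)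
        have "strip_pm n (a, b) v = 0" using z[of "(a, b)"] True lt ij by simp
        moreover have "strip_pm n (b, a) v = 0"
          using z[of "(b, a)"] True lt ij by (simp add: max.commute min.commute)
        ultimately show ?thesis by (rule strip_pm_zero)
      qed (use out v in blast)
      then show ?thesis unfolding ij(1) by (rule strip_pm_dec2_hw[OF sh pt v])
    qed
    show "v = 0" if v: "v \<in> ?V" and z: "\<And>x. x \<in> ?I \<Longrightarrow> strip_pm n x v = 0" for v
    proof (rule strip_all_zero[OF ws[OF v], of L])
      show "strip (Suc n) i v = 0" if "i < L" for i
      proof (rule strip_all_zero[OF strip_weight_space(1)[OF ws[OF v]], of L])
        show "strip n j (strip (Suc n) i v) = 0" if "j < L" for j
          using strip_pm_zero[of n i j v] z \<open>i < L\<close> that by (simp add: strip2_def)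
      qed (use sh in \<open>simp add: shape_def dec_def\<close>)
    qed (use sh in \<open>simp add: shape_def\<close>)
    show "strip_pm n x (?f v) = fscale (sg x) (act \<sigma> (strip_pm n x v))" for x v
      using strip_pm_act[OF \<sigma>] by (cases x) (simp add: sg_def)
    \<comment> \<open>The dimension count does not see the signs: it is \<open>dim_hw_eq\<close>
      applied twice.\<close>
    have "cfun.dim (dec_hw (Suc n) \<alpha> i) = (\<Sum>j<L. cfun.dim (dec2_hw n \<alpha> (i, j)))" for i
    proof (cases "corner \<alpha> i")
      case True
      then have "cfun.dim (hw (Suc n) (dec \<alpha> i)) = (\<Sum>j<L. cfun.dim (dec_hw n (dec \<alpha> i) j))"
        by (intro dim_hw_eq shape_dec[OF sh] is_part_dec[OF pt])
      then show ?thesis using True by (simp add: dec_hw_def dec2_hw_def)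
    next
      case False
      then show ?thesis by (simp add: dec_hw_def dec2_hw_def cfun.dim_zero_space)
    qed
    then show "(\<Sum>x\<in>?I. cfun.dim (dec2_hw n \<alpha> x)) \<le> cfun.dim ?V"
      using dim_hw_eq[OF sh pt] by (simp add: sum.cartesian_product)
    show "cfun.fin_subspace (dec2_hw n \<alpha> x)" for x
      using fin2 by (cases x) (simp add: dec2_hw_def cfun.fin_subspace_zero)
  qed (use fin_subspace_hw_shape[OF sh] strip_pm_hom act_hom hom act_hw_image[OF per] in auto)
  also have "\<dots> = (\<Sum>(i, j)\<in>?I. if corner \<alpha> i \<and> corner (dec \<alpha> i) j
        then (if i \<le> j then 1 else - 1) * chi n (dec (dec \<alpha> i) j) \<sigma> else 0)"
  proof (rule sum.cong)
    fix x assume "x \<in> ?I"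
    obtain i j where ij: "x = (i, j)" by (cases x)
    show "cfun.trace_on (dec2_hw n \<alpha> x) (\<lambda>v. fscale (sg x) (act \<sigma> v))
      = (case x of (i, j) \<Rightarrow> if corner \<alpha> i \<and> corner (dec \<alpha> i) j
        then (if i \<le> j then 1 else - 1) * chi n (dec (dec \<alpha> i) j) \<sigma> else 0)"
      unfolding ij
      using cfun.trace_on_scale[OF fin2 act_hom act_hw_image[OF \<sigma>], of i j "sg (i, j)"]
      by (auto simp: dec2_hw_def chi_def sg_def)
  qed simp
  finally show ?thesis unfolding chi_def sum.cartesian_product .
qed

text \<open>
  These are sums over the standard tableaux of shape \<open>\<alpha>\<close>, built by removing the largest entry
  (in row \<open>i\<close>) and then the next one (in row \<open>j\<close>), so that \<open>j < i\<close> marks a descent.  They are meaningful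
  only if the size argument matches \<open>\<alpha>\<close>.
\<close>

primrec fdim :: "nat \<Rightarrow> nat \<Rightarrow> (nat \<Rightarrow> nat) \<Rightarrow> real" where
  "fdim L 0 \<alpha> = 1"
| "fdim L (Suc n) \<alpha> = (\<Sum>i<L. if corner \<alpha> i then fdim L n (dec \<alpha> i) else 0)"

primrec xsum :: "nat \<Rightarrow> real \<Rightarrow> nat \<Rightarrow> (nat \<Rightarrow> nat) \<Rightarrow> real" where
  "xsum L q 0 \<alpha> = 1"
| "xsum L q (Suc m) \<alpha> = (\<Sum>i<L. \<Sum>j<L. if corner \<alpha> i \<and> corner (dec \<alpha> i) j
     then (if i \<le> j then 1 else q) * xsum L q m (dec (dec \<alpha> i) j) else 0)"

definition ndes :: "nat \<Rightarrow> nat \<Rightarrow> (nat \<Rightarrow> nat) \<Rightarrow> real" where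
  "ndes L n \<alpha> = (\<Sum>i<L. \<Sum>j<L. if corner \<alpha> i \<and> corner (dec \<alpha> i) j \<and> j < i
     then fdim L n (dec (dec \<alpha> i) j) else 0)"

lemma act_id: "act id = (\<lambda>v. v)"
  by (simp add: act_def fun_eq_iff)

lemma chi_zero:
  assumes "shape L 0 \<alpha>"
  shows "chi 0 \<alpha> id = 1"
proof -
  have \<alpha>: "\<alpha> i = 0" for i using assms by (cases "i < L") (auto simp: shape_def)
  define u :: "nat \<Rightarrow> nat" where "u = (\<lambda>_. undefined)"
  define e :: "(nat \<Rightarrow> nat) \<Rightarrow> complex" where "e = (\<lambda>r. if r = u then 1 else 0)"
  have tab: "tabloids 0 \<alpha> = {u}" by (auto simp: tabloids_def u_def \<alpha> extensional_def fun_eq_iff)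
  have "hw 0 \<alpha> = cfun.span {e}"
  proof (intro subset_antisym subsetI)
    fix v assume v: "v \<in> hw 0 \<alpha>"
    then have "v r = 0" if "r \<noteq> u" for r using that tab by (auto simp: hw_def weight_space_def)
    then have "v r = fscale (v u) e r" for r by (cases "r = u") (simp_all add: fscale_def e_def)
    then have "v = fscale (v u) e" by (rule ext)
    then show "v \<in> cfun.span {e}" by (metis cfun.span_base cfun.span_scale singletonI)
  next
    have "e \<in> hw 0 \<alpha>" by (auto simp: hw_def weight_space_def tab e_def raise_def fun_eq_iff)
    then show "v \<in> hw 0 \<alpha>" if "v \<in> cfun.span {e}" for v
      using cfun.span_minimal[OF _ hw_subspace, of "{e}"] that by blast
  qed
  moreover have "e \<noteq> 0" by (auto simp: e_def fun_eq_iff)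
  then have "cfun.independent {e}" by simp
  ultimately have "cfun.dim (hw 0 \<alpha>) = 1" using cfun.dim_span_eq_card_independent[of "{e}"] by simp
  then show ?thesis
    unfolding chi_def act_id using cfun.trace_on_id[OF fin_subspace_hw_shape[OF assms, of 0]] by simp
qed

lemma chi_id:
  assumes "shape L n \<alpha>" "is_part \<alpha>"
  shows "chi n \<alpha> id = of_real (fdim L n \<alpha>)"
  using assms
proof (induction n arbitrary: \<alpha>)
  case 0
  then show ?case using chi_zero[of L \<alpha>] by (simp only: fdim.simps of_real_1)
next
  case (Suc n)
  have "chi (Suc n) \<alpha> id = (\<Sum>k<L. if corner \<alpha> k then chi n (dec \<alpha> k) id else 0)"
    by (rule chi_branch[OF permutes_id Suc.prems])
  also have "\<dots> = (\<Sum>k<L. if corner \<alpha> k then of_real (fdim L n (dec \<alpha> k)) else 0)"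
    by (intro sum.cong refl if_cong Suc.IH shape_dec[OF Suc.prems(1)] is_part_dec[OF Suc.prems(2)])
  also have "\<dots> = of_real (fdim L (Suc n) \<alpha>)" by (auto simp: of_real_sum intro!: sum.cong)
  finally show ?case .
qed

lemma fdim_Suc_Suc:
  "fdim L (Suc (Suc n)) \<alpha> = (\<Sum>i<L. \<Sum>j<L. if corner \<alpha> i \<and> corner (dec \<alpha> i) j
     then fdim L n (dec (dec \<alpha> i) j) else 0)"
  by (auto intro!: sum.cong)

text \<open>Tableaux with a last-step descent contribute -1, all others 1.\<close>

lemma chi_transpose_last:
  assumes sh: "shape L (Suc (Suc n)) \<alpha>" and pt: "is_part \<alpha>"
  shows "chi (Suc (Suc n)) \<alpha> (transpose n (Suc n)) = of_real (fdim L (Suc (Suc n)) \<alpha> - 2 * ndes L n \<alpha>)"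
proof -
  have "chi (Suc (Suc n)) \<alpha> (transpose n (Suc n)) = (\<Sum>i<L. \<Sum>j<L. if corner \<alpha> i \<and> corner (dec \<alpha> i) j
        then (if i \<le> j then 1 else - 1) * chi n (dec (dec \<alpha> i) j) id else 0)"
    using chi_branch_transpose[OF permutes_id sh pt] by simp
  also have "\<dots> = (\<Sum>i<L. \<Sum>j<L. complex_of_real ((if corner \<alpha> i \<and> corner (dec \<alpha> i) j
        then fdim L n (dec (dec \<alpha> i) j) else 0) - 2 * (if corner \<alpha> i \<and> corner (dec \<alpha> i) j \<and> j < i
        then fdim L n (dec (dec \<alpha> i) j) else 0)))"
  proof (intro sum.cong refl)
    fix i j
    show "(if corner \<alpha> i \<and> corner (dec \<alpha> i) j
        then (if i \<le> j then 1 else - 1) * chi n (dec (dec \<alpha> i) j) id else 0)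
      = complex_of_real ((if corner \<alpha> i \<and> corner (dec \<alpha> i) j
        then fdim L n (dec (dec \<alpha> i) j) else 0) - 2 * (if corner \<alpha> i \<and> corner (dec \<alpha> i) j \<and> j < i
        then fdim L n (dec (dec \<alpha> i) j) else 0))"
    proof (cases "corner \<alpha> i \<and> corner (dec \<alpha> i) j")
      case True
      then have "chi n (dec (dec \<alpha> i) j) id = of_real (fdim L n (dec (dec \<alpha> i) j))"
        by (intro chi_id shape_dec is_part_dec sh pt) auto
      then show ?thesis using True by auto
    qed auto
  qed
  also have "\<dots> = of_real (fdim L (Suc (Suc n)) \<alpha> - 2 * ndes L n \<alpha>)"
    unfolding fdim_Suc_Suc ndes_def by (simp only: of_real_sum[symmetric] sum_subtractf sum_distrib_left)
  finally show ?thesis .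
qed

lemma chi_transpose_first:
  assumes sh: "shape L (Suc (Suc n)) \<alpha>" and pt: "is_part \<alpha>"
  shows "chi (Suc (Suc n)) \<alpha> (transpose 0 1) = of_real (fdim L (Suc (Suc n)) \<alpha> - 2 * ndes L n \<alpha>)"
proof -
  let ?\<pi> = "transpose 0 n \<circ> transpose 1 (Suc n)"
  have \<pi>: "?\<pi> permutes {..<Suc (Suc n)}" by (intro permutes_compose permutes_swap_id) auto
  have "?\<pi> 0 = n" "?\<pi> 1 = Suc n" by (cases n) (auto simp: transpose_def)
  then have "inv ?\<pi> n = 0" "inv ?\<pi> (Suc n) = 1"
    using permutes_inverses(2)[OF \<pi>] by metis+
  then have "?\<pi> \<circ> transpose 0 1 = transpose n (Suc n) \<circ> ?\<pi>"
    using transpose_comp_eq[OF permutes_bij[OF \<pi>], of n "Suc n"] by simp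
  then have "chi (Suc (Suc n)) \<alpha> (transpose 0 1) = chi (Suc (Suc n)) \<alpha> (transpose n (Suc n))"
    by (intro chi_conj[OF sh _ \<pi>] permutes_swap_id) auto
  then show ?thesis using chi_transpose_last[OF sh pt] by simp
qed

text \<open>The definition looks at the last two entries, so removing the last one destroys it. But
  the count is determined by the character at \<open>transpose 0 1\<close>, to which
  \<open>chi_branch\<close> applies.\<close>

lemma ndes_rec:
  assumes sh: "shape L (Suc (Suc (Suc n))) \<alpha>" and pt: "is_part \<alpha>"
  shows "ndes L (Suc n) \<alpha> = (\<Sum>i<L. if corner \<alpha> i then ndes L n (dec \<alpha> i) else 0)"
proof -
  have "complex_of_real (fdim L (Suc (Suc (Suc n))) \<alpha> - 2 * ndes L (Suc n) \<alpha>)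
      = chi (Suc (Suc (Suc n))) \<alpha> (transpose 0 1)"
    using chi_transpose_first[OF sh pt] by simp
  also have "\<dots> = (\<Sum>k<L. if corner \<alpha> k then chi (Suc (Suc n)) (dec \<alpha> k) (transpose 0 1) else 0)"
    by (rule chi_branch[OF _ sh pt]) (auto intro: permutes_swap_id)
  also have "\<dots> = (\<Sum>k<L. complex_of_real ((if corner \<alpha> k then fdim L (Suc (Suc n)) (dec \<alpha> k) else 0)
      - 2 * (if corner \<alpha> k then ndes L n (dec \<alpha> k) else 0)))"
  proof (intro sum.cong refl)
    fix k
    show "(if corner \<alpha> k then chi (Suc (Suc n)) (dec \<alpha> k) (transpose 0 1) else 0)
      = complex_of_real ((if corner \<alpha> k then fdim L (Suc (Suc n)) (dec \<alpha> k) else 0)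
      - 2 * (if corner \<alpha> k then ndes L n (dec \<alpha> k) else 0))"
    proof (cases "corner \<alpha> k")
      case True
      then show ?thesis
        by (simp only: chi_transpose_first[OF shape_dec[OF sh True] is_part_dec[OF pt True]] if_True)
    qed simp
  qed
  also have "\<dots> = complex_of_real (fdim L (Suc (Suc (Suc n))) \<alpha>
      - 2 * (\<Sum>k<L. if corner \<alpha> k then ndes L n (dec \<alpha> k) else 0))"
    unfolding fdim.simps(2)[of L "Suc (Suc n)" \<alpha>]
    by (simp only: of_real_sum[symmetric] sum_subtractf sum_distrib_left)
  finally have "fdim L (Suc (Suc (Suc n))) \<alpha> - 2 * ndes L (Suc n) \<alpha>
     = fdim L (Suc (Suc (Suc n))) \<alpha> - 2 * (\<Sum>k<L. if corner \<alpha> k then ndes L n (dec \<alpha> k) else 0)"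
    using of_real_eq_iff by blast
  then show ?thesis by linarith
qed

section \<open>Characters at involutions and their binomial average\<close>

lemma involution_Suc: "involution (Suc s) = involution s \<circ> transpose (2 * s) (Suc (2 * s))"
  by (auto simp: fun_eq_iff involution_def transpose_def less_Suc_eq)

text \<open>Moves the last two-cycle to the last two entries, so that
  \<open>chi_branch_transpose\<close> applies; the conjugating permutation fixes all points moved by
  \<open>involution s\<close>.\<close>

lemma chi_involution_Suc:
  assumes sh: "shape L (Suc (Suc (2 * m))) \<alpha>" and s: "s \<le> m"
  shows "chi (Suc (Suc (2 * m))) \<alpha> (involution (Suc s))
    = chi (Suc (Suc (2 * m))) \<alpha> (involution s \<circ> transpose (2 * m) (Suc (2 * m)))"
proof -
  let ?\<pi> = "transpose (2 * s) (2 * m) \<circ> transpose (Suc (2 * s)) (Suc (2 * m))"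
  have \<pi>: "?\<pi> permutes {..<Suc (Suc (2 * m))}"
    using s by (intro permutes_compose permutes_swap_id) auto
  have par: "2 * a \<noteq> Suc (2 * b)" "Suc (2 * b) \<noteq> 2 * a" for a b :: nat by presburger+
  have "?\<pi> (2 * s) = 2 * m" "?\<pi> (Suc (2 * s)) = Suc (2 * m)"
    by (auto simp: transpose_def par)
  then have "inv ?\<pi> (2 * m) = 2 * s" "inv ?\<pi> (Suc (2 * m)) = Suc (2 * s)"
    using permutes_inverses(2)[OF \<pi>] by metis+
  then have 1: "transpose (2 * m) (Suc (2 * m)) \<circ> ?\<pi> = ?\<pi> \<circ> transpose (2 * s) (Suc (2 * s))"
    using transpose_comp_eq[OF permutes_bij[OF \<pi>], of "2 * m" "Suc (2 * m)"] by simp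
  have "?\<pi> (involution s x) = involution s (?\<pi> x)" for x
  proof (cases "x < 2 * s")
    case True
    then have "involution s x < 2 * s" by (auto simp: involution_def)
    then show ?thesis using True s by (auto simp: transpose_def)
  next
    case False
    then have "\<not> ?\<pi> x < 2 * s" using s by (auto simp: transpose_def)
    then show ?thesis using False by (simp add: involution_def)
  qed
  then have 2: "?\<pi> \<circ> involution s = involution s \<circ> ?\<pi>" by (simp add: fun_eq_iff)
  show ?thesis
  proof (rule chi_conj[OF sh involution_permutes \<pi>])
    have "?\<pi> \<circ> involution (Suc s) = (?\<pi> \<circ> involution s) \<circ> transpose (2 * s) (Suc (2 * s))"
      by (simp add: involution_Suc comp_assoc)
    also have "\<dots> = involution s \<circ> (?\<pi> \<circ> transpose (2 * s) (Suc (2 * s)))"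
      unfolding 2 by (simp only: comp_assoc)
    also have "\<dots> = involution s \<circ> transpose (2 * m) (Suc (2 * m)) \<circ> ?\<pi>"
      unfolding 1[symmetric] by (simp only: comp_assoc)
    finally show "?\<pi> \<circ> involution (Suc s) = involution s \<circ> transpose (2 * m) (Suc (2 * m)) \<circ> ?\<pi>" .
  qed (use s in simp)
qed

text \<open>Pascal's rule: one factor p + (1 - p) T is split off from the binomial expansion, where
  T shifts the sequence \<open>c\<close>.\<close>

lemma binomial_sum_Suc:
  fixes c :: "nat \<Rightarrow> complex"
  shows "(\<Sum>s\<le>Suc m. of_real (p ^ (Suc m - s) * (1 - p) ^ s * real (Suc m choose s)) * c s)
    = (\<Sum>s\<le>m. of_real (p ^ (m - s) * (1 - p) ^ s * real (m choose s)) * (of_real p * c s + of_real (1 - p) * c (Suc s)))"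
proof -
  let ?w = "\<lambda>s. complex_of_real (p ^ (m - s) * (1 - p) ^ s * real (m choose s))"
  define f where "f s = complex_of_real (p ^ (Suc m - s) * (1 - p) ^ s * real (m choose s)) * c s" for s
  define A where "A = (\<Sum>s\<le>m. of_real (p ^ (Suc m - s) * (1 - p) ^ s * real (m choose s)) * c s)"
  define B where "B = (\<Sum>s\<le>m. ?w s * of_real (1 - p) * c (Suc s))"
  have "(\<Sum>s\<le>Suc m. of_real (p ^ (Suc m - s) * (1 - p) ^ s * real (Suc m choose s)) * c s)
      = of_real (p ^ Suc m) * c 0
        + (\<Sum>s\<le>m. of_real (p ^ (m - s) * (1 - p) ^ Suc s * real (Suc m choose Suc s)) * c (Suc s))"
    by (subst sum.atMost_Suc_shift) simp
  also have "(\<Sum>s\<le>m. of_real (p ^ (m - s) * (1 - p) ^ Suc s * real (Suc m choose Suc s)) * c (Suc s))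
      = B + (\<Sum>s\<le>m. of_real (p ^ (m - s) * (1 - p) ^ Suc s * real (m choose Suc s)) * c (Suc s))"
    unfolding B_def sum.distrib[symmetric] by (intro sum.cong refl) (simp add: algebra_simps)
  also have "of_real (p ^ Suc m) * c 0 + (B + (\<Sum>s\<le>m. of_real (p ^ (m - s) * (1 - p) ^ Suc s * real (m choose Suc s)) * c (Suc s)))
      = B + (\<Sum>s\<le>Suc m. of_real (p ^ (Suc m - s) * (1 - p) ^ s * real (m choose s)) * c s)"
    using sum.atMost_Suc_shift[of f m] by (simp add: f_def)
  also have "(\<Sum>s\<le>Suc m. of_real (p ^ (Suc m - s) * (1 - p) ^ s * real (m choose s)) * c s) = A"
    by (simp add: A_def)
  also have "A = (\<Sum>s\<le>m. ?w s * of_real p * c s)"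
    unfolding A_def by (intro sum.cong refl) (simp add: Suc_diff_le)
  finally show ?thesis
    unfolding B_def by (simp add: sum.distrib[symmetric] algebra_simps)
qed

lemma chi_binomial_sum:
  assumes "shape L (2 * m) \<alpha>" "is_part \<alpha>"
  shows "(\<Sum>s\<le>m. of_real (p ^ (m - s) * (1 - p) ^ s * real (m choose s)) * chi (2 * m) \<alpha> (involution s))
    = of_real (xsum L (2 * p - 1) m \<alpha>)"
  using assms
proof (induction m arbitrary: \<alpha>)
  case 0
  have "involution 0 = id" by (auto simp: involution_def)
  then have "chi (2 * 0) \<alpha> (involution 0) = 1" using chi_zero[of L \<alpha>] 0 by (simp only: mult_0_right)
  then show ?case by simp
next
  case (Suc m)
  let ?w = "\<lambda>s. complex_of_real (p ^ (m - s) * (1 - p) ^ s * real (m choose s))"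
  let ?ok = "\<lambda>i j. corner \<alpha> i \<and> corner (dec \<alpha> i) j" and ?b = "\<lambda>i j. dec (dec \<alpha> i) j"
  have sh: "shape L (Suc (Suc (2 * m))) \<alpha>" using Suc.prems by simp
  note pt = Suc.prems(2)
  \<comment> \<open>The two-cycle acts by 1 or -1, so the average is p + (1 - p) = 1 or p - (1 - p)
    = 2 p - 1.\<close>
  have step: "of_real p * chi (Suc (Suc (2 * m))) \<alpha> (involution s) + of_real (1 - p) * chi (Suc (Suc (2 * m))) \<alpha> (involution (Suc s))
     = (\<Sum>i<L. \<Sum>j<L. if ?ok i j then of_real (if i \<le> j then 1 else 2 * p - 1) * chi (2 * m) (?b i j) (involution s) else 0)"
    if s: "s \<le> m" for s
  proof -
    have per: "involution s permutes {..<2 * m}" using s by (intro involution_permutes) simp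
    have "chi (Suc (Suc (2 * m))) \<alpha> (involution s)
       = (\<Sum>i<L. if corner \<alpha> i then chi (Suc (2 * m)) (dec \<alpha> i) (involution s) else 0)"
      by (rule chi_branch[OF permutes_lessThan_Suc[OF per] sh pt])
    also have "\<dots> = (\<Sum>i<L. \<Sum>j<L. if ?ok i j then chi (2 * m) (?b i j) (involution s) else 0)"
    proof (intro sum.cong refl)
      fix i
      show "(if corner \<alpha> i then chi (Suc (2 * m)) (dec \<alpha> i) (involution s) else 0)
          = (\<Sum>j<L. if ?ok i j then chi (2 * m) (?b i j) (involution s) else 0)"
        using chi_branch[OF per shape_dec[OF sh] is_part_dec[OF pt]] by auto
    qed
    finally have a: "chi (Suc (Suc (2 * m))) \<alpha> (involution s)
       = (\<Sum>i<L. \<Sum>j<L. if ?ok i j then chi (2 * m) (?b i j) (involution s) else 0)" .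
    have b: "chi (Suc (Suc (2 * m))) \<alpha> (involution (Suc s)) = (\<Sum>i<L. \<Sum>j<L. if ?ok i j
        then (if i \<le> j then 1 else - 1) * chi (2 * m) (?b i j) (involution s) else 0)"
      unfolding chi_involution_Suc[OF sh s] by (rule chi_branch_transpose[OF per sh pt])
    show ?thesis
      unfolding a b sum_distrib_left sum.distrib[symmetric]
      by (intro sum.cong refl) (auto simp: algebra_simps)
  qed
  have IH: "(\<Sum>s\<le>m. ?w s * chi (2 * m) (?b i j) (involution s)) = of_real (xsum L (2 * p - 1) m (?b i j))"
    if "?ok i j" for i j
    using Suc.IH[of "?b i j"] shape_dec[OF shape_dec[OF sh]] is_part_dec[OF is_part_dec[OF pt]] that by simp
  have "(\<Sum>s\<le>Suc m. of_real (p ^ (Suc m - s) * (1 - p) ^ s * real (Suc m choose s)) * chi (2 * Suc m) \<alpha> (involution s))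
    = (\<Sum>s\<le>m. ?w s * (\<Sum>i<L. \<Sum>j<L. if ?ok i j then of_real (if i \<le> j then 1 else 2 * p - 1) * chi (2 * m) (?b i j) (involution s) else 0))"
    unfolding binomial_sum_Suc using step by (intro sum.cong refl) simp
  also have "\<dots> = (\<Sum>s\<le>m. \<Sum>i<L. \<Sum>j<L. ?w s * (if ?ok i j then of_real (if i \<le> j then 1 else 2 * p - 1) * chi (2 * m) (?b i j) (involution s) else 0))"
    by (simp only: sum_distrib_left)
  also have "\<dots> = (\<Sum>i<L. \<Sum>j<L. \<Sum>s\<le>m. ?w s * (if ?ok i j then of_real (if i \<le> j then 1 else 2 * p - 1) * chi (2 * m) (?b i j) (involution s) else 0))"
    by (subst sum.swap) (intro sum.cong refl sum.swap)
  also have "\<dots> = (\<Sum>i<L. \<Sum>j<L. of_real (if ?ok i j then (if i \<le> j then 1 else 2 * p - 1) * xsum L (2 * p - 1) m (?b i j) else 0))"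
  proof (intro sum.cong refl)
    fix i j
    show "(\<Sum>s\<le>m. ?w s * (if ?ok i j then of_real (if i \<le> j then 1 else 2 * p - 1) * chi (2 * m) (?b i j) (involution s) else 0))
      = complex_of_real (if ?ok i j then (if i \<le> j then 1 else 2 * p - 1) * xsum L (2 * p - 1) m (?b i j) else 0)"
    proof (cases "?ok i j")
      case True
      have "(\<Sum>s\<le>m. ?w s * (complex_of_real (if i \<le> j then 1 else 2 * p - 1) * chi (2 * m) (?b i j) (involution s)))
          = complex_of_real (if i \<le> j then 1 else 2 * p - 1) * (\<Sum>s\<le>m. ?w s * chi (2 * m) (?b i j) (involution s))"
        unfolding sum_distrib_left by (intro sum.cong refl) (simp only: mult.left_commute)
      then show ?thesis using IH[OF True] True by (simp only: if_True conj_absorb of_real_mult simp_thms)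
    qed auto
  qed
  also have "\<dots> = of_real (xsum L (2 * p - 1) (Suc m) \<alpha>)" by (simp only: xsum.simps of_real_sum)
  finally show ?case .
qed

definition part_fun :: "nat list \<Rightarrow> nat \<Rightarrow> nat" where
  "part_fun lam i = (if i < length lam then lam ! i else 0)"

lemma cells_diagram: "cells lam = diagram (part_fun lam)"
  by (auto simp: cells_def diagram_def part_fun_def split: if_splits)

lemma specht_eq: "specht n lam = specht_fun n (part_fun lam)"
  by (simp add: specht_def specht_fun_def tableaux_def cells_diagram)

lemma part_fun_shape:
  assumes "partition_of n lam" "length lam \<le> L"
  shows "shape L n (part_fun lam)" "is_part (part_fun lam)"
proof -
  have "(\<Sum>i<L. part_fun lam i) = (\<Sum>i<length lam. part_fun lam i)"
    by (rule sum.mono_neutral_right) (use assms(2) in \<open>auto simp: part_fun_def\<close>)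
  also have "\<dots> = sum_list lam" by (simp add: part_fun_def sum_list_sum_nth atLeast0LessThan)
  finally show "shape L n (part_fun lam)" using assms by (auto simp: shape_def part_fun_def partition_of_def)
  show "is_part (part_fun lam)"
    using assms(1) sorted_wrt_nth_less[of "(\<ge>)" lam] by (auto simp: is_part_def part_fun_def partition_of_def)
qed

lemma psi_eq:
  assumes "partition_of (2 * m) lam" "length lam \<le> L"
  shows "psi (2 * m) p lam = of_real (xsum L (2 * p - 1) m (part_fun lam) / fdim L (2 * m) (part_fun lam))"
proof -
  let ?\<alpha> = "part_fun lam"
  note sp = part_fun_shape[OF assms]
  have ch: "irr_char (2 * m) lam \<sigma> = chi (2 * m) ?\<alpha> \<sigma>" for \<sigma>
    by (simp add: irr_char_def chi_def specht_eq specht_fun_eq_hw[OF sp])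
  have d: "irr_dim (2 * m) lam = of_real (fdim L (2 * m) ?\<alpha>)"
    unfolding irr_dim_def ch by (rule chi_id[OF sp])
  have "psi (2 * m) p lam = (\<Sum>s\<le>m. of_real (p ^ (m - s) * (1 - p) ^ s * real (m choose s)) * chi (2 * m) ?\<alpha> (involution s))
      / of_real (fdim L (2 * m) ?\<alpha>)"
    unfolding psi_def ch d sum_divide_distrib by (simp add: atLeast0AtMost)
  then show ?thesis unfolding chi_binomial_sum[OF sp] by simp
qed

section \<open>Generalised trinomial coefficients\<close>

text \<open>The coefficient of x^j in (x + s + 1/x)^m.\<close>

primrec tri :: "real \<Rightarrow> nat \<Rightarrow> int \<Rightarrow> real" where
  "tri s 0 j = (if j = 0 then 1 else 0)"
| "tri s (Suc m) j = tri s m (j - 1) + s * tri s m j + tri s m (j + 1)"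

lemma tri_nonneg: "0 \<le> s \<Longrightarrow> 0 \<le> tri s m j"
  by (induction m arbitrary: j) auto

lemma tri_outside: "int m < \<bar>j\<bar> \<Longrightarrow> tri s m j = 0"
  by (induction m arbitrary: j) auto

lemma tri_minus: "tri s m (- j) = tri s m j"
proof (induction m arbitrary: j)
  case (Suc m)
  have "tri s m (- j - 1) = tri s m (j + 1)" using Suc[of "j + 1"] by simp
  moreover have "tri s m (- j + 1) = tri s m (j - 1)" using Suc[of "j - 1"] by simp
  ultimately show ?case using Suc[of j] by simp
qed simp

text \<open>Compares coefficients in (x + s + 1/x) x f' = m (x - 1/x) f for f = (x + s +
  1/x)^m.\<close>

lemma tri_rec:
  "(real m + 1 + of_int j) * tri s m (j + 1) + s * of_int j * tri s m j = (real m + 1 - of_int j) * tri s m (j - 1)"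
proof (induction m arbitrary: j)
  case 0
  then show ?case by (auto simp: algebra_simps)
next
  case (Suc m)
  note a = Suc[of "j - 1"] and b = Suc[of j] and c = Suc[of "j + 1"]
  have i: "j - 1 + 1 = j" "j + 1 - 1 = j" "j - 1 - 1 = j - 2" "j + 1 + 1 = j + 2" by auto
  define x1 x2 x3 x4 x5 J where x: "x1 = tri s m (j - 2)" "x2 = tri s m (j - 1)" "x3 = tri s m j"
    "x4 = tri s m (j + 1)" "x5 = tri s m (j + 2)" "J = (of_int j :: real)"
  have a': "(real m + J) * x3 + s * (J - 1) * x2 = (real m + 2 - J) * x1"
    using a unfolding i by (simp add: x algebra_simps)
  have b': "(real m + 1 + J) * x4 + s * J * x3 = (real m + 1 - J) * x2"
    using b by (simp add: x)
  have c': "(real m + 2 + J) * x5 + s * (J + 1) * x4 = (real m - J) * x3"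
    using c unfolding i by (simp add: x algebra_simps)
  \<comment> \<open>The identity at level m + 1 is the sum of those at j - 1, j, j + 1 with weights
    1, s, 1.\<close>
  have "(real m + 2 + J) * (x3 + s * x4 + x5) + s * J * (x2 + s * x3 + x4)
      - (real m + 2 - J) * (x1 + s * x2 + x3)
      = ((real m + J) * x3 + s * (J - 1) * x2 - (real m + 2 - J) * x1)
        + s * ((real m + 1 + J) * x4 + s * J * x3 - (real m + 1 - J) * x2)
        + ((real m + 2 + J) * x5 + s * (J + 1) * x4 - (real m - J) * x3)"
    by (simp add: algebra_simps)
  then have "(real m + 2 + J) * (x3 + s * x4 + x5) + s * J * (x2 + s * x3 + x4)
      = (real m + 2 - J) * (x1 + s * x2 + x3)" using a' b' c' by simp
  then show ?case unfolding tri.simps i by (simp add: x add.commute add.left_commute)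
qed

text \<open>\<open>tri_rec\<close> eliminates the outer neighbours j - 1 and j + 2, so a consecutive
  pair at level m + 1 depends only on the same pair at level m.\<close>

lemma tri_step:
  "(real m + 1 - of_int j) * tri s (Suc m) j = (real m + 1) * (2 * tri s m (j + 1) + s * tri s m j)"
  "(real m + 2 + of_int j) * tri s (Suc m) (j + 1) = (real m + 1) * (2 * tri s m j + s * tri s m (j + 1))"
proof -
  have "(real m + 1 - of_int j) * tri s (Suc m) j
      = (real m + 1 - of_int j) * tri s m (j - 1) + (real m + 1 - of_int j) * (s * tri s m j + tri s m (j + 1))"
    by (simp add: algebra_simps)
  then show "(real m + 1 - of_int j) * tri s (Suc m) j = (real m + 1) * (2 * tri s m (j + 1) + s * tri s m j)"
    unfolding tri_rec[symmetric] by (simp add: algebra_simps)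
  have r: "(real m + 2 + of_int j) * tri s m (j + 2) = (real m - of_int j) * tri s m j - s * (of_int j + 1) * tri s m (j + 1)"
    using tri_rec[of m "j + 1" s] by (simp add: algebra_simps)
  have "(real m + 2 + of_int j) * tri s (Suc m) (j + 1)
      = (real m + 2 + of_int j) * tri s m (j + 2) + (real m + 2 + of_int j) * (tri s m j + s * tri s m (j + 1))"
    by (simp add: algebra_simps)
  then show "(real m + 2 + of_int j) * tri s (Suc m) (j + 1) = (real m + 1) * (2 * tri s m j + s * tri s m (j + 1))"
    unfolding r by (simp add: algebra_simps)
qed

text \<open>
  Both bounds are equalities for \<open>s = 2\<close>.  The recursion in \<open>m\<close> acts on the ratio of consecutive
  entries by a decreasing Moebius map, so upper and lower bounds alternate.
\<close>

definition tri_lower :: "real \<Rightarrow> nat \<Rightarrow> int \<Rightarrow> bool" where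
  "tri_lower s m j \<longleftrightarrow>
     4 * (real m - of_int j) * tri s m j \<le> (4 * real m + 2 + s * (2 * of_int j + 1)) * tri s m (j + 1)"

definition tri_upper :: "real \<Rightarrow> nat \<Rightarrow> int \<Rightarrow> bool" where
  "tri_upper s m j \<longleftrightarrow>
     (4 * (real m + 2 + of_int j) + s * (2 * of_int j + 1)) * tri s m (j + 1) \<le> (4 * real m + 6) * tri s m j"

lemma tri_lower_trivial:
  assumes "0 \<le> s" "int m \<le> j"
  shows "tri_lower s m j"
proof (cases "j = int m")
  case True
  then show ?thesis using tri_nonneg[OF assms(1), of m] assms by (auto simp: tri_lower_def)
next
  case False
  then show ?thesis using tri_outside[of m] assms(2) by (simp add: tri_lower_def)
qed

lemma tri_lower_step:
  assumes s: "1 \<le> s" "s \<le> 2" and j: "0 \<le> j" and U: "tri_upper s m j"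
  shows "tri_lower s (Suc m) j"
proof (cases "int (Suc m) \<le> j")
  case True
  then show ?thesis using tri_lower_trivial[of s "Suc m" j] s by simp
next
  case False
  define x y J M where d: "x = tri s m j" "y = tri s m (j + 1)" "J = real_of_int j" "M = real m + 1"
  have pos: "0 < M - J" "0 \<le> J" "0 < M" using False j by (auto simp: d)
  have 1: "(M - J) * tri s (Suc m) j = M * (2 * y + s * x)" using tri_step(1)[where m = m and j = j and s = s] by (simp add: d)
  have 2: "(M + 1 + J) * tri s (Suc m) (j + 1) = M * (2 * x + s * y)"
    using tri_step(2)[where m = m and j = j and s = s] by (simp add: d add.commute add.left_commute)
  have U': "(4 * (M + 1 + J) + s * (2 * J + 1)) * y \<le> (4 * M + 2) * x"
    using U by (simp add: tri_upper_def d algebra_simps)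
  \<comment> \<open>Up to positive factors, the slack at level m + 1 is 2 - s times the slack of the
    upper bound at level m.\<close>
  have "(4 * M + 2 + s * (2 * J + 1)) * (2 * x + s * y) - 4 * (M + 1 + J) * (2 * y + s * x)
      = (2 - s) * ((4 * M + 2) * x - (4 * (M + 1 + J) + s * (2 * J + 1)) * y)"
    by (simp add: algebra_simps power2_eq_square)
  also have "\<dots> \<ge> 0" using U' s by (intro mult_nonneg_nonneg) auto
  finally have "4 * (M + 1 + J) * (2 * y + s * x) \<le> (4 * M + 2 + s * (2 * J + 1)) * (2 * x + s * y)" by simp
  then have "M * (4 * (M + 1 + J) * (2 * y + s * x)) \<le> M * ((4 * M + 2 + s * (2 * J + 1)) * (2 * x + s * y))"
    using pos by (intro mult_left_mono) auto
  then have "4 * (M + 1 + J) * (M * (2 * y + s * x)) \<le> (4 * M + 2 + s * (2 * J + 1)) * (M * (2 * x + s * y))"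
    by (simp add: algebra_simps)
  then have "(M + 1 + J) * (4 * (M - J) * tri s (Suc m) j)
      \<le> (M + 1 + J) * ((4 * M + 2 + s * (2 * J + 1)) * tri s (Suc m) (j + 1))"
    unfolding 1[symmetric] 2[symmetric] by (simp add: algebra_simps)
  then have "4 * (M - J) * tri s (Suc m) j \<le> (4 * M + 2 + s * (2 * J + 1)) * tri s (Suc m) (j + 1)"
    using pos by (simp add: mult_le_cancel_left)
  then show ?thesis by (simp add: tri_lower_def d add.commute)
qed

lemma tri_upper_step:
  assumes s: "1 \<le> s" "s \<le> 2" and j: "0 \<le> j" and m: "1 \<le> m" and Lo: "tri_lower s m j"
  shows "tri_upper s (Suc m) j"
proof -
  define x y J M where d: "x = tri s m j" "y = tri s m (j + 1)" "J = real_of_int j" "M = real m + 1"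
  \<comment> \<open>Inserting \<open>tri_step\<close> into the claim and clearing denominators
    leaves x A \<le> y B.\<close>
  define A where "A = 2 * (M - J) * (4 * (M + 2 + J) + s * (2 * J + 1)) - s * (4 * M + 6) * (M + 1 + J)"
  define B where "B = 2 * (4 * M + 6) * (M + 1 + J) - s * (M - J) * (4 * (M + 2 + J) + s * (2 * J + 1))"
  have xy: "0 \<le> x" "0 \<le> y" using tri_nonneg s by (auto simp: d)
  have J: "0 \<le> J" and M: "2 \<le> M" using j m by (auto simp: d)
  show ?thesis
  proof (cases "int m < j")
    case True
    then have "tri s (Suc m) (j + 1) = 0" by (intro tri_outside) auto
    then show ?thesis using tri_nonneg[of s "Suc m" j] s by (simp add: tri_upper_def)
  next
    case False
    then have MJ: "1 \<le> M - J" by (simp add: d)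
    have key: "x * A \<le> y * B"
    proof (cases "j = int m")
      case True
      then have Mj: "M = J + 1" "J \<ge> 1" using m by (auto simp: d)
      \<comment> \<open>At j = m the entry \<open>y\<close> vanishes and the claim needs A \<le> 0,
        which uses J \<ge> 1.\<close>
      have y0: "y = 0" using True by (simp add: d tri_outside)
      have "A = 16 * J + 24 + s * (4 * J + 2) - s * ((4 * J + 10) * (2 * J + 2))"
        unfolding A_def Mj by (simp add: algebra_simps)
      also have "\<dots> = 16 * J + 24 - s * (8 * J * J + 24 * J + 18)" by (simp add: algebra_simps)
      also have "\<dots> \<le> 16 * J + 24 - 1 * (8 * J * J + 24 * J + 18)"
        using s J by (intro diff_left_mono mult_right_mono) auto
      also have "\<dots> \<le> 0"
      proof -
        have "0 \<le> J * J" using J by simp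
        then have "6 \<le> 8 * J + 8 * (J * J)" using Mj(2) by linarith
        then show ?thesis by (simp add: algebra_simps)
      qed
      finally have "x * A \<le> 0" using xy by (simp add: mult_nonneg_nonpos)
      then show ?thesis using y0 by simp
    next
      case False
      then have "j + 1 \<le> int m" using \<open>\<not> int m < j\<close> by simp
      then have "of_int (j + 1) \<le> real_of_int (int m)" by (simp only: of_int_le_iff)
      then have i0: "0 \<le> M - J - 2" by (simp add: d)
      \<comment> \<open>In the nonnegative quantities I, J, e the difference behind \<open>E\<close>
        has only nonnegative coefficients; \<open>B\<close> also uses the signs of 1 - e and 1 - e *
        e.\<close>
      define I e where Ie: "I = M - J - 2" "e = s - 1"
      have MI: "M = I + J + 2" and sI: "s = 1 + e" by (auto simp: Ie)
      have I: "0 \<le> I" and e: "0 \<le> e" "e \<le> 1" using i0 s by (auto simp: Ie)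
      have L': "4 * (I + 1) * x \<le> (4 * M - 2 + s * (2 * J + 1)) * y"
        using Lo by (simp add: tri_lower_def d Ie algebra_simps)
      have "4 * (I + 1) * B - A * (4 * M - 2 + s * (2 * J + 1)) = 18 + 96 * e + 30 * e^2 + (84 + 304 * e + 92 * e^2) * J
          + (120 + 256 * e + 72 * e^2) * J^2 + (48 + 64 * e + 16 * e^2) * J^3
          + (36 + 48 * e + 12 * e^2) * I + (96 + 128 * e + 32 * e^2) * (I * J) + (48 + 64 * e + 16 * e^2) * (I * J^2)"
        unfolding A_def B_def MI sI by (simp add: algebra_simps power2_eq_square power3_eq_cube)
      also have "\<dots> \<ge> 0" using I J e by (intro add_nonneg_nonneg mult_nonneg_nonneg) auto
      finally have E: "A * (4 * M - 2 + s * (2 * J + 1)) \<le> 4 * (I + 1) * B" by simp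
      have e2: "e * e \<le> e" using e mult_left_mono[of e 1 e] by simp
      have "B = (48 + 2 * (1 - e * e) + 36 * (1 - e) - 36) + (56 + 4 * (1 - e * e) + 24 * (1 - e) - 24) * J + 16 * J^2
          + ((1 - e * e) + 26 * (1 - e)) * I + (12 * (1 - e) + 2 * (1 - e * e)) * (I * J) + 4 * (1 - e) * I^2"
        unfolding B_def MI sI by (simp add: algebra_simps power2_eq_square power3_eq_cube)
      also have "\<dots> \<ge> 0" using I J e e2 by (intro add_nonneg_nonneg mult_nonneg_nonneg) auto
      finally have B: "0 \<le> B" .
      show ?thesis
      proof (cases "A \<le> 0")
        case True
        then show ?thesis using xy B by (meson mult_nonneg_nonneg mult_nonneg_nonpos order_trans)
      next
        case False
        have "4 * (I + 1) * (x * A) = A * (4 * (I + 1) * x)" by simp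
        also have "\<dots> \<le> A * ((4 * M - 2 + s * (2 * J + 1)) * y)" using L' False by (intro mult_left_mono) auto
        also have "\<dots> = (A * (4 * M - 2 + s * (2 * J + 1))) * y" by simp
        also have "\<dots> \<le> (4 * (I + 1) * B) * y" using E xy by (intro mult_right_mono) auto
        finally have "(4 * (I + 1)) * (x * A) \<le> (4 * (I + 1)) * (y * B)" by (simp add: algebra_simps)
        moreover have "0 < 4 * (I + 1)" using I by simp
        ultimately show ?thesis by (simp only: mult_le_cancel_left_pos)
      qed
    qed
    have 1: "(M - J) * tri s (Suc m) j = M * (2 * y + s * x)" using tri_step(1)[where m = m and j = j and s = s] by (simp add: d)
    have 2: "(M + 1 + J) * tri s (Suc m) (j + 1) = M * (2 * x + s * y)"
      using tri_step(2)[where m = m and j = j and s = s] by (simp add: d add.commute add.left_commute)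
    have "M * (x * A) \<le> M * (y * B)" using key M by (intro mult_left_mono) auto
    then have "(M - J) * (4 * (M + 2 + J) + s * (2 * J + 1)) * (M * (2 * x + s * y))
        \<le> (4 * M + 6) * (M + 1 + J) * (M * (2 * y + s * x))"
      unfolding A_def B_def by (simp add: algebra_simps)
    then have "((M - J) * (M + 1 + J)) * ((4 * (M + 2 + J) + s * (2 * J + 1)) * tri s (Suc m) (j + 1))
        \<le> ((M - J) * (M + 1 + J)) * ((4 * M + 6) * tri s (Suc m) j)"
      unfolding 1[symmetric] 2[symmetric] by (simp add: algebra_simps)
    moreover have "0 < (M - J) * (M + 1 + J)" using MJ J M by (intro mult_pos_pos) auto
    ultimately have "(4 * (M + 2 + J) + s * (2 * J + 1)) * tri s (Suc m) (j + 1) \<le> (4 * M + 6) * tri s (Suc m) j"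
      by (simp only: mult_le_cancel_left_pos)
    then show ?thesis by (simp add: tri_upper_def d algebra_simps)
  qed
qed

text \<open>The induction moves two levels at a time, so levels 3 and 4 both serve as a base. At
  level 2 and j = 0 the bound amounts to (3 s - 4) (s - 2) \<le> 0 and fails for s < 4/3.\<close>

lemma tri_lower_3:
  assumes s: "1 \<le> s" "s \<le> 2" and j: "0 \<le> j"
  shows "tri_lower s 3 j"
proof (cases "3 \<le> j")
  case True
  then show ?thesis using tri_lower_trivial[of s 3 j] s by simp
next
  case False
  then consider "j = 0" | "j = 1" | "j = 2" using j by linarith
  then show ?thesis
  proof cases
    case 1
    \<comment> \<open>The difference of the two sides of the bound; s = 2 is a root because of
      equality there.\<close>
    have "(s - 2) * (9 * s^2 - 24 * s + 21) \<le> 0"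
    proof (rule mult_nonpos_nonneg)
      have "9 * s^2 - 24 * s + 21 = (3 * s - 4)^2 + 5" by (simp add: power2_eq_square algebra_simps)
      then show "0 \<le> 9 * s^2 - 24 * s + 21" using zero_le_power2[of "3 * s - 4"] by linarith
    qed (use s in simp)
    then show ?thesis using 1 by (simp add: tri_lower_def eval_nat_numeral algebra_simps)
  next
    case 2
    have "(s - 2) * (5 * s - 4) \<le> 0" using s by (intro mult_nonpos_nonneg) auto
    then show ?thesis using 2 by (simp add: tri_lower_def eval_nat_numeral algebra_simps)
  next
    case 3
    then show ?thesis using s by (simp add: tri_lower_def eval_nat_numeral algebra_simps)
  qed
qed

lemma tri_lower_4:
  assumes s: "1 \<le> s" "s \<le> 2" and j: "0 \<le> j"
  shows "tri_lower s 4 j"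
proof (cases "4 \<le> j")
  case True
  then show ?thesis using tri_lower_trivial[of s 4 j] s by simp
next
  case False
  then consider "j = 0" | "j = 1" | "j = 2" | "j = 3" using j by linarith
  then show ?thesis
  proof cases
    case 1
    have "((s - 1) * (s - 2)) * (s^2 - 3 * s + 4) \<le> 0"
    proof (rule mult_nonpos_nonneg)
      have "s^2 - 3 * s + 4 = (s - 3/2)^2 + 7/4" by (simp add: power2_eq_square algebra_simps)
      then show "0 \<le> s^2 - 3 * s + 4" by simp
    qed (use s in \<open>simp add: mult_nonneg_nonpos\<close>)
    then show ?thesis using 1 by (simp add: tri_lower_def eval_nat_numeral algebra_simps)
  next
    case 2
    have "(s - 2) * (5 * s^2 - 8 * s + 6) \<le> 0"
    proof (rule mult_nonpos_nonneg)
      have "5 * s^2 - 8 * s + 6 = 5 * (s - 4/5)^2 + 14/5" by (simp add: power2_eq_square algebra_simps)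
      then show "0 \<le> 5 * s^2 - 8 * s + 6" by simp
    qed (use s in simp)
    then show ?thesis using 2 by (simp add: tri_lower_def eval_nat_numeral algebra_simps)
  next
    case 3
    have "(s - 2) * (7 * s - 4) \<le> 0" using s by (intro mult_nonpos_nonneg) auto
    then show ?thesis using 3 by (simp add: tri_lower_def eval_nat_numeral algebra_simps)
  next
    case 4
    then show ?thesis using s by (simp add: tri_lower_def eval_nat_numeral algebra_simps)
  qed
qed

lemma tri_lower:
  assumes s: "1 \<le> s" "s \<le> 2" and j: "0 \<le> j" and m: "3 \<le> m"
  shows "tri_lower s m j"
  using m
proof (induction m rule: less_induct)
  case (less m)
  have "m = 3 \<or> m = 4 \<or> (m = Suc (Suc (m - 2)) \<and> 3 \<le> m - 2)" using less.prems by linarith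
  then consider "m = 3" | "m = 4" | k where "m = Suc (Suc k)" "3 \<le> k" by blast
  then show ?case
  proof cases
    case 3
    then have "tri_upper s (Suc k) j" using less.IH[of k] tri_upper_step[OF s j, of k] by simp
    then show ?thesis using tri_lower_step[OF s j] 3 by simp
  qed (use tri_lower_3 tri_lower_4 s j in auto)
qed

section \<open>First-row removals and descents\<close>

lemma fdim_nonneg: "0 \<le> fdim L n \<alpha>"
  by (induction n arbitrary: \<alpha>) (auto intro!: sum_nonneg)

lemma corner_exists:
  assumes "shape L (Suc n) \<alpha>"
  shows "\<exists>i. corner \<alpha> i"
proof (rule ccontr)
  assume "\<nexists>i. corner \<alpha> i"
  then have "\<And>i. \<alpha> i \<le> \<alpha> (Suc i)" by (auto simp: corner_def not_less)
  then have "\<alpha> i \<le> \<alpha> (i + L)" for i using lift_Suc_mono_le[of \<alpha> i "i + L"] by simp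
  then have "\<alpha> i = 0" for i using assms by (simp add: shape_def)
  then show False using assms by (simp add: shape_def)
qed

lemma fdim_pos:
  assumes "shape L n \<alpha>" "is_part \<alpha>"
  shows "0 < fdim L n \<alpha>"
  using assms
proof (induction n arbitrary: \<alpha>)
  case (Suc n)
  obtain i where i: "corner \<alpha> i" using corner_exists Suc.prems by blast
  then have "i < L" using corner_less Suc.prems by blast
  have "0 < fdim L n (dec \<alpha> i)" using Suc shape_dec is_part_dec i by blast
  also have "\<dots> = (if corner \<alpha> i then fdim L n (dec \<alpha> i) else 0)" using i by simp
  also have "\<dots> \<le> fdim L (Suc n) \<alpha>"
    unfolding fdim.simps by (rule member_le_sum) (use \<open>i < L\<close> fdim_nonneg in auto)
  finally show ?case .
qed simp

lemma sum_lessThan_split0: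
  fixes f :: "nat \<Rightarrow> 'a :: comm_monoid_add"
  assumes "0 < L"
  shows "(\<Sum>i<L. f i) = f 0 + (\<Sum>i=1..<L. f i)"
  using sum.atLeast_Suc_lessThan[OF assms, of f] by (simp add: atLeast0LessThan)

text \<open>The number of standard tableaux whose largest entry lies in the first row;
  \<open>out_row\<close> counts the others.\<close>

definition in_row :: "nat \<Rightarrow> nat \<Rightarrow> (nat \<Rightarrow> nat) \<Rightarrow> real" where
  "in_row L n \<alpha> = (if corner \<alpha> 0 then fdim L n (dec \<alpha> 0) else 0)"

definition out_row :: "nat \<Rightarrow> nat \<Rightarrow> (nat \<Rightarrow> nat) \<Rightarrow> real" where
  "out_row L n \<alpha> = (\<Sum>i=1..<L. if corner \<alpha> i then fdim L n (dec \<alpha> i) else 0)"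

lemma fdim_split: "0 < L \<Longrightarrow> fdim L (Suc n) \<alpha> = in_row L n \<alpha> + out_row L n \<alpha>"
  by (simp add: sum_lessThan_split0 in_row_def out_row_def)

lemma in_row_nonneg: "0 \<le> in_row L n \<alpha>"
  by (simp add: in_row_def fdim_nonneg)

lemma out_row_nonneg: "0 \<le> out_row L n \<alpha>"
  unfolding out_row_def by (intro sum_nonneg) (auto simp: fdim_nonneg)

lemma corner_dec_0: "1 \<le> i \<Longrightarrow> corner (dec \<alpha> 0) i \<longleftrightarrow> corner \<alpha> i"
  by (auto simp: corner_def dec_def)

lemma corner_0_dec: "1 \<le> i \<Longrightarrow> \<alpha> 1 < \<alpha> 0 \<Longrightarrow> corner (dec \<alpha> i) 0"
  by (auto simp: corner_def dec_def)

lemma dec_0_other: "1 \<le> i \<Longrightarrow> dec \<alpha> i 0 = \<alpha> 0"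
  by (simp add: dec_def)

lemma shape_first_two:
  assumes "shape L n \<alpha>" "0 < L"
  shows "\<alpha> 0 + \<alpha> 1 \<le> n"
proof (cases "1 < L")
  case True
  have "(\<Sum>i\<in>{0, 1}. \<alpha> i) \<le> (\<Sum>i<L. \<alpha> i)" by (rule sum_mono2) (use True in auto)
  then show ?thesis using assms by (simp add: shape_def)
next
  case False
  then have "L = 1" using assms by simp
  then show ?thesis using assms by (simp add: shape_def)
qed

lemma shape_first_three:
  assumes "shape L n \<alpha>" "3 \<le> L"
  shows "\<alpha> 0 + \<alpha> 1 + \<alpha> 2 \<le> n"
proof -
  have "(\<Sum>i\<in>{0, 1, 2}. \<alpha> i) \<le> (\<Sum>i<L. \<alpha> i)" by (rule sum_mono2) (use assms in auto)
  then show ?thesis using assms by (simp add: shape_def)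
qed

text \<open>Both sides remove one cell from the first row and one elsewhere, in opposite orders. The
  gap between the first two rows makes the orders independent.\<close>

lemma out_row_dec_0:
  assumes "\<alpha> 1 < \<alpha> 0"
  shows "out_row L n (dec \<alpha> 0) = (\<Sum>i=1..<L. if corner \<alpha> i then in_row L n (dec \<alpha> i) else 0)"
  unfolding out_row_def
proof (intro sum.cong refl)
  fix i assume "i \<in> {1..<L}"
  then have "1 \<le> i" by simp
  then show "(if corner (dec \<alpha> 0) i then fdim L n (dec (dec \<alpha> 0) i) else 0)
      = (if corner \<alpha> i then in_row L n (dec \<alpha> i) else 0)"
    using corner_dec_0[of i \<alpha>] corner_0_dec[of i \<alpha>] assms dec_commute[of \<alpha> 0 i]
    by (simp add: in_row_def)
qed

text \<open>With \<open>a\<close> cells in the first row and \<open>k\<close> outside, (a - k) (a +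
  1) / ((a - k + 1) (a + k)) is the proportion for the two-row shape (a, k).\<close>

lemma first_row_ratio:
  assumes "0 < L" "shape L (Suc n) \<alpha>" "is_part \<alpha>" "Suc n \<le> 2 * \<alpha> 0"
    and "a = real (\<alpha> 0)" "k = real (Suc n) - a"
  shows "(a - k) * (a + 1) * fdim L (Suc n) \<alpha> \<le> (a - k + 1) * (a + k) * in_row L n \<alpha>"
  using assms(2-)
proof (induction n arbitrary: \<alpha> a k)
  case 0
  have "\<alpha> 0 = 1" using 0 shape_first_two[of L "Suc 0" \<alpha>] assms(1) by simp
  then have ak: "a = 1" "k = 0" using 0 by auto
  have z: "\<alpha> i = 0" if "1 \<le> i" for i
    using is_part_mono[OF \<open>is_part \<alpha>\<close>, of 1 i] that shape_first_two[OF 0(1) assms(1)] \<open>\<alpha> 0 = 1\<close> by simp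
  have "out_row L 0 \<alpha> = 0" unfolding out_row_def by (intro sum.neutral) (auto simp: corner_def z)
  then show ?case unfolding fdim_split[OF assms(1)] ak by simp
next
  case (Suc n)
  note sh = Suc.prems(1) and pt = Suc.prems(2) and a = Suc.prems(4) and k = Suc.prems(5)
  have k0: "0 \<le> k" "k \<le> a" using Suc.prems(3) a k shape_first_two[OF sh assms(1)] by auto
  define F0 where "F0 = in_row L (Suc n) \<alpha>"
  define S where "S = out_row L (Suc n) \<alpha>"
  have F: "fdim L (Suc (Suc n)) \<alpha> = F0 + S" unfolding F0_def S_def by (rule fdim_split[OF assms(1)])
  have nn: "0 \<le> F0" "0 \<le> S" by (simp_all add: F0_def S_def in_row_nonneg out_row_nonneg)
  have "(a - k) * (a + 1) * (F0 + S) \<le> (a - k + 1) * (a + k) * F0"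
  proof (cases "a = k")
    case True
    then show ?thesis using nn k0 by simp
  next
    case False
    then have nk: "2 * \<alpha> 0 \<ge> Suc (Suc (Suc n))" using Suc.prems(3) a k by (cases "2 * \<alpha> 0 = Suc (Suc n)") auto
    have a1: "\<alpha> 1 < \<alpha> 0" using shape_first_two[OF sh assms(1)] nk by simp
    have c0: "corner \<alpha> 0" using a1 by (simp add: corner_def)
    have F0': "F0 = fdim L (Suc n) (dec \<alpha> 0)" using c0 by (simp add: F0_def in_row_def)
    have sh0: "shape L (Suc n) (dec \<alpha> 0)" and pt0: "is_part (dec \<alpha> 0)"
      using shape_dec[OF sh c0] is_part_dec[OF pt c0] by auto
    have ra: "real (dec \<alpha> 0 0) = a - 1" using a nk by (simp add: dec_def)
    have ak1: "k + 1 \<le> a" using nk a k by simp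
    define O' where "O' = in_row L n (dec \<alpha> 0)"
    define S' where "S' = out_row L n (dec \<alpha> 0)"
    have F0s: "F0 = O' + S'" unfolding F0' O'_def S'_def by (rule fdim_split[OF assms(1)])
    \<comment> \<open>Among the tableaux ending in the first row, this bounds those with the
      previous entry outside it.\<close>
    have "(a - 1 - k) * (a - 1 + 1) * F0 \<le> (a - 1 - k + 1) * (a - 1 + k) * O'"
      unfolding F0' O'_def
      by (rule Suc.IH[OF sh0 pt0]) (use nk ra a k in \<open>auto simp: dec_def\<close>)
    then have "(a - k) * (a + k - 1) * F0 - k * (a + 1 - k) * F0 \<le> (a - k) * (a + k - 1) * O'"
      by (simp add: algebra_simps)
    then have 1: "(a - k) * (a + k - 1) * S' \<le> k * (a + 1 - k) * F0"
      unfolding F0s by (simp add: algebra_simps)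
    \<comment> \<open>For each \<open>dec \<alpha> i\<close> the tableaux are bounded by those
      ending in the first row, and by \<open>out_row_dec_0\<close> the latter add up to
      \<open>S'\<close>.\<close>
    have 2: "(a - k + 1) * (a + 1) * S \<le> (a - k + 2) * (a + k - 1) * S'"
      unfolding S_def S'_def out_row_dec_0[OF a1] unfolding out_row_def sum_distrib_left
    proof (rule sum_mono)
      fix i assume "i \<in> {1..<L}"
      then have i: "1 \<le> i" by simp
      show "(a - k + 1) * (a + 1) * (if corner \<alpha> i then fdim L (Suc n) (dec \<alpha> i) else 0)
          \<le> (a - k + 2) * (a + k - 1) * (if corner \<alpha> i then in_row L n (dec \<alpha> i) else 0)"
      proof (cases "corner \<alpha> i")
        case True
        have "(a - (k - 1)) * (a + 1) * fdim L (Suc n) (dec \<alpha> i) \<le> (a - (k - 1) + 1) * (a + (k - 1)) * in_row L n (dec \<alpha> i)"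
          by (rule Suc.IH[OF shape_dec[OF sh True] is_part_dec[OF pt True]])
             (use nk a k dec_0_other[OF i, of \<alpha>] in auto)
        then show ?thesis using True by (simp add: algebra_simps)
      qed simp
    qed
    have "(a - k + 1) * ((a - k) * (a + 1) * S) = (a - k) * ((a - k + 1) * (a + 1) * S)" by simp
    also have "\<dots> \<le> (a - k) * ((a - k + 2) * (a + k - 1) * S')" using 2 ak1 by (intro mult_left_mono) auto
    also have "\<dots> = (a - k + 2) * ((a - k) * (a + k - 1) * S')" by simp
    also have "\<dots> \<le> (a - k + 2) * (k * (a + 1 - k) * F0)" using 1 ak1 by (intro mult_left_mono) auto
    also have "\<dots> = (a - k + 1) * ((a - k + 2) * k * F0)" by (simp add: algebra_simps)
    finally have "(a - k) * (a + 1) * S \<le> (a - k + 2) * k * F0"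
      using ak1 by (simp add: mult_le_cancel_left)
    then show ?thesis by (simp add: algebra_simps)
  qed
  then show ?case unfolding F F0_def .
qed

text \<open>In a single column every step is a descent.\<close>

lemma ndes_base:
  assumes "\<alpha> 0 \<le> 1" "is_part \<alpha>"
  shows "ndes L n \<alpha> = fdim L (Suc (Suc n)) \<alpha>"
  unfolding ndes_def fdim_Suc_Suc
proof (intro sum.cong refl)
  fix i j
  have "j < i" if "corner \<alpha> i" "corner (dec \<alpha> i) j"
  proof (rule ccontr)
    assume "\<not> j < i"
    moreover have "\<alpha> i \<le> 1" using is_part_mono[OF assms(2), of 0 i] assms(1) by simp
    ultimately have "dec \<alpha> i j = 0"
      using that(1) is_part_mono[OF assms(2), of "Suc i" j] by (cases "j = i") (auto simp: dec_def corner_def)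
    then show False using that(2) by (simp add: corner_def)
  qed
  then show "(if corner \<alpha> i \<and> corner (dec \<alpha> i) j \<and> j < i then fdim L n (dec (dec \<alpha> i) j) else 0)
      = (if corner \<alpha> i \<and> corner (dec \<alpha> i) j then fdim L n (dec (dec \<alpha> i) j) else 0)" by auto
qed

lemma ndes_nonneg: "0 \<le> ndes L n \<alpha>"
  unfolding ndes_def by (intro sum_nonneg) (auto simp: fdim_nonneg)

text \<open>For the two-row shape (a, k) of size s = a + k the proportion of last-step descents is k
  (a + 1) / (s (s - 1)). \<open>A\<close> is the first row of the comparison shape: at least half of
  the size, rounded up.\<close>

lemma ndes_ge:
  assumes "0 < L" "shape L (Suc (Suc n)) \<alpha>" "is_part \<alpha>"
    and "A = max (\<alpha> 0) ((n + 3) div 2)"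
  shows "(real n + 2 - real A) * (real A + 1) * fdim L (Suc (Suc n)) \<alpha> \<le> (real n + 2) * (real n + 1) * ndes L n \<alpha>"
  using assms(2-)
proof (induction n arbitrary: \<alpha> A)
  case 0
  show ?case
  proof (cases "\<alpha> 0 \<le> 1")
    case True
    then have "A = 1" using 0 by simp
    then show ?thesis using ndes_base[OF True 0(2), of L 0] by simp
  next
    case False
    then have "A = 2" using 0 shape_first_two[OF 0(1) assms(1)] by simp
    then show ?thesis using ndes_nonneg[of L 0 \<alpha>] by simp
  qed
next
  case (Suc n)
  note sh = Suc.prems(1) and pt = Suc.prems(2)
  let ?F = "fdim L (Suc (Suc (Suc n))) \<alpha>"
  have rec: "ndes L (Suc n) \<alpha> = (\<Sum>i<L. if corner \<alpha> i then ndes L n (dec \<alpha> i) else 0)"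
    by (rule ndes_rec[OF sh pt])
  have Frec: "?F = (\<Sum>i<L. if corner \<alpha> i then fdim L (Suc (Suc n)) (dec \<alpha> i) else 0)" by (rule fdim.simps(2))
  \<comment> \<open>Applies when all shapes \<open>dec \<alpha> i\<close> have the same comparison
    shape; \<open>ndes_rec\<close> then passes their common proportion on.\<close>
  have unif: "(real n + 2 - real A') * (real A' + 1) * ?F \<le> (real n + 2) * (real n + 1) * ndes L (Suc n) \<alpha>"
    if A': "\<And>i. corner \<alpha> i \<Longrightarrow> A' = max (dec \<alpha> i 0) ((n + 3) div 2)" for A'
    unfolding rec Frec sum_distrib_left
  proof (rule sum_mono)
    fix i
    show "(real n + 2 - real A') * (real A' + 1) * (if corner \<alpha> i then fdim L (Suc (Suc n)) (dec \<alpha> i) else 0)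
        \<le> (real n + 2) * (real n + 1) * (if corner \<alpha> i then ndes L n (dec \<alpha> i) else 0)"
      using Suc.IH[OF shape_dec[OF sh] is_part_dec[OF pt], of i A'] A'[of i] by (cases "corner \<alpha> i") simp_all
  qed
  have decle: "dec \<alpha> i 0 \<le> \<alpha> 0" for i by (simp add: dec_def)
  have Fpos: "0 \<le> ?F" and Npos: "0 \<le> ndes L (Suc n) \<alpha>" by (rule fdim_nonneg ndes_nonneg)+
  consider (big) "n + 3 < 2 * \<alpha> 0" | (even) m where "n + 3 = 2 * m" "\<alpha> 0 \<le> m" | (odd) m where "n + 3 = 2 * m + 1" "\<alpha> 0 \<le> m"
  proof (cases "n + 3 < 2 * \<alpha> 0")
    case False
    then show ?thesis using that(2)[of "(n + 3) div 2"] that(3)[of "(n + 3) div 2"]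
      by (cases "even (n + 3)") (auto elim!: evenE oddE)
  qed (use that(1) in blast)
  then show ?case
  proof cases
    case even
    then have "A = m" "(n + 3) div 2 = m" using Suc.prems(3) by auto
    then have "(real n + 2 - real m) * (real m + 1) * ?F \<le> (real n + 2) * (real n + 1) * ndes L (Suc n) \<alpha>"
    proof (intro unif)
      show "m = max (dec \<alpha> i 0) ((n + 3) div 2)" for i
        using decle[of i] even(2) \<open>(n + 3) div 2 = m\<close> by simp
    qed
    moreover have n: "real n = 2 * real m - 3" using arg_cong[OF even(1), of real] by simp
    moreover have m: "2 \<le> real m" using even(1) by simp
    ultimately have "(real m - 1) * ((real m + 1) * ?F) \<le> (real m - 1) * (2 * (2 * real m - 1) * ndes L (Suc n) \<alpha>)"
      by (simp add: algebra_simps)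
    then have "(real m + 1) * ?F \<le> 2 * (2 * real m - 1) * ndes L (Suc n) \<alpha>" using m by (simp add: mult_le_cancel_left)
    then have "real m * ((real m + 1) * ?F) \<le> real m * (2 * (2 * real m - 1) * ndes L (Suc n) \<alpha>)"
      by (intro mult_left_mono) auto
    then show ?thesis unfolding \<open>A = m\<close> of_nat_Suc n by (simp add: algebra_simps)
  next
    case odd
    then have "A = m + 1" "(n + 3) div 2 = m" using Suc.prems(3) by auto
    then have "(real n + 2 - real m) * (real m + 1) * ?F \<le> (real n + 2) * (real n + 1) * ndes L (Suc n) \<alpha>"
    proof (intro unif)
      show "m = max (dec \<alpha> i 0) ((n + 3) div 2)" for i
        using decle[of i] odd(2) \<open>(n + 3) div 2 = m\<close> by simp
    qed
    moreover have n: "real n = 2 * real m - 2" using arg_cong[OF odd(1), of real] by simp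
    moreover have m: "1 \<le> real m" using odd(1) by simp
    ultimately have "real m * ((real m + 1) * ?F) \<le> real m * (2 * (2 * real m - 1) * ndes L (Suc n) \<alpha>)"
      by (simp add: algebra_simps)
    then have 1: "(real m + 1) * ?F \<le> 2 * (2 * real m - 1) * ndes L (Suc n) \<alpha>" using m by (simp add: mult_le_cancel_left)
    \<comment> \<open>Rounding up lengthens the first row of the comparison shape by one, so the
      inherited proportion exceeds the required one; after clearing denominators the gap is
      \<open>3 * ?F\<close>.\<close>
    have "(2 * real m - 1) * ((real m + 2) * ?F) \<le> (2 * real m + 1) * ((real m + 1) * ?F)"
    proof -
      have "(2 * real m + 1) * ((real m + 1) * ?F) - (2 * real m - 1) * ((real m + 2) * ?F) = 3 * ?F"
        by (simp add: algebra_simps)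
      then show ?thesis using Fpos by linarith
    qed
    also have "\<dots> \<le> (2 * real m + 1) * (2 * (2 * real m - 1) * ndes L (Suc n) \<alpha>)"
      using 1 m by (intro mult_left_mono) auto
    also have "\<dots> = (2 * real m - 1) * (2 * (2 * real m + 1) * ndes L (Suc n) \<alpha>)" by (simp add: algebra_simps)
    finally have "(real m + 2) * ?F \<le> 2 * (2 * real m + 1) * ndes L (Suc n) \<alpha>" using m by (simp add: mult_le_cancel_left)
    then have "real m * ((real m + 2) * ?F) \<le> real m * (2 * (2 * real m + 1) * ndes L (Suc n) \<alpha>)"
      by (intro mult_left_mono) auto
    then show ?thesis unfolding \<open>A = m + 1\<close> of_nat_Suc n by (simp add: algebra_simps)
  next
    case big
    define a k s where "a = real (\<alpha> 0)" and "k = real (n + 3) - a" and "s = real (n + 3)"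
    have A: "A = \<alpha> 0" using Suc.prems(3) big by auto
    have a1: "\<alpha> 1 < \<alpha> 0" using shape_first_two[OF sh assms(1)] big by simp
    have c0: "corner \<alpha> 0" using a1 by (simp add: corner_def)
    define O' where "O' = in_row L (Suc (Suc n)) \<alpha>"
    define S where "S = out_row L (Suc (Suc n)) \<alpha>"
    have F: "?F = O' + S" unfolding O'_def S_def by (rule fdim_split[OF assms(1)])
    have k0: "0 \<le> k" "k + 1 \<le> a" "a \<ge> 2" using shape_first_two[OF sh assms(1)] big by (auto simp: a_def k_def)
    have sak: "s = a + k" by (simp add: s_def k_def)
    have N: "ndes L (Suc n) \<alpha> = ndes L n (dec \<alpha> 0) + (\<Sum>i=1..<L. if corner \<alpha> i then ndes L n (dec \<alpha> i) else 0)"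
      unfolding rec using sum_lessThan_split0[OF assms(1), of "\<lambda>i. if corner \<alpha> i then ndes L n (dec \<alpha> i) else 0"] c0 by simp
    have "(real n + 2 - real (dec \<alpha> 0 0)) * (real (dec \<alpha> 0 0) + 1) * fdim L (Suc (Suc n)) (dec \<alpha> 0)
       \<le> (real n + 2) * (real n + 1) * ndes L n (dec \<alpha> 0)"
      by (rule Suc.IH[OF shape_dec[OF sh c0] is_part_dec[OF pt c0]]) (use big in \<open>auto simp: dec_def\<close>)
    moreover have "real (dec \<alpha> 0 0) = a - 1" using big by (simp add: dec_def a_def)
    ultimately have 0: "k * a * O' \<le> (s - 1) * (s - 2) * ndes L n (dec \<alpha> 0)"
      using c0 by (simp add: O'_def in_row_def s_def k_def algebra_simps)
    have 1: "(k - 1) * (a + 1) * S \<le> (s - 1) * (s - 2) * (\<Sum>i=1..<L. if corner \<alpha> i then ndes L n (dec \<alpha> i) else 0)"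
      unfolding S_def out_row_def sum_distrib_left
    proof (rule sum_mono)
      fix i assume "i \<in> {1..<L}"
      then have i: "1 \<le> i" by simp
      show "(k - 1) * (a + 1) * (if corner \<alpha> i then fdim L (Suc (Suc n)) (dec \<alpha> i) else 0)
        \<le> (s - 1) * (s - 2) * (if corner \<alpha> i then ndes L n (dec \<alpha> i) else 0)"
      proof (cases "corner \<alpha> i")
        case True
        have "(real n + 2 - real (\<alpha> 0)) * (real (\<alpha> 0) + 1) * fdim L (Suc (Suc n)) (dec \<alpha> i)
           \<le> (real n + 2) * (real n + 1) * ndes L n (dec \<alpha> i)"
          by (rule Suc.IH[OF shape_dec[OF sh True] is_part_dec[OF pt True]])
             (use big dec_0_other[OF i, of \<alpha>] in auto)
        then show ?thesis using True by (simp add: s_def k_def a_def algebra_simps)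
      qed simp
    qed
    have "(a - k) * (a + 1) * ?F \<le> (a - k + 1) * (a + k) * O'"
      unfolding O'_def by (rule first_row_ratio[OF assms(1) sh pt _ a_def]) (use big in \<open>auto simp: k_def\<close>)
    then have R: "(a - k) * (a + 1) * (O' + S) \<le> (a - k + 1) * (a + k) * O'" unfolding F .
    \<comment> \<open>The gap between the induction hypotheses and the claim is exactly the slack in
      \<open>first_row_ratio\<close>.\<close>
    have "s * (k * a * O' + (k - 1) * (a + 1) * S) - (s - 2) * (k * (a + 1) * (O' + S))
        = (a - k + 1) * (a + k) * O' - (a - k) * (a + 1) * (O' + S)"
      unfolding sak by (simp add: algebra_simps)
    then have "(s - 2) * (k * (a + 1) * (O' + S)) \<le> s * (k * a * O' + (k - 1) * (a + 1) * S)"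
      using R by linarith
    also have "\<dots> \<le> s * ((s - 1) * (s - 2) * ndes L (Suc n) \<alpha>)"
      using 0 1 by (intro mult_left_mono) (auto simp: N s_def distrib_left)
    also have "\<dots> = (s - 2) * (s * (s - 1) * ndes L (Suc n) \<alpha>)" by (simp add: algebra_simps)
    finally have "k * (a + 1) * ?F \<le> s * (s - 1) * ndes L (Suc n) \<alpha>"
      unfolding F by (simp add: mult_le_cancel_left s_def)
    then show ?thesis unfolding A by (simp add: s_def k_def a_def algebra_simps)
  qed
qed

section \<open>Two-row shapes\<close>

lemma tri_pos:
  assumes "0 < s" "0 \<le> j" "j \<le> int m"
  shows "0 < tri s m j"
  using assms(2,3)
proof (induction m arbitrary: j)
  case (Suc m)
  have nn: "0 \<le> tri s m i" for i using tri_nonneg assms(1) by simp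
  show ?case
  proof (cases "j = 0")
    case True
    then have "0 < s * tri s m j" using Suc.IH[of 0] assms(1) by simp
    then show ?thesis using nn[of "j - 1"] nn[of "j + 1"] by simp
  next
    case False
    then have "0 < tri s m (j - 1)" using Suc by simp
    moreover have "0 \<le> s * tri s m j" using nn assms(1) by simp
    ultimately show ?thesis using nn[of "j + 1"] by simp
  qed
qed simp

text \<open>Removing two cells from a two-row shape moves half the difference of its rows by -1, 0
  or 1. The reflection principle subtracts the mirror image in -1/2, and by symmetry of
  \<open>tri\<close> this is a difference of neighbours.\<close>

definition ballot :: "real \<Rightarrow> nat \<Rightarrow> int \<Rightarrow> real" where
  "ballot s m j = tri s m j - tri s m (j + 1)"

lemma ballot_Suc: "ballot s (Suc m) j = ballot s m (j - 1) + s * ballot s m j + ballot s m (j + 1)"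
  by (simp add: ballot_def algebra_simps)

lemma ballot_minus_1: "ballot s m (- 1) = - ballot s m 0"
  using tri_minus[of s m 1] by (simp add: ballot_def)

lemma ballot_outside: "int m < j \<Longrightarrow> ballot s m j = 0"
  by (simp add: ballot_def tri_outside)

text \<open>x + 2 + 1/x is the square of x^(1/2) + x^(-1/2), so these are the binomial coefficients
  of 2m at m + j. The proof uses that for s = 2 the two right-hand sides of \<open>tri_step\<close>
  agree.\<close>

lemma tri_2_ratio: "(real m + 1 + of_int j) * tri 2 m (j + 1) = (real m - of_int j) * tri 2 m j"
proof (cases m)
  case 0
  then show ?thesis by auto
next
  case (Suc M)
  then show ?thesis using tri_step(1)[of M j 2] tri_step(2)[of M j 2] by (simp add: algebra_simps)
qed

lemma ballot_2: "(real m + 1 + of_int j) * ballot 2 m j = (2 * of_int j + 1) * tri 2 m j"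
proof -
  have "(real m + 1 + of_int j) * ballot 2 m j = (real m + 1 + of_int j) * tri 2 m j - (real m + 1 + of_int j) * tri 2 m (j + 1)"
    by (simp add: ballot_def algebra_simps)
  then show ?thesis unfolding tri_2_ratio by (simp add: algebra_simps)
qed

lemma ballot_2_pos:
  assumes "0 \<le> j" "j \<le> int m"
  shows "0 < ballot 2 m j"
proof -
  have "0 < (2 * real_of_int j + 1) * tri 2 m j" using assms tri_pos[of 2 j m] by (intro mult_pos_pos) auto
  then have "0 < (real m + 1 + of_int j) * ballot 2 m j" unfolding ballot_2 .
  then show ?thesis using assms by (simp add: zero_less_mult_iff)
qed

lemma ballot_2_next:
  assumes "0 \<le> j"
  shows "(2 * of_int j + 1) * (real m + of_int j + 2) * ballot 2 m (j + 1) = (2 * of_int j + 3) * (real m - of_int j) * ballot 2 m j"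
proof -
  have "(real m + 1 + of_int j) * ((2 * of_int j + 1) * tri 2 m (j + 1)) = (2 * of_int j + 1) * ((real m - of_int j) * tri 2 m j)"
    unfolding tri_2_ratio[symmetric] by simp
  also have "\<dots> = (real m - of_int j) * ((real m + 1 + of_int j) * ballot 2 m j)" unfolding ballot_2 by simp
  finally have "(real m + 1 + of_int j) * ((2 * of_int j + 1) * tri 2 m (j + 1))
      = (real m + 1 + of_int j) * ((real m - of_int j) * ballot 2 m j)" by simp
  then have t: "(2 * of_int j + 1) * tri 2 m (j + 1) = (real m - of_int j) * ballot 2 m j"
    using assms by simp
  have "(2 * of_int j + 1) * (real m + of_int j + 2) * ballot 2 m (j + 1)
      = (2 * of_int j + 1) * ((real m + 1 + of_int (j + 1)) * ballot 2 m (j + 1))" by (simp add: algebra_simps)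
  also have "\<dots> = (2 * of_int j + 3) * ((2 * of_int j + 1) * tri 2 m (j + 1))" unfolding ballot_2 by (simp add: algebra_simps)
  finally show ?thesis unfolding t by simp
qed

text \<open>\<open>ballot 2\<close> gives the two-row dimensions; this ratio is the descent
  proportion of \<open>ndes_ge\<close> for the first row m + 1 + j.\<close>

lemma ballot_2_level:
  assumes "0 \<le> j"
  shows "(2 * real m + 2) * (2 * real m + 1) * ballot 2 m j = (real m + 1 - of_int j) * (real m + of_int j + 2) * ballot 2 (Suc m) j"
proof -
  define J where "J = real_of_int j"
  have J: "0 \<le> J" using assms by (simp add: J_def)
  have "(real m + 1 + J) * ((real m + 1 - J) * tri 2 (Suc m) j) = 2 * (real m + 1) * ((real m + 1 + J) * tri 2 m (j + 1) + (real m + 1 + J) * tri 2 m j)"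
    using tri_step(1)[of m j 2] by (simp add: J_def algebra_simps)
  also have "(real m + 1 + J) * tri 2 m (j + 1) = (real m - J) * tri 2 m j"
    using tri_2_ratio[of m j] by (simp add: J_def)
  also have "2 * (real m + 1) * ((real m - J) * tri 2 m j + (real m + 1 + J) * tri 2 m j)
      = 2 * (real m + 1) * (2 * real m + 1) * tri 2 m j"
    by (simp add: algebra_simps)
  finally have e3: "(real m + 1 + J) * (real m + 1 - J) * tri 2 (Suc m) j = 2 * (real m + 1) * (2 * real m + 1) * tri 2 m j" by simp
  have b1: "(real m + 1 + J) * ballot 2 m j = (2 * J + 1) * tri 2 m j"
    unfolding J_def by (rule ballot_2)
  have b2: "(real m + J + 2) * ballot 2 (Suc m) j = (2 * J + 1) * tri 2 (Suc m) j"
    using ballot_2[of "Suc m" j] by (simp add: J_def add.commute add.left_commute del: tri.simps)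
  have "(real m + 1 + J) * ((2 * real m + 2) * (2 * real m + 1) * ballot 2 m j)
     = (2 * real m + 2) * (2 * real m + 1) * ((real m + 1 + J) * ballot 2 m j)" by simp
  also have "\<dots> = (2 * J + 1) * (2 * (real m + 1) * (2 * real m + 1) * tri 2 m j)"
    unfolding b1 by simp
  also have "\<dots> = (real m + 1 + J) * (real m + 1 - J) * ((2 * J + 1) * tri 2 (Suc m) j)"
    unfolding e3[symmetric] by (simp del: tri.simps)
  also have "\<dots> = (real m + 1 + J) * ((real m + 1 - J) * (real m + J + 2) * ballot 2 (Suc m) j)"
    unfolding b2[symmetric] by simp
  finally show ?thesis using J by (simp add: J_def[symmetric])
qed

text \<open>The proportion of two-row tableaux with both last entries in the second row;
  \<open>ballot_2_level_down\<close> is its counterpart for the first row.\<close>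

lemma ballot_2_level_up:
  assumes "0 \<le> j"
  shows "(2 * real m + 2) * (2 * real m + 1) * (2 * of_int j + 1) * ballot 2 m (j + 1)
    = (2 * of_int j + 3) * (real m - of_int j) * (real m + 1 - of_int j) * ballot 2 (Suc m) j"
proof -
  define J where "J = real_of_int j"
  have J: "0 \<le> J" using assms by (simp add: J_def)
  have "(real m + J + 2) * ((2 * real m + 2) * (2 * real m + 1) * (2 * J + 1) * ballot 2 m (j + 1))
     = (2 * real m + 2) * (2 * real m + 1) * ((2 * J + 1) * (real m + J + 2) * ballot 2 m (j + 1))" by simp
  also have "\<dots> = (2 * J + 3) * (real m - J) * ((2 * real m + 2) * (2 * real m + 1) * ballot 2 m j)"
    using ballot_2_next[OF assms, of m] by (simp add: J_def)
  also have "\<dots> = (real m + J + 2) * ((2 * J + 3) * (real m - J) * (real m + 1 - J) * ballot 2 (Suc m) j)"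
    using ballot_2_level[OF assms, of m] by (simp add: J_def)
  finally show ?thesis using J by (simp add: J_def[symmetric])
qed

lemma ballot_2_level_down:
  assumes "1 \<le> j" "j \<le> int m"
  shows "(2 * real m + 2) * (2 * real m + 1) * (2 * of_int j + 1) * ballot 2 m (j - 1)
    = (2 * of_int j - 1) * (real m + 1 + of_int j) * (real m + of_int j + 2) * ballot 2 (Suc m) j"
proof -
  define J where "J = real_of_int j"
  have J: "1 \<le> J" "J \<le> real m" using assms by (auto simp: J_def)
  have "(real m + 1 - J) * ((2 * real m + 2) * (2 * real m + 1) * (2 * J + 1) * ballot 2 m (j - 1))
     = (2 * real m + 2) * (2 * real m + 1) * ((2 * J + 1) * (real m + 1 - J) * ballot 2 m (j - 1))" by simp
  also have "(2 * J + 1) * (real m + 1 - J) * ballot 2 m (j - 1) = (2 * J - 1) * (real m + 1 + J) * ballot 2 m j"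
    using ballot_2_next[of "j - 1" m] assms by (simp add: J_def algebra_simps)
  also have "(2 * real m + 2) * (2 * real m + 1) * ((2 * J - 1) * (real m + 1 + J) * ballot 2 m j)
     = (2 * J - 1) * (real m + 1 + J) * ((2 * real m + 2) * (2 * real m + 1) * ballot 2 m j)" by simp
  also have "\<dots> = (real m + 1 - J) * ((2 * J - 1) * (real m + 1 + J) * (real m + J + 2) * ballot 2 (Suc m) j)"
    using ballot_2_level[of j m] assms by (simp add: J_def)
  finally show ?thesis using J by (simp add: J_def[symmetric])
qed

text \<open>Eliminating \<open>tri s m (j + 2)\<close> by \<open>tri_rec\<close> turns this into
  \<open>tri_lower\<close>, multiplied by j + 1.\<close>

lemma ballot_next_ge:
  assumes "1 \<le> s" "s \<le> 2" "0 \<le> j" "3 \<le> m"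
  shows "(2 * of_int j + 3) * (real m - of_int j) * ballot s m j \<le> (2 * of_int j + 1) * (real m + of_int j + 2) * ballot s m (j + 1)"
proof -
  define J where "J = real_of_int j"
  have r: "(real m + 2 + J) * tri s m (j + 2) = (real m - J) * tri s m j - s * (J + 1) * tri s m (j + 1)"
    using tri_rec[of m "j + 1" s] by (simp add: J_def algebra_simps)
  have L: "4 * (real m - J) * tri s m j \<le> (4 * real m + 2 + s * (2 * J + 1)) * tri s m (j + 1)"
    using tri_lower[OF assms] by (simp add: tri_lower_def J_def)
  have "(2 * J + 1) * (real m + J + 2) * ballot s m (j + 1) - (2 * J + 3) * (real m - J) * ballot s m j
      = (2 * J + 1) * ((real m + 2 + J) * tri s m (j + 1)) - (2 * J + 1) * ((real m + 2 + J) * tri s m (j + 2))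
        - (2 * J + 3) * (real m - J) * (tri s m j - tri s m (j + 1))"
    by (simp add: ballot_def algebra_simps)
  also have "\<dots> = (J + 1) * ((4 * real m + 2 + s * (2 * J + 1)) * tri s m (j + 1) - 4 * (real m - J) * tri s m j)"
    unfolding r by (simp add: algebra_simps)
  also have "\<dots> \<ge> 0" using L assms(3) by (intro mult_nonneg_nonneg) (auto simp: J_def)
  finally show ?thesis by (simp add: J_def)
qed

text \<open>The value of \<open>psi\<close> at the shape [m + j, m - j] for q = 2 p - 1.\<close>

definition two_row_value :: "real \<Rightarrow> nat \<Rightarrow> nat \<Rightarrow> real" where
  "two_row_value q m j = ballot (1 + q) m (int j) / ballot 2 m (int j)"

text \<open>Sets \<open>ballot_next_ge\<close> at s = 1 + q against its equality case
  \<open>ballot_2_next\<close> at s = 2.\<close>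

lemma two_row_value_Suc:
  assumes "0 \<le> q" "q \<le> 1" "3 \<le> m" "Suc j \<le> m"
  shows "two_row_value q m j \<le> two_row_value q m (Suc j)"
proof -
  let ?B = "ballot (1 + q) m" and ?D = "ballot 2 m" and ?c = "(2 * real j + 1) * (real m + real j + 2)"
  have pos: "0 < ?D (int j)" "0 < ?D (int j + 1)" using ballot_2_pos assms(4) by auto
  have "?c * (?B (int j) * ?D (int j + 1)) = ?B (int j) * (?c * ?D (int j + 1))" by simp
  also have "\<dots> = ?B (int j) * ((2 * real j + 3) * (real m - real j) * ?D (int j))"
    using ballot_2_next[of "int j" m] by simp
  also have "\<dots> = ?D (int j) * ((2 * real j + 3) * (real m - real j) * ?B (int j))" by simp
  also have "\<dots> \<le> ?D (int j) * (?c * ?B (int j + 1))"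
    using ballot_next_ge[of "1 + q" "int j" m] assms pos by (intro mult_left_mono) auto
  finally have "?c * (?B (int j) * ?D (int j + 1)) \<le> ?c * (?B (int j + 1) * ?D (int j))" by (simp add: algebra_simps)
  moreover have "0 < ?c" by (intro mult_pos_pos) auto
  ultimately have "?B (int j) * ?D (int j + 1) \<le> ?B (int j + 1) * ?D (int j)" by (simp only: mult_le_cancel_left_pos)
  then show ?thesis using pos by (simp add: two_row_value_def frac_le_eq divide_simps add.commute)
qed

definition two_row :: "nat \<Rightarrow> nat \<Rightarrow> nat \<Rightarrow> nat" where
  "two_row a k = (\<lambda>i. if i = 0 then a else if i = 1 then k else 0)"

lemma corner_two_row:
  "corner (two_row a k) i \<longleftrightarrow> i = 0 \<and> k < a \<or> i = 1 \<and> 0 < k"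
  by (auto simp: corner_def two_row_def)

lemma dec_two_row:
  "dec (two_row a k) 0 = two_row (a - 1) k" "dec (two_row a k) (Suc 0) = two_row a (k - 1)"
  by (auto simp: dec_def two_row_def fun_eq_iff)

lemma sum_lessThan_two:
  fixes f :: "nat \<Rightarrow> real"
  assumes "2 \<le> L" "\<And>i. 2 \<le> i \<Longrightarrow> f i = 0"
  shows "(\<Sum>i<L. f i) = f 0 + f 1"
proof -
  have "(\<Sum>i<L. f i) = (\<Sum>i\<in>{0, 1}. f i)"
    by (rule sum.mono_neutral_right) (use assms in auto)
  then show ?thesis by simp
qed

lemma xsum_two_row:
  assumes "2 \<le> L" "k \<le> a" "a + k = 2 * m"
  shows "xsum L q m (two_row a k) = ballot (1 + q) m (int a - int m)"
  using assms(2,3)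
proof (induction m arbitrary: a k)
  case 0
  then show ?case by (simp add: ballot_def)
next
  case (Suc m)
  let ?X = "xsum L q m" and ?B = "ballot (1 + q) m"
  define j where "j = int a - int (Suc m)"
  have inner: "(\<Sum>l<L. if corner (two_row a k) i \<and> corner (dec (two_row a k) i) l then w i l * ?X (dec (dec (two_row a k) i) l) else 0)
      = (if corner (two_row a k) i \<and> corner (dec (two_row a k) i) 0 then w i 0 * ?X (dec (dec (two_row a k) i) 0) else 0)
      + (if corner (two_row a k) i \<and> corner (dec (two_row a k) i) 1 then w i 1 * ?X (dec (dec (two_row a k) i) 1) else 0)"
    for i and w :: "nat \<Rightarrow> nat \<Rightarrow> real"
    by (rule sum_lessThan_two[OF assms(1)]) (auto simp: corner_two_row dec_two_row)
  define H where "H i =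
      (if corner (two_row a k) i \<and> corner (dec (two_row a k) i) 0
       then (if i \<le> 0 then 1 else q) * ?X (dec (dec (two_row a k) i) 0) else 0)
    + (if corner (two_row a k) i \<and> corner (dec (two_row a k) i) 1
       then (if i \<le> 1 then 1 else q) * ?X (dec (dec (two_row a k) i) 1) else 0)" for i
  have "xsum L q (Suc m) (two_row a k) = (\<Sum>i<L. H i)"
    unfolding xsum.simps H_def by (intro sum.cong refl inner[where w = "\<lambda>i l. if i \<le> l then 1 else q"])
  also have "\<dots> = H 0 + H 1" by (rule sum_lessThan_two[OF assms(1)]) (simp add: H_def corner_two_row)
  also have "H 0 = (if k < a then (if k < a - 1 then ?X (two_row (a - 2) k) else 0)
      + (if 0 < k then ?X (two_row (a - 1) (k - 1)) else 0) else 0)"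
    by (simp add: H_def corner_two_row dec_two_row numeral_2_eq_2)
  also have "H 1 = (if 0 < k then q * ?X (two_row (a - 1) (k - 1)) + (if 1 < k then ?X (two_row a (k - 2)) else 0) else 0)"
    using Suc.prems(1) by (auto simp: H_def corner_two_row dec_two_row numeral_2_eq_2)
  also have "(if k < a then (if k < a - 1 then ?X (two_row (a - 2) k) else 0)
      + (if 0 < k then ?X (two_row (a - 1) (k - 1)) else 0) else 0)
      + (if 0 < k then q * ?X (two_row (a - 1) (k - 1)) + (if 1 < k then ?X (two_row a (k - 2)) else 0) else 0)
      = ?B (j - 1) + (1 + q) * ?B j + ?B (j + 1)"
  proof -
    have 00: "?X (two_row (a - 2) k) = ?B (j - 1)" if "k < a"
    proof -
      have *: "k \<le> a - 2" "a - 2 + k = 2 * m" "2 \<le> a" using that Suc.prems by presburger+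
      have e: "int (a - 2) - int m = j - 1" using *(3) by (simp add: j_def of_nat_diff)
      show ?thesis unfolding e[symmetric] by (rule Suc.IH[OF *(1,2)])
    qed
    have 01: "?X (two_row (a - 1) (k - 1)) = ?B j" if "0 < k"
    proof -
      have e: "int (a - 1) - int m = j" using that Suc.prems by (simp add: j_def of_nat_diff)
      have *: "k - 1 \<le> a - 1" "a - 1 + (k - 1) = 2 * m" using that Suc.prems by auto
      show ?thesis unfolding e[symmetric] by (rule Suc.IH[OF *])
    qed
    have 11: "?X (two_row a (k - 2)) = ?B (j + 1)" if "1 < k"
    proof -
      have e: "int a - int m = j + 1" by (simp add: j_def)
      have *: "k - 2 \<le> a" "a + (k - 2) = 2 * m" using that Suc.prems by auto
      show ?thesis unfolding e[symmetric] by (rule Suc.IH[OF *])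
    qed
    \<comment> \<open>The two rows have equal parity, so k = a - 1 cannot occur.\<close>
    have lt: "k < a - 1 \<longleftrightarrow> k < a" using Suc.prems by presburger
    have z1: "?B (j + 1) = 0" if "\<not> 1 < k" using that Suc.prems by (intro ballot_outside) (simp add: j_def)
    have z0: "?B j = 0" if "\<not> 0 < k" using that Suc.prems by (intro ballot_outside) (simp add: j_def)
    show ?thesis
    proof (cases "k < a")
      case True
      then show ?thesis using 00 01 11 lt z0 z1 by (cases "0 < k"; cases "1 < k") (auto simp: algebra_simps)
    next
      case False
      \<comment> \<open>With equal rows the first row cannot lose a cell first, so the mixed removal
        occurs only with weight q; the reflected term \<open>ballot_minus_1\<close> accounts for the
        missing 1.\<close>
      then have "j = 0" "0 < k" using Suc.prems by (auto simp: j_def)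
      then show ?thesis using False 01 11 z1 ballot_minus_1[of "1 + q" m] by (cases "1 < k") (auto simp: algebra_simps)
    qed
  qed
  finally show ?case using ballot_Suc[of "1 + q" m j] by (simp add: j_def)
qed

lemma fdim_eq_xsum: "fdim L (2 * m) \<alpha> = xsum L 1 m \<alpha>"
proof (induction m arbitrary: \<alpha>)
  case (Suc m)
  have "fdim L (2 * Suc m) \<alpha> = fdim L (Suc (Suc (2 * m))) \<alpha>" by simp
  then show ?case unfolding fdim_Suc_Suc Suc xsum.simps by (auto intro!: sum.cong)
qed simp

lemma xsum_nonneg: "0 \<le> q \<Longrightarrow> 0 \<le> xsum L q m \<alpha>"
  by (induction m arbitrary: \<alpha>) (auto intro!: sum_nonneg)

lemma two_row_value_nonneg:
  assumes "0 \<le> q" "j \<le> m"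
  shows "0 \<le> two_row_value q m j"
proof -
  have "ballot (1 + q) m (int j) = xsum 2 q m (two_row (m + j) (m - j))"
    using xsum_two_row[of 2 "m - j" "m + j" m q] assms by simp
  then have "0 \<le> ballot (1 + q) m (int j)" using xsum_nonneg assms by simp
  moreover have "0 < ballot 2 m (int j)" using ballot_2_pos assms by simp
  ultimately show ?thesis by (simp add: two_row_value_def)
qed

lemma xsum_two_row_value:
  assumes "2 \<le> L" "k \<le> a" "a + k = 2 * m"
  shows "xsum L q m (two_row a k) = two_row_value q m (a - m) * fdim L (2 * m) (two_row a k)"
proof -
  have "int (a - m) = int a - int m" using assms by simp
  moreover have "ballot 2 m (int a - int m) \<noteq> 0" using ballot_2_pos[of "int a - int m" m] assms by simp
  ultimately show ?thesis
    unfolding fdim_eq_xsum two_row_value_def using xsum_two_row[OF assms] by simp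
qed

section \<open>Comparison with two-row shapes\<close>

text \<open>\<open>F00\<close>, \<open>2 * S0\<close>, \<open>SS\<close> count tableaux with two,
  one or none of the last two entries in the first row; \<open>d0\<close>, \<open>2 * d1\<close>,
  \<open>d2\<close> belong to the two-row shape. Rewriting \<open>N'\<close> as N - S0 gives the
  middle class the weight y, and x0 \<le> y \<le> x2 makes each of the three inequalities act in the
  right direction.\<close>

lemma weighted_compare:
  fixes D :: real
  assumes x: "x0 \<le> x1" "x1 \<le> x2" "0 \<le> x2" and q: "0 \<le> q" "q \<le> 1" and D: "0 < D"
    and F: "F = F00 + 2 * S0 + SS" and N: "N = S0 + N'"
    and Ds: "D = d0 + 2 * d1 + d2"
    and 1: "d0 * F \<le> D * F00" and 2: "D * SS \<le> d2 * F" and 3: "d1 * F \<le> D * N"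
    and g: "g * D = x0 * d0 + (1 + q) * x1 * d1 + x2 * d2"
  shows "x0 * F00 + (1 + q) * x1 * S0 + x2 * (SS - (1 - q) * N') \<le> g * F"
proof -
  define P where "P = D * F00 - d0 * F"
  define R where "R = d2 * F - D * SS"
  define y where "y = ((1 + q) * x1 + (1 - q) * x2) / 2"
  have PR: "0 \<le> P" "0 \<le> R" using 1 2 by (auto simp: P_def R_def)
  have "(1 - q) * x1 \<le> (1 - q) * x2" "(1 + q) * x1 \<le> (1 + q) * x2"
    using x q by (auto intro: mult_left_mono)
  then have y: "x0 \<le> y" "y \<le> x2" using x by (auto simp: y_def algebra_simps)
  have "P - R = D * (F00 + SS) - (d0 + d2) * F" by (simp add: P_def R_def algebra_simps)
  also have "\<dots> = 2 * (d1 * F - D * S0)" unfolding F Ds by (simp add: algebra_simps)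
  finally have PmR: "2 * (d1 * F - D * S0) = P - R" by simp
  have "g * D * F - D * (x0 * F00 + (1 + q) * x1 * S0 + x2 * (SS - (1 - q) * N'))
      = - x0 * P + y * (2 * (d1 * F - D * S0)) + x2 * R + (1 - q) * x2 * (D * N - d1 * F)"
    unfolding g N P_def R_def y_def by (simp add: field_simps)
  also have "\<dots> = (y - x0) * P + (x2 - y) * R + (1 - q) * x2 * (D * N - d1 * F)"
    unfolding PmR by (simp add: algebra_simps)
  also have "\<dots> \<ge> 0" using y PR q x 3 by (intro add_nonneg_nonneg mult_nonneg_nonneg) auto
  finally have "D * (x0 * F00 + (1 + q) * x1 * S0 + x2 * (SS - (1 - q) * N')) \<le> D * (g * F)"
    by (simp add: algebra_simps)
  then show ?thesis using D by (simp only: mult_le_cancel_left_pos)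
qed

lemma two_row_shape:
  assumes "shape L n \<alpha>" "is_part \<alpha>" "\<alpha> 2 = 0" "2 \<le> L"
  shows "\<alpha> = two_row (\<alpha> 0) (\<alpha> 1)" "\<alpha> 0 + \<alpha> 1 = n"
proof -
  have z: "\<alpha> i = 0" if "2 \<le> i" for i using is_part_mono[OF assms(2) that] assms(3) by simp
  show "\<alpha> = two_row (\<alpha> 0) (\<alpha> 1)"
  proof
    fix i :: nat
    consider "i = 0" | "i = 1" | "2 \<le> i" by linarith
    then show "\<alpha> i = two_row (\<alpha> 0) (\<alpha> 1) i" using z by cases (auto simp: two_row_def)
  qed
  have "(\<Sum>i<L. \<alpha> i) = (\<Sum>i\<in>{0, 1}. \<alpha> i)"
    by (rule sum.mono_neutral_right) (use assms(4) z in auto)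
  then show "\<alpha> 0 + \<alpha> 1 = n" using assms(1) by (simp add: shape_def)
qed

lemma two_row_value_eq:
  assumes "j \<le> m"
  shows "two_row_value q m j * ballot 2 m (int j) = ballot (1 + q) m (int j)"
  using ballot_2_pos[of "int j" m] assms by (simp add: two_row_value_def)

text \<open>All smaller shapes have first row at most \<open>M\<close>, so one value
  \<open>x0\<close> bounds them all and only the number of descents matters.\<close>

lemma xsum_step_narrow:
  assumes L: "0 < L" and q: "0 \<le> q" "q \<le> 1" and M: "3 \<le> M"
    and sh: "shape L (2 * Suc M) \<alpha>" and pt: "is_part \<alpha>" and a: "\<alpha> 0 \<le> M"
    and IH: "\<And>\<beta>. shape L (2 * M) \<beta> \<Longrightarrow> is_part \<beta> \<Longrightarrow>
      xsum L q M \<beta> \<le> two_row_value q M (\<beta> 0 - M) * fdim L (2 * M) \<beta>"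
  shows "xsum L q (Suc M) \<alpha> \<le> two_row_value q (Suc M) 0 * fdim L (2 * Suc M) \<alpha>"
proof -
  let ?ok = "\<lambda>i j. corner \<alpha> i \<and> corner (dec \<alpha> i) j" and ?b = "\<lambda>i j. dec (dec \<alpha> i) j"
  define x0 x1 where "x0 = two_row_value q M 0" and "x1 = two_row_value q M 1"
  define F N where "F = fdim L (Suc (Suc (2 * M))) \<alpha>" and "N = ndes L (2 * M) \<alpha>"
  have sh2: "shape L (Suc (Suc (2 * M))) \<alpha>" using sh by simp
  have x: "0 \<le> x0" "x0 \<le> x1"
    using two_row_value_nonneg[OF q(1), of 0 M] two_row_value_Suc[OF q M, of 0] M by (auto simp: x0_def x1_def)
  have "xsum L q (Suc M) \<alpha> \<le> (\<Sum>i<L. \<Sum>j<L. x0 * (if ?ok i j then fdim L (2 * M) (?b i j) else 0)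
      - (1 - q) * x0 * (if corner \<alpha> i \<and> corner (dec \<alpha> i) j \<and> j < i then fdim L (2 * M) (?b i j) else 0))"
    unfolding xsum.simps
  proof (intro sum_mono)
    fix i j
    show "(if ?ok i j then (if i \<le> j then 1 else q) * xsum L q M (?b i j) else 0)
      \<le> x0 * (if ?ok i j then fdim L (2 * M) (?b i j) else 0)
      - (1 - q) * x0 * (if corner \<alpha> i \<and> corner (dec \<alpha> i) j \<and> j < i then fdim L (2 * M) (?b i j) else 0)"
    proof (cases "?ok i j")
      case True
      have "?b i j 0 - M = 0" using a by (auto simp: dec_def)
      then have "xsum L q M (?b i j) \<le> x0 * fdim L (2 * M) (?b i j)"
        using IH[of "?b i j"] shape_dec[OF shape_dec[OF sh2]] is_part_dec[OF is_part_dec[OF pt]] True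
        by (simp add: x0_def)
      moreover from this have "q * xsum L q M (?b i j) \<le> q * (x0 * fdim L (2 * M) (?b i j))"
        using q by (intro mult_left_mono)
      ultimately show ?thesis using True by (auto simp: algebra_simps)
    qed auto
  qed
  also have "\<dots> = x0 * F - (1 - q) * x0 * N"
    unfolding F_def N_def fdim_Suc_Suc ndes_def sum_distrib_left sum_subtractf ..
  also have "\<dots> \<le> two_row_value q (Suc M) 0 * F"
  proof -
    define D d0 d1 where "D = ballot 2 (Suc M) 0" and "d0 = ballot 2 M 0" and "d1 = ballot 2 M 1"
    have D: "0 < D" using ballot_2_pos[of 0 "Suc M"] by (simp add: D_def)
    \<comment> \<open>The reflected term \<open>ballot 2 M (- 1)\<close> cancels one of the two
      copies of \<open>d0\<close>.\<close>
    have Dd: "D = d0 + d1" using ballot_Suc[of 2 M 0] ballot_minus_1[of 2 M] by (simp add: D_def d0_def d1_def)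
    have d1: "0 < d1" using ballot_2_pos[of 1 M] M by (simp add: d1_def)
    have gD: "two_row_value q (Suc M) 0 * D = q * x0 * d0 + x1 * d1"
      using two_row_value_eq[of 0 "Suc M" q] two_row_value_eq[of 0 M q] two_row_value_eq[of 1 M q] M
        ballot_Suc[of "1 + q" M 0] ballot_minus_1[of "1 + q" M]
      by (simp add: D_def d0_def d1_def x0_def x1_def algebra_simps)
    have "(2 * real M + 2 - real (Suc M)) * (real (Suc M) + 1) * F \<le> (2 * real M + 2) * (2 * real M + 1) * N"
      using ndes_ge[OF L sh2 pt, of "Suc M"] a by (simp add: F_def N_def)
    then have "(real M + 1) * ((real M + 2) * F) \<le> (real M + 1) * (2 * (2 * real M + 1) * N)"
      by (simp add: algebra_simps)
    then have n: "(real M + 2) * F \<le> 2 * (2 * real M + 1) * N" by (simp add: mult_le_cancel_left)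
    have l: "2 * (2 * real M + 1) * d0 = (real M + 2) * D"
    proof -
      have "(real M + 1) * (2 * (2 * real M + 1) * d0) = (real M + 1) * ((real M + 2) * D)"
        using ballot_2_level[of 0 M] by (simp add: d0_def D_def algebra_simps)
      then show ?thesis by (simp only: mult_cancel_left) simp
    qed
    have F0: "0 \<le> F" by (simp add: F_def fdim_nonneg del: fdim.simps)
    have "(2 * (2 * real M + 1)) * (d0 * F) = (2 * (2 * real M + 1) * d0) * F" by simp
    also have "\<dots> = D * ((real M + 2) * F)" unfolding l by simp
    also have "\<dots> \<le> D * (2 * (2 * real M + 1) * N)" using n D by (intro mult_left_mono) auto
    finally have "(2 * (2 * real M + 1)) * (d0 * F) \<le> (2 * (2 * real M + 1)) * (D * N)" by (simp add: algebra_simps)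
    then have dN: "d0 * F \<le> D * N" by (subst (asm) mult_le_cancel_left_pos) auto
    have "(1 - q) * x0 * (d0 * F) \<le> (1 - q) * x0 * (D * N)" using dN q x by (intro mult_left_mono) auto
    moreover have "x0 * d1 * F \<le> x1 * d1 * F" using x d1 F0 by (intro mult_right_mono) auto
    ultimately have "D * (x0 * F - (1 - q) * x0 * N) \<le> (q * x0 * d0 + x1 * d1) * F"
      unfolding Dd by (simp add: algebra_simps)
    also have "\<dots> = D * (two_row_value q (Suc M) 0 * F)" unfolding gD[symmetric] by simp
    finally show ?thesis using D by (simp only: mult_le_cancel_left_pos)
  qed
  finally show ?thesis by (simp add: F_def del: fdim.simps)
qed

text \<open>\<open>weighted_compare\<close> is fed with two uses of \<open>first_row_ratio\<close>
  for each of the two outer classes and with \<open>ndes_ge\<close> for the descents.\<close>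

lemma xsum_step_wide:
  assumes L: "3 \<le> L" and q: "0 \<le> q" "q \<le> 1" and M: "3 \<le> M"
    and sh: "shape L (2 * Suc M) \<alpha>" and pt: "is_part \<alpha>" and a: "\<alpha> 0 = Suc M + j" and a2: "0 < \<alpha> 2"
    and IH: "\<And>\<beta>. shape L (2 * M) \<beta> \<Longrightarrow> is_part \<beta> \<Longrightarrow>
      xsum L q M \<beta> \<le> two_row_value q M (\<beta> 0 - M) * fdim L (2 * M) \<beta>"
  shows "xsum L q (Suc M) \<alpha> \<le> two_row_value q (Suc M) j * fdim L (2 * Suc M) \<alpha>"
proof -
  let ?ok = "\<lambda>i l. corner \<alpha> i \<and> corner (dec \<alpha> i) l" and ?b = "\<lambda>i l. dec (dec \<alpha> i) l"
  have L0: "0 < L" using L by simp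
  define f where "f i l = (if ?ok i l then fdim L (2 * M) (?b i l) else 0)" for i l
  \<comment> \<open>For j = 0 truncation makes \<open>x0\<close> equal to \<open>x1\<close>; the
    matching weight \<open>ballot 2 M (- 1)\<close> is then negative.\<close>
  define x0 x1 x2 where "x0 = two_row_value q M (j - 1)" and "x1 = two_row_value q M j" and "x2 = two_row_value q M (Suc j)"
  have sh2: "shape L (Suc (Suc (2 * M))) \<alpha>" using sh by simp
  have three: "\<alpha> 0 + \<alpha> 1 + \<alpha> 2 \<le> Suc (Suc (2 * M))" by (rule shape_first_three[OF sh2 L])
  moreover have "\<alpha> 2 \<le> \<alpha> 1" by (rule is_part_mono[OF pt]) simp
  \<comment> \<open>The second and third rows have at least one cell each, so the first row is at
    most 2 M and the index \<open>Suc j\<close> of \<open>x2\<close> is admissible.\<close>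
  ultimately have jM: "Suc j \<le> M" and a1: "\<alpha> 1 < \<alpha> 0" using a a2 by auto
  have c0: "corner \<alpha> 0" using a1 by (simp add: corner_def)
  have x: "x0 \<le> x1" "x1 \<le> x2" "0 \<le> x2"
    using two_row_value_Suc[OF q M, of "j - 1"] two_row_value_Suc[OF q M, of j] two_row_value_nonneg[OF q(1), of "Suc j" M] jM
    by (cases j; simp add: x0_def x1_def x2_def)+
  define F00 S0 SS N' where "F00 = f 0 0" and "S0 = (\<Sum>l=1..<L. f 0 l)"
    and "SS = (\<Sum>i=1..<L. \<Sum>l=1..<L. f i l)" and "N' = (\<Sum>i=1..<L. \<Sum>l=1..<L. if l < i then f i l else 0)"
  define F N where "F = fdim L (Suc (Suc (2 * M))) \<alpha>" and "N = ndes L (2 * M) \<alpha>"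
  have fnn: "0 \<le> f i l" for i l by (simp add: f_def fdim_nonneg)
  have sym: "f i 0 = f 0 i" if "1 \<le> i" for i
    using that corner_dec_0[of i \<alpha>] corner_0_dec[of i \<alpha>] a1 c0 dec_commute[of \<alpha> 0 i] by (simp add: f_def)
  have split: "(\<Sum>i<L. \<Sum>l<L. h i l) = h 0 0 + (\<Sum>l=1..<L. h 0 l) + (\<Sum>i=1..<L. h i 0) + (\<Sum>i=1..<L. \<Sum>l=1..<L. h i l)"
    for h :: "nat \<Rightarrow> nat \<Rightarrow> real"
    unfolding sum_lessThan_split0[OF L0] sum.distrib by simp
  have S0': "(\<Sum>i=1..<L. f i 0) = S0" unfolding S0_def by (intro sum.cong refl sym) simp
  have F: "F = F00 + 2 * S0 + SS"
    unfolding F_def fdim_Suc_Suc f_def[symmetric] split S0' F00_def SS_def S0_def by simp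
  have N: "N = S0 + N'"
  proof -
    have "N = (\<Sum>i<L. \<Sum>l<L. if l < i then f i l else 0)"
      unfolding N_def ndes_def f_def by (intro sum.cong refl) auto
    also have "\<dots> = (\<Sum>i=1..<L. f i 0) + N'" unfolding split N'_def by simp
    finally show ?thesis using S0' by simp
  qed
  have xs: "xsum L q (Suc M) \<alpha> \<le> x0 * F00 + (1 + q) * x1 * S0 + x2 * (SS - (1 - q) * N')"
  proof -
    define h where "h i l = (if ?ok i l then (if i \<le> l then 1 else q) * xsum L q M (?b i l) else 0)" for i l
    have hb: "h i l \<le> (if i \<le> l then 1 else q) * (two_row_value q M (?b i l 0 - M) * f i l)" for i l
    proof (cases "?ok i l")
      case True
      have A: "xsum L q M (?b i l) \<le> two_row_value q M (?b i l 0 - M) * fdim L (2 * M) (?b i l)"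
        using IH[of "?b i l"] shape_dec[OF shape_dec[OF sh2]] is_part_dec[OF is_part_dec[OF pt]] True by simp
      show ?thesis using True A mult_left_mono[OF A q(1)] by (cases "i \<le> l") (simp_all add: h_def f_def)
    next
      case False
      then have "h i l = 0" "f i l = 0" unfolding h_def f_def by (simp_all only: if_False)
      then show ?thesis by simp
    qed
    have v00: "?b 0 0 0 - M = j - 1" using a by (simp add: dec_def)
    have v0: "?b 0 l 0 - M = j" "?b l 0 0 - M = j" if "1 \<le> l" for l using a that by (auto simp: dec_def)
    have v: "?b i l 0 - M = Suc j" if "1 \<le> i" "1 \<le> l" for i l using a that by (auto simp: dec_def)
    have 00: "h 0 0 \<le> x0 * F00" using hb[of 0 0] v00 by (simp add: x0_def F00_def)
    have 01: "(\<Sum>l=1..<L. h 0 l) \<le> x1 * S0"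
      unfolding S0_def sum_distrib_left by (intro sum_mono) (use hb[of 0] v0(1) in \<open>fastforce simp: x1_def\<close>)
    have 10: "(\<Sum>i=1..<L. h i 0) \<le> q * x1 * S0"
    proof -
      have "(\<Sum>i=1..<L. h i 0) \<le> (\<Sum>i=1..<L. q * x1 * f i 0)"
      proof (rule sum_mono)
        fix i assume "i \<in> {1..<L}"
        then have "1 \<le> i" by simp
        then show "h i 0 \<le> q * x1 * f i 0" using hb[of i 0] v0(2)[of i] by (simp add: x1_def)
      qed
      then show ?thesis by (simp only: sum_distrib_left[symmetric] S0')
    qed
    have 11: "(\<Sum>i=1..<L. \<Sum>l=1..<L. h i l) \<le> x2 * (SS - (1 - q) * N')"
    proof -
      have "(\<Sum>i=1..<L. \<Sum>l=1..<L. h i l)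
          \<le> (\<Sum>i=1..<L. \<Sum>l=1..<L. x2 * f i l - x2 * (1 - q) * (if l < i then f i l else 0))"
      proof (intro sum_mono)
        fix i l assume "i \<in> {1..<L}" "l \<in> {1..<L}"
        then have "1 \<le> i" "1 \<le> l" by auto
        then show "h i l \<le> x2 * f i l - x2 * (1 - q) * (if l < i then f i l else 0)"
          using hb[of i l] v[of i l] by (auto simp: x2_def algebra_simps split: if_splits)
      qed
      also have "\<dots> = x2 * (SS - (1 - q) * N')"
        unfolding SS_def N'_def sum_subtractf sum_distrib_left[symmetric] by (simp add: algebra_simps)
      finally show ?thesis .
    qed
    have "xsum L q (Suc M) \<alpha> = h 0 0 + (\<Sum>l=1..<L. h 0 l) + (\<Sum>i=1..<L. h i 0) + (\<Sum>i=1..<L. \<Sum>l=1..<L. h i l)"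
      unfolding xsum.simps h_def[symmetric] by (rule split)
    then show ?thesis using 00 01 10 11 by (simp add: algebra_simps)
  qed
  also have "\<dots> \<le> two_row_value q (Suc M) j * F"
  proof (rule weighted_compare[OF x q _ F N])
    let ?D = "ballot 2 (Suc M) (int j)"
    define c J m where "c = (2 * real M + 2) * (2 * real M + 1) * (2 * real j + 1)" and "J = real j" and "m = real M + 1"
    have J: "0 \<le> J" "J + 2 \<le> m" using jM by (auto simp: J_def m_def)
    have cpos: "0 < c" unfolding c_def by (intro mult_pos_pos) auto
    have c: "c = 2 * m * (2 * m - 1) * (2 * J + 1)" by (simp add: c_def m_def J_def)
    show D: "0 < ?D" using ballot_2_pos[of "int j" "Suc M"] jM by simp
    show "?D = ballot 2 M (int j - 1) + 2 * ballot 2 M (int j) + ballot 2 M (int j + 1)"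
      by (rule ballot_Suc)
    have F0: "0 \<le> F" "0 \<le> F00" using fnn by (simp_all add: F_def F00_def fdim_nonneg del: fdim.simps)
    define In where "In = in_row L (Suc (2 * M)) \<alpha>"
    define Out where "Out = out_row L (Suc (2 * M)) \<alpha>"
    have FIO: "F = In + Out" unfolding F_def In_def Out_def by (rule fdim_split[OF L0])
    have R1: "(2 * J) * (m + J + 1) * F \<le> (2 * J + 1) * (2 * m) * In"
    proof -
      have "(m + J - (m - J)) * (m + J + 1) * F \<le> (m + J - (m - J) + 1) * (m + J + (m - J)) * In"
        unfolding F_def In_def by (rule first_row_ratio[OF L0 sh2 pt]) (use a in \<open>auto simp: m_def J_def\<close>)
      then show ?thesis by simp
    qed
    have R2: "(2 * J - 1) * (m + J) * In \<le> (2 * J) * (2 * m - 1) * F00" if j: "1 \<le> j"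
    proof -
      have "(m + J - 1 - (m - J)) * (m + J - 1 + 1) * fdim L (Suc (2 * M)) (dec \<alpha> 0)
          \<le> (m + J - 1 - (m - J) + 1) * (m + J - 1 + (m - J)) * in_row L (2 * M) (dec \<alpha> 0)"
        by (rule first_row_ratio[OF L0 shape_dec[OF sh2 c0] is_part_dec[OF pt c0]])
           (use a j in \<open>auto simp: m_def J_def dec_def\<close>)
      moreover have "in_row L (2 * M) (dec \<alpha> 0) = F00" using c0 by (simp add: in_row_def F00_def f_def)
      moreover have "fdim L (Suc (2 * M)) (dec \<alpha> 0) = In" using c0 by (simp add: In_def in_row_def del: fdim.simps)
      ultimately show ?thesis by simp
    qed
    show "ballot 2 M (int j - 1) * F \<le> ?D * F00"
    proof (cases "j = 0")
      case True
      have "ballot 2 M 0 > 0" using ballot_2_pos[of 0 M] by simp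
      then have "ballot 2 M (int j - 1) * F \<le> 0" using True F0 ballot_minus_1[of 2 M] by simp
      also have "0 \<le> ?D * F00" using D F0 by simp
      finally show ?thesis .
    next
      case False
      then have j: "1 \<le> j" "1 \<le> J" by (auto simp: J_def)
      have e: "c * ballot 2 M (int j - 1) = (2 * J - 1) * (m + J) * (m + J + 1) * ?D"
        using ballot_2_level_down[of "int j" M] j jM by (simp add: c_def J_def m_def algebra_simps)
      have "(2 * J) * ((2 * J - 1) * (m + J) * (m + J + 1) * F) = (2 * J - 1) * (m + J) * ((2 * J) * (m + J + 1) * F)" by simp
      also have "\<dots> \<le> (2 * J - 1) * (m + J) * ((2 * J + 1) * (2 * m) * In)"
        using R1 j J by (intro mult_left_mono) auto
      also have "\<dots> = ((2 * J + 1) * (2 * m)) * ((2 * J - 1) * (m + J) * In)" by simp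
      also have "\<dots> \<le> ((2 * J + 1) * (2 * m)) * ((2 * J) * (2 * m - 1) * F00)"
        using R2[OF j(1)] J by (intro mult_left_mono) auto
      also have "\<dots> = (2 * J) * (c * F00)" unfolding c by simp
      finally have "(2 * J - 1) * (m + J) * (m + J + 1) * F \<le> c * F00"
        using j by (subst (asm) mult_le_cancel_left_pos) auto
      then have "?D * ((2 * J - 1) * (m + J) * (m + J + 1) * F) \<le> ?D * (c * F00)"
        using D by (intro mult_left_mono) auto
      then have "c * (ballot 2 M (int j - 1) * F) \<le> c * (?D * F00)"
        unfolding mult.assoc[symmetric] e by (simp add: algebra_simps)
      then show ?thesis using cpos by (simp only: mult_le_cancel_left_pos)
    qed
    show "?D * SS \<le> ballot 2 M (int j + 1) * F"
    proof -
      \<comment> \<open>The complement of \<open>first_row_ratio\<close> for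
        \<open>dec \<alpha> i\<close>: the share of tableaux whose next entry is outside the first
        row as well.\<close>
      have s1: "(2 * J + 2) * (2 * m - 1) * SS \<le> (m - J - 1) * (2 * J + 3) * Out"
        unfolding SS_def Out_def out_row_def sum_distrib_left
      proof (rule sum_mono)
        fix i assume "i \<in> {1..<L}"
        then have i: "1 \<le> i" by simp
        have "(2 * J + 2) * (2 * m - 1) * (\<Sum>l=1..<L. f i l)
            \<le> (m - J - 1) * (2 * J + 3) * (if corner \<alpha> i then fdim L (Suc (2 * M)) (dec \<alpha> i) else 0)"
        proof (cases "corner \<alpha> i")
          case True
          have o: "(\<Sum>l=1..<L. f i l) = out_row L (2 * M) (dec \<alpha> i)"
            using True by (simp add: f_def out_row_def)
          have "(m + J - (m - J - 1)) * (m + J + 1) * fdim L (Suc (2 * M)) (dec \<alpha> i)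
              \<le> (m + J - (m - J - 1) + 1) * (m + J + (m - J - 1)) * in_row L (2 * M) (dec \<alpha> i)"
            by (rule first_row_ratio[OF L0 shape_dec[OF sh2 True] is_part_dec[OF pt True]])
               (use a dec_0_other[OF i, of \<alpha>] in \<open>auto simp: m_def J_def\<close>)
          then have "(2 * J + 1) * (m + J + 1) * fdim L (Suc (2 * M)) (dec \<alpha> i)
              \<le> (2 * J + 2) * (2 * m - 1) * in_row L (2 * M) (dec \<alpha> i)" by (simp add: algebra_simps)
          then show ?thesis
            unfolding o using True fdim_split[OF L0, of "2 * M" "dec \<alpha> i"]
            by (simp add: algebra_simps del: fdim.simps)
        next
          case False
          then show ?thesis by (simp add: f_def)
        qed
        then show "(\<Sum>l=1..<L. (2 * J + 2) * (2 * m - 1) * f i l)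
            \<le> (m - J - 1) * (2 * J + 3) * (if corner \<alpha> i then fdim L (Suc (2 * M)) (dec \<alpha> i) else 0)"
          by (simp only: sum_distrib_left)
      qed
      have s2: "(2 * J + 1) * (2 * m) * Out \<le> (m - J) * (2 * J + 2) * F"
        using R1 unfolding FIO by (simp add: algebra_simps)
      have e: "c * ballot 2 M (int j + 1) = (2 * J + 3) * (m - J - 1) * (m - J) * ?D"
        using ballot_2_level_up[of "int j" M] by (simp add: c_def J_def m_def algebra_simps)
      have "(2 * J + 2) * (c * SS) = ((2 * J + 1) * (2 * m)) * ((2 * J + 2) * (2 * m - 1) * SS)" unfolding c by simp
      also have "\<dots> \<le> ((2 * J + 1) * (2 * m)) * ((m - J - 1) * (2 * J + 3) * Out)"
        using s1 J by (intro mult_left_mono) auto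
      also have "\<dots> = ((m - J - 1) * (2 * J + 3)) * ((2 * J + 1) * (2 * m) * Out)" by simp
      also have "\<dots> \<le> ((m - J - 1) * (2 * J + 3)) * ((m - J) * (2 * J + 2) * F)"
        using s2 J by (intro mult_left_mono) auto
      also have "\<dots> = (2 * J + 2) * ((2 * J + 3) * (m - J - 1) * (m - J) * F)" by simp
      finally have "c * SS \<le> (2 * J + 3) * (m - J - 1) * (m - J) * F"
        using J by (subst (asm) mult_le_cancel_left_pos) auto
      then have "?D * (c * SS) \<le> ?D * ((2 * J + 3) * (m - J - 1) * (m - J) * F)"
        using D by (intro mult_left_mono) auto
      then have "c * (?D * SS) \<le> c * (ballot 2 M (int j + 1) * F)"
        unfolding mult.assoc[symmetric] e by (simp add: algebra_simps)
      then show ?thesis using cpos by (simp only: mult_le_cancel_left_pos)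
    qed
    show "ballot 2 M (int j) * F \<le> ?D * N"
    proof -
      have "(2 * real M + 2 - real (\<alpha> 0)) * (real (\<alpha> 0) + 1) * F \<le> (2 * real M + 2) * (2 * real M + 1) * N"
        using ndes_ge[OF L0 sh2 pt, of "\<alpha> 0"] a by (simp add: F_def N_def del: fdim.simps)
      moreover have ra: "real (\<alpha> 0) = m + J" using a by (simp add: m_def J_def)
      ultimately have n: "(m - J) * (m + J + 1) * F \<le> 2 * m * (2 * m - 1) * N"
        unfolding ra by (simp add: m_def algebra_simps)
      have e: "2 * m * (2 * m - 1) * ballot 2 M (int j) = (m - J) * (m + J + 1) * ?D"
        using ballot_2_level[of "int j" M] by (simp add: J_def m_def algebra_simps)
      have p: "0 < 2 * m * (2 * m - 1)" unfolding m_def by (intro mult_pos_pos) auto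
      have "?D * ((m - J) * (m + J + 1) * F) \<le> ?D * (2 * m * (2 * m - 1) * N)"
        using n D by (intro mult_left_mono) auto
      then have "2 * m * (2 * m - 1) * (ballot 2 M (int j) * F) \<le> 2 * m * (2 * m - 1) * (?D * N)"
        unfolding mult.assoc[symmetric, of "2 * m * (2 * m - 1)"] e by (simp add: algebra_simps)
      then show ?thesis using p by (simp only: mult_le_cancel_left_pos)
    qed
    show "two_row_value q (Suc M) j * ?D = x0 * ballot 2 M (int j - 1) + (1 + q) * x1 * ballot 2 M (int j)
        + x2 * ballot 2 M (int j + 1)"
    proof -
      have v1: "x1 * ballot 2 M (int j) = ballot (1 + q) M (int j)"
        using two_row_value_eq[of j M q] jM by (simp add: x1_def)
      have v2: "x2 * ballot 2 M (int j + 1) = ballot (1 + q) M (int j + 1)"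
        using two_row_value_eq[of "Suc j" M q] jM by (simp add: x2_def add.commute)
      have v0: "x0 * ballot 2 M (int j - 1) = ballot (1 + q) M (int j - 1)"
      proof (cases "j = 0")
        case True
        then show ?thesis using two_row_value_eq[of 0 M q] ballot_minus_1[of 2 M] ballot_minus_1[of "1 + q" M]
          by (simp add: x0_def)
      next
        case False
        then have "int (j - 1) = int j - 1" by simp
        then show ?thesis using two_row_value_eq[of "j - 1" M q] jM by (simp add: x0_def)
      qed
      have "two_row_value q (Suc M) j * ?D = ballot (1 + q) (Suc M) (int j)"
        using two_row_value_eq[of j "Suc M" q] jM by simp
      also have "\<dots> = ballot (1 + q) M (int j - 1) + (1 + q) * ballot (1 + q) M (int j) + ballot (1 + q) M (int j + 1)"
        by (rule ballot_Suc)
      finally show ?thesis using v0 v1 v2 by simp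
    qed
  qed
  finally show ?thesis by (simp add: F_def del: fdim.simps)
qed

section \<open>The base case of size 6\<close>

lemma sum_lessThan_indep:
  fixes f :: "nat \<Rightarrow> 'a :: comm_monoid_add"
  assumes "\<And>i. L \<le> i \<Longrightarrow> f i = 0" "\<And>i. K \<le> i \<Longrightarrow> f i = 0"
  shows "(\<Sum>i<L. f i) = (\<Sum>i<K. f i)"
proof -
  have "(\<Sum>i<max L K. f i) = (\<Sum>i<L. f i)" by (rule sum.mono_neutral_right) (use assms(1) in auto)
  moreover have "(\<Sum>i<max L K. f i) = (\<Sum>i<K. f i)" by (rule sum.mono_neutral_right) (use assms(2) in auto)
  ultimately show ?thesis by simp
qed

text \<open>Rows beyond the shape contribute nothing, so the base case can be computed with six
  rows.\<close>

lemma xsum_indep: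
  assumes "\<And>i. L \<le> i \<Longrightarrow> \<alpha> i = 0" "\<And>i. K \<le> i \<Longrightarrow> \<alpha> i = 0"
  shows "xsum L q m \<alpha> = xsum K q m \<alpha>"
  using assms
proof (induction m arbitrary: \<alpha>)
  case (Suc m)
  let ?h = "\<lambda>R i j. if corner \<alpha> i \<and> corner (dec \<alpha> i) j then (if i \<le> j then 1 else q) * xsum R q m (dec (dec \<alpha> i) j) else 0"
  have "xsum L q m (dec (dec \<alpha> i) j) = xsum K q m (dec (dec \<alpha> i) j)" for i j
    by (rule Suc.IH) (simp_all add: dec_def Suc.prems)
  then have hLK: "?h L i j = ?h K i j" for i j by (simp only:)
  have nc: "\<not> corner \<alpha> i" "\<not> corner (dec \<alpha> j) i" if "L \<le> i \<or> K \<le> i" for i j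
    using that Suc.prems by (auto simp: corner_def dec_def)
  have "xsum L q (Suc m) \<alpha> = (\<Sum>i<L. \<Sum>j<L. ?h K i j)" unfolding xsum.simps hLK ..
  also have "\<dots> = (\<Sum>i<L. \<Sum>j<K. ?h K i j)"
    by (intro sum.cong refl sum_lessThan_indep) (auto simp: nc)
  also have "\<dots> = (\<Sum>i<K. \<Sum>j<K. ?h K i j)"
    by (rule sum_lessThan_indep) (auto simp: nc)
  finally show ?case by simp
qed simp

definition ldec :: "nat list \<Rightarrow> nat \<Rightarrow> nat list" where
  "ldec xs i = xs[i := xs ! i - 1]"

text \<open>The appended 0 stands for the row below the last list entry.\<close>

definition lcorner :: "nat list \<Rightarrow> nat \<Rightarrow> bool" where
  "lcorner xs i \<longleftrightarrow> (xs @ [0]) ! Suc i < xs ! i"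

lemma corner_part_fun: "i < length xs \<Longrightarrow> corner (part_fun xs) i \<longleftrightarrow> lcorner xs i"
  by (auto simp: corner_def part_fun_def lcorner_def nth_append)

lemma dec_part_fun: "i < length xs \<Longrightarrow> dec (part_fun xs) i = part_fun (ldec xs i)"
  by (auto simp: dec_def part_fun_def ldec_def fun_eq_iff)

lemma xsum_list:
  assumes "length xs = K"
  shows "xsum K q (Suc m) (part_fun xs) = (\<Sum>i\<leftarrow>[0..<K]. \<Sum>j\<leftarrow>[0..<K]. if lcorner xs i \<and> lcorner (ldec xs i) j
     then (if i \<le> j then 1 else q) * xsum K q m (part_fun (ldec (ldec xs i) j)) else 0)"
proof -
  have l: "length (ldec xs i) = K" for i using assms by (simp add: ldec_def)
  have "xsum K q (Suc m) (part_fun xs) = (\<Sum>i<K. \<Sum>j<K. if lcorner xs i \<and> lcorner (ldec xs i) j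
     then (if i \<le> j then 1 else q) * xsum K q m (part_fun (ldec (ldec xs i) j)) else 0)"
    unfolding xsum.simps using assms l by (intro sum.cong refl) (auto simp: corner_part_fun dec_part_fun)
  then show ?thesis by (simp add: sum_list_distinct_conv_sum_set atLeast0LessThan)
qed

text \<open>The sums are evaluated level by level as polynomials in \<open>q\<close>, each level
  listing the shapes that the next one needs.\<close>

lemma xsum_1:
  "xsum 6 q (Suc 0) (part_fun [2,0,0,0,0,0]) = 1"
  "xsum 6 q (Suc 0) (part_fun [1,1,0,0,0,0]) = q"
  by (simp_all add: xsum_list lcorner_def ldec_def upt_rec del: xsum.simps(2))

lemma xsum_2:
  "xsum 6 q (Suc (Suc 0)) (part_fun [4,0,0,0,0,0]) = 1"
  "xsum 6 q (Suc (Suc 0)) (part_fun [3,1,0,0,0,0]) = 1 + 2 * q"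
  "xsum 6 q (Suc (Suc 0)) (part_fun [2,2,0,0,0,0]) = 1 + q^2"
  "xsum 6 q (Suc (Suc 0)) (part_fun [2,1,1,0,0,0]) = 2 * q + q^2"
  "xsum 6 q (Suc (Suc 0)) (part_fun [1,1,1,1,0,0]) = q^2"
  by (simp_all add: xsum_list[where m = "Suc 0"] lcorner_def ldec_def upt_rec xsum_1[unfolded One_nat_def] power2_eq_square algebra_simps del: xsum.simps(2))

lemma xsum_3:
  "xsum 6 q (Suc (Suc (Suc 0))) (part_fun [4,1,1,0,0,0]) = 1 + 6 * q + 3 * q^2"
  "xsum 6 q (Suc (Suc (Suc 0))) (part_fun [3,2,1,0,0,0]) = 2 + 6 * q + 6 * q^2 + 2 * q^3"
  "xsum 6 q (Suc (Suc (Suc 0))) (part_fun [3,1,1,1,0,0]) = 3 * q + 6 * q^2 + q^3"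
  "xsum 6 q (Suc (Suc (Suc 0))) (part_fun [2,2,2,0,0,0]) = 1 + 3 * q^2 + q^3"
  "xsum 6 q (Suc (Suc (Suc 0))) (part_fun [2,2,1,1,0,0]) = 3 * q + 3 * q^2 + 3 * q^3"
  "xsum 6 q (Suc (Suc (Suc 0))) (part_fun [2,1,1,1,1,0]) = 3 * q^2 + 2 * q^3"
  "xsum 6 q (Suc (Suc (Suc 0))) (part_fun [1,1,1,1,1,1]) = q^3"
  by (simp_all add: xsum_list[where m = "Suc (Suc 0)"] lcorner_def ldec_def upt_rec xsum_2[unfolded One_nat_def] power2_eq_square power3_eq_cube algebra_simps del: xsum.simps(2))

lemma two_row_value_3:
  "two_row_value q 3 0 = (q^3 + 3 * q + 1) / 5"
  "two_row_value q 3 (Suc 0) = (q^2 + q + 1) / 3"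
  by (simp_all add: two_row_value_def ballot_def eval_nat_numeral field_simps)

lemma xsum_le_3:
  assumes L: "3 \<le> L" and q: "0 \<le> q" "q \<le> 1" and sh: "shape L 6 \<alpha>" and pt: "is_part \<alpha>" and a2: "0 < \<alpha> 2"
  shows "xsum L q 3 \<alpha> \<le> two_row_value q 3 (\<alpha> 0 - 3) * fdim L 6 \<alpha>"
proof -
  have a6: "\<alpha> 6 = 0"
  proof (rule ccontr)
    assume "\<alpha> 6 \<noteq> 0"
    then have "6 < L" using sh by (metis not_le shape_def)
    have "7 = (\<Sum>i<(7::nat). 1::nat)" by simp
    also have "\<dots> \<le> (\<Sum>i<7. \<alpha> i)"
    proof (rule sum_mono)
      fix i :: nat assume "i \<in> {..<7}"
      then have "\<alpha> 6 \<le> \<alpha> i" by (intro is_part_mono[OF pt]) simp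
      then show "1 \<le> \<alpha> i" using \<open>\<alpha> 6 \<noteq> 0\<close> by simp
    qed
    also have "\<dots> \<le> (\<Sum>i<L. \<alpha> i)" by (rule sum_mono2) (use \<open>6 < L\<close> in auto)
    finally show False using sh by (simp add: shape_def)
  qed
  have z: "\<alpha> i = 0" if "6 \<le> i" for i using is_part_mono[OF pt that] a6 by simp
  have zL: "\<alpha> i = 0" if "L \<le> i" for i using sh that by (simp add: shape_def)
  have "(\<Sum>i<6. \<alpha> i) = (\<Sum>i<L. \<alpha> i)" by (rule sum_lessThan_indep) (use z zL in auto)
  then have sum: "\<alpha> 0 + \<alpha> 1 + \<alpha> 2 + \<alpha> 3 + \<alpha> 4 + \<alpha> 5 = 6"
    using sh by (simp add: shape_def eval_nat_numeral)
  define xs where "xs = [\<alpha> 0, \<alpha> 1, \<alpha> 2, \<alpha> 3, \<alpha> 4, \<alpha> 5]"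
  have pf: "\<alpha> = part_fun xs"
  proof
    fix i :: nat
    consider "i = 0" | "i = 1" | "i = 2" | "i = 3" | "i = 4" | "i = 5" | "6 \<le> i" by linarith
    then show "\<alpha> i = part_fun xs i" using z by cases (auto simp: part_fun_def xs_def)
  qed
  have mono: "\<alpha> 1 \<le> \<alpha> 0" "\<alpha> 2 \<le> \<alpha> 1" "\<alpha> 3 \<le> \<alpha> 2" "\<alpha> 4 \<le> \<alpha> 3" "\<alpha> 5 \<le> \<alpha> 4"
    by (rule is_part_mono[OF pt]; simp)+
  have "\<alpha> 1 = 1 \<or> \<alpha> 1 = 2" "\<alpha> 2 = 1 \<or> \<alpha> 2 = 2" "\<alpha> 3 = 0 \<or> \<alpha> 3 = 1" "\<alpha> 4 = 0 \<or> \<alpha> 4 = 1" "\<alpha> 5 = 0 \<or> \<alpha> 5 = 1"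
    using sum mono a2 by linarith+
  then have cs: "xs \<in> {[4,1,1,0,0,0], [3,2,1,0,0,0], [3,1,1,1,0,0], [2,2,2,0,0,0], [2,2,1,1,0,0], [2,1,1,1,1,0], [1,1,1,1,1,1]}"
    using sum mono unfolding xs_def by (elim disjE) simp_all
  have X: "xsum L r 3 \<alpha> = xsum 6 r 3 (part_fun xs)" for r
    unfolding pf[symmetric] by (rule xsum_indep) (use z zL in auto)
  have F: "fdim L 6 \<alpha> = xsum 6 1 3 (part_fun xs)" using fdim_eq_xsum[of L 3 \<alpha>] X[of 1] by simp
  have \<alpha>0: "\<alpha> 0 = xs ! 0" by (simp add: xs_def)
  \<comment> \<open>Up to positive constants these are the differences of the two sides for the
    seven shapes in \<open>cs\<close>, in the same order.\<close>
  have p: "0 \<le> (1 - q) * (7 - q)" "0 \<le> (1 - q) * (1 + 4 * q - q^2)" "0 \<le> (1 - q) * (2 + 5 * q - q^2)"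
    "0 \<le> q * (1 - q)" "0 \<le> (1 - q) * (2 * q^2 + 7 * q + 3)" "0 \<le> (1 - q) * (1 + 4 * q + q^2)"
    "0 \<le> (1 - q) * (1 + 4 * q + 4 * q^2)"
    using q power_le_one[of q 2] by (auto intro!: mult_nonneg_nonneg)
  show ?thesis
    unfolding X F \<alpha>0 using cs
    by (elim insertE emptyE)
       (use p in \<open>simp_all add: xsum_3[folded numeral_3_eq_3, unfolded One_nat_def] two_row_value_3 field_simps power2_eq_square power3_eq_cube\<close>)
qed

text \<open>The truncated difference \<open>\<alpha> 0 - m\<close> encodes the first row
  max(\<alpha> 0, m). Two-row shapes have first row at least m and give equality, so the induction
  concerns shapes with a third row.\<close>

theorem xsum_le_two_row:
  assumes L: "3 \<le> L" and q: "0 \<le> q" "q \<le> 1" and m: "3 \<le> m"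
    and "shape L (2 * m) \<alpha>" "is_part \<alpha>"
  shows "xsum L q m \<alpha> \<le> two_row_value q m (\<alpha> 0 - m) * fdim L (2 * m) \<alpha>"
  using m assms(5,6)
proof (induction m arbitrary: \<alpha> rule: nat_induct_at_least)
  case base
  show ?case
  proof (cases "\<alpha> 2 = 0")
    case True
    have "2 \<le> L" using L by simp
    note t = two_row_shape[OF base True this]
    have "\<alpha> 1 \<le> \<alpha> 0" by (rule is_part_mono[OF base(2)]) simp
    then have "xsum L q 3 (two_row (\<alpha> 0) (\<alpha> 1))
        = two_row_value q 3 (\<alpha> 0 - 3) * fdim L (2 * 3) (two_row (\<alpha> 0) (\<alpha> 1))"
      by (intro xsum_two_row_value t(2)) (use L in auto)
    then show ?thesis unfolding t(1)[symmetric] by (rule eq_refl)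
  next
    case False
    then show ?thesis using xsum_le_3[OF L q _ base(2)] base(1) by simp
  qed
next
  case (Suc M)
  show ?case
  proof (cases "\<alpha> 2 = 0")
    case True
    have "2 \<le> L" using L by simp
    note t = two_row_shape[OF Suc.prems True this]
    have "\<alpha> 1 \<le> \<alpha> 0" by (rule is_part_mono[OF Suc.prems(2)]) simp
    then have "xsum L q (Suc M) (two_row (\<alpha> 0) (\<alpha> 1))
        = two_row_value q (Suc M) (\<alpha> 0 - Suc M) * fdim L (2 * (Suc M)) (two_row (\<alpha> 0) (\<alpha> 1))"
      by (intro xsum_two_row_value t(2)) (use L in auto)
    then show ?thesis unfolding t(1)[symmetric] by (rule eq_refl)
  next
    case False
    show ?thesis
    proof (cases "\<alpha> 0 \<le> M")
      case True
      have "xsum L q (Suc M) \<alpha> \<le> two_row_value q (Suc M) 0 * fdim L (2 * Suc M) \<alpha>"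
      proof (rule xsum_step_narrow[OF _ q Suc.hyps(1) Suc.prems True])
        show "xsum L q M \<beta> \<le> two_row_value q M (\<beta> 0 - M) * fdim L (2 * M) \<beta>"
          if "shape L (2 * M) \<beta>" "is_part \<beta>" for \<beta> by (rule Suc.IH[OF that])
      qed (use L in simp)
      moreover have "\<alpha> 0 - Suc M = 0" using True by simp
      ultimately show ?thesis by (simp only:)
    next
      case wide: False
      define j where "j = \<alpha> 0 - Suc M"
      have j: "\<alpha> 0 = Suc M + j" using wide by (simp add: j_def)
      have "xsum L q (Suc M) \<alpha> \<le> two_row_value q (Suc M) j * fdim L (2 * Suc M) \<alpha>"
      proof (rule xsum_step_wide[OF L q Suc.hyps(1) Suc.prems j])
        show "xsum L q M \<beta> \<le> two_row_value q M (\<beta> 0 - M) * fdim L (2 * M) \<beta>"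
          if "shape L (2 * M) \<beta>" "is_part \<beta>" for \<beta> by (rule Suc.IH[OF that])
      qed (use False in simp)
      then show ?thesis unfolding j_def .
    qed
  qed
qed

section \<open>Return to characters and to the shape [n/2, n/2]\<close>

theorem mainTheorem7:
  fixes n :: nat and p :: real and lam :: "nat list"
  assumes "even n"
    and "1 / 2 \<le> p" and "p \<le> 1"
    and "partition_of n lam"
    and "first_col lam \<le> first_row lam"
    and "first_row lam < n div 2"
  shows "psi n p lam \<le> psi n p [n div 2, n div 2]"
proof -
  obtain m where n: "n = 2 * m" using assms(1) by (elim evenE)
  \<comment> \<open>\<open>length lam + 3\<close> leaves room for the three rows required by
    \<open>xsum_le_two_row\<close> and for the shape [m, m].\<close>
  define q L where "q = 2 * p - 1" and "L = length lam + 3"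
  have q: "0 \<le> q" "q \<le> 1" using assms(2,3) by (auto simp: q_def)
  let ?\<alpha> = "part_fun lam"
  have pl: "partition_of (2 * m) lam" using assms(4) n by simp
  have sp: "shape L (2 * m) ?\<alpha>" "is_part ?\<alpha>"
    using part_fun_shape[OF pl, of L] by (auto simp: L_def)
  have fr: "?\<alpha> 0 = first_row lam" by (auto simp: part_fun_def first_row_def split: list.splits)
  have am: "?\<alpha> 0 < m" "length lam < m" using assms(5,6) n fr by (auto simp: first_col_def)
  \<comment> \<open>The bounds on first row and first column fit the diagram into a square of side m
    - 1, and 2 m \<le> (m - 1)^2 with first row below m rules out m < 3.\<close>
  have "2 * m = (\<Sum>i<length lam. ?\<alpha> i)"
    using part_fun_shape(1)[OF pl order_refl] by (simp add: shape_def)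
  also have "\<dots> \<le> length lam * ?\<alpha> 0"
    using sum_bounded_above[of "{..<length lam}" ?\<alpha> "?\<alpha> 0"] is_part_mono[OF sp(2), of 0] by simp
  also have "\<dots> \<le> (m - 1) * (m - 1)" using am by (intro mult_mono) auto
  finally have m3: "3 \<le> m"
  proof (rule contrapos_pp)
    assume "\<not> 3 \<le> m"
    then consider "m = 0" | "m = 1" | "m = 2" by linarith
    then show "\<not> 2 * m \<le> (m - 1) * (m - 1)" using am by cases auto
  qed
  have F: "0 < fdim L (2 * m) ?\<alpha>" by (rule fdim_pos[OF sp])
  have "xsum L q m ?\<alpha> \<le> two_row_value q m 0 * fdim L (2 * m) ?\<alpha>"
    using xsum_le_two_row[OF _ q m3 sp] am by (simp add: L_def)
  then have le: "xsum L q m ?\<alpha> / fdim L (2 * m) ?\<alpha> \<le> two_row_value q m 0"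
    using F by (simp add: divide_le_eq)
  have pm: "partition_of (2 * m) [m, m]" using m3 by (simp add: partition_of_def)
  have pf: "part_fun [m, m] = two_row m m"
    by (auto simp: part_fun_def two_row_def fun_eq_iff less_Suc_eq nth_Cons')
  have "0 < fdim L (2 * m) (two_row m m)"
    using fdim_pos part_fun_shape[OF pm, of L] pf by (simp add: L_def)
  then have "xsum L q m (two_row m m) / fdim L (2 * m) (two_row m m) = two_row_value q m 0"
    using xsum_two_row_value[of L m m m q] by (simp add: L_def)
  then have "psi n p [n div 2, n div 2] = of_real (two_row_value q m 0)"
    using psi_eq[OF pm, of L p] pf n by (simp add: q_def L_def)
  moreover have "psi n p lam = of_real (xsum L q m ?\<alpha> / fdim L (2 * m) ?\<alpha>)"
    using psi_eq[OF pl, of L p] n by (simp add: q_def L_def)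
  \<comment> \<open>Both values are real, where the order on complex numbers is the usual
    one.\<close>
  ultimately show ?thesis using le by (simp add: less_eq_complex_def)
qed

end
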